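(* Suppose $\phi:X=[0,1]\to\mathbb{R}$ is of bounded variation with $\int_X\phi\,d\mu=0$ and asymptotic variance $\sigma^2>0$, and define $S_n=\sum_{j=0}^{n-1}\phi_\pi\circ\tau^j$ on $\Omega^\star$. Let $I$ be the rate function of the annealed large deviation principle associated to $\phi$, let $\alpha>0$ be in the domain where this principle holds, and set $$l_n=l_n(\alpha)=\left[\frac{\log n}{I(\alpha)}\right],\qquad n\in\mathbb{N},$$ where $[\cdot]$ is the integer part. Then, for $\mu_c$-a.e. point of $\Omega^\star$, $$\lim_{n\to\infty}\max_{0\le m\le n-l_n}\frac{S_{l_n}\circ\tau^m}{l_n}=\alpha.$$
   Context: Random system. $X=[0,1]$, $m$ is Lebesgue measure, and $(\Omega,\mathcal{T},\mathbb{P})$ is a probability space; to each $\omega\in\Omega$ is associated a piecewise $C^2$ map $T_\omega:X\to X$, non-singular with respect to $m$, with $(\omega,x)\mapsto T_\omega(x)$ measurable, and there is a uniform upper bound $L>0$ for the derivatives of all the $T_\omega$. Set $\tilde\Omega=\Omega^{\mathbb{N}}$, with elements $\underline\omega=(\omega_1,\omega_2,\ldots)$, and $\tilde{\mathbb{P}}=\mathbb{P}^{\otimes\mathbb{N}}$. The transfer operator $P_\omega$ of $T_\omega$ acts on $L^1(m)$ and is characterized by $\int P_\omega f\,g\,dm=\int f\,(g\circ T_\omega)\,dm$; the annealed operators are $P=\int_\Omega P_\omega\,d\mathbb{P}(\omega)$ and $Ug(x)=\int_\Omega g(T_\omega x)\,d\mathbb{P}(\omega)$. Standing assumptions, with $\mathcal{B}=\mathrm{BV}$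 the space of functions of bounded variation on $[0,1]$ with norm $\|f\|=\|f\|_{L^1(m)}+\mathrm{Var}(f)$ (variation minimized over a.e.-equal representatives): $P$ maps $\mathcal{B}$ continuously into itself; there are $N\ge1$, $\rho<1$, $K\ge0$ with $\|P^Nf\|\le\rho\|f\|+K\|f\|_{L^1(m)}$ for all $f\in\mathcal{B}$; and $1$ is a simple isolated eigenvalue of $P$ on $\mathcal{B}$, with no other eigenvalue on the unit circle. Then $\mu$ denotes the unique probability measure absolutely continuous with respect to $m$ that is stationary, i.e. $\mu(A)=\int_\Omega\mu(T_\omega^{-1}A)\,d\mathbb{P}(\omega)$ for all measurable $A$. Moreover there are $C>0$ and $\lambda<1$ such that for all $n\ge0$, $f\in\mathcal{B}$, $g\in L^1(\mu)$, $\left|\int f\,U^ng\,d\mu-\int f\,d\mu\int g\,d\mu\right|\le C\lambda^n\|f\|\,\|g\|_{L^1(\mu)}$. Symbolic system. $\Omega^\star=X^{\mathbb{N}_0}$ with the product $\sigma$-algebra; $\pi(\underline x)=x_0$; $\phi_\pi=\phi\circ\pi$; $\tau$ is the one-sided shift; $\mu_c$ is the law on $\Omega^\star$ of the stationary Markov chain with initial distribution $\mu$ and transition probability $U(x,A)=\mathbb{P}(\{\omega:T_\omega x\in A\})$; it is $\tau$-invariant. The law of $S_n$ under $\mu_c$ equals the law of $\sum_{k=0}^{n-1}\phi(T_{\omega_k}\cdots T_{\omega_1}x)$ under $\tilde{\mathbb{P}}\otimes\mu$. Rate function. The asymptotic variance is $\sigma^2=\int\phi^2\,d\mu+2\sum_{n\ge1}\int\phi\,U^n\phi\,d\mu$.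 When $\sigma^2>0$, the annealed large deviation principle holds: there is a non-negative function $I$ on an open interval containing $0$, continuous, strictly convex, vanishing only at $0$, such that $\lim_{n\to\infty}\frac1n\log\mu_c(S_n>n\epsilon)=-I(\epsilon)$ for every sufficiently small $\epsilon>0$. "In the domain where this principle holds" means that $\alpha$ belongs to an open interval containing $0$ on which $I$ is defined and such that this limit holds for all positive $\epsilon$ in the interval. *)

theory Defs
  imports "HOL-Probability.Probability"
begin

section \<open>The random system\<close>

definition leb01 :: "real measure" where
  "leb01 = restrict_space lborel {0..1}"

text \<open>Piecewise \<open>C\<^sup>2\<close> in the sense of Lasota and Yorke: on each open interval of a finite
  partition the map agrees with a function that is \<open>C\<^sup>2\<close> on the closed interval.\<close>

definition piecewise_C2 :: "(real \<Rightarrow> real) \<Rightarrow> bool" where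
  "piecewise_C2 S \<longleftrightarrow>
     (\<exists>k::nat. \<exists>a::nat \<Rightarrow> real. a 0 = 0 \<and> a k = 1 \<and>
        (\<forall>i<k. a i < a (Suc i) \<and>
          (\<exists>h h' h'' :: real \<Rightarrow> real.
             (\<forall>x\<in>{a i<..<a (Suc i)}. S x = h x) \<and>
             (\<forall>x\<in>{a i..a (Suc i)}.
                (h has_real_derivative h' x) (at x within {a i..a (Suc i)}) \<and>
                (h' has_real_derivative h'' x) (at x within {a i..a (Suc i)})) \<and>
             continuous_on {a i..a (Suc i)} h'')))"

text \<open>Joint measurability into \<^const>\<open>leb01\<close> includes that every \<open>T \<omega>\<close> maps \<open>[0,1]\<close> into itself;
  the values of \<open>T \<omega>\<close> outside \<open>[0,1]\<close> are irrelevant.\<close>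

locale random_system = prob_space M
  for M :: "'a measure" +
  fixes T :: "'a \<Rightarrow> real \<Rightarrow> real"
  assumes measurable_T: "(\<lambda>(\<omega>, x). T \<omega> x) \<in> M \<Otimes>\<^sub>M leb01 \<rightarrow>\<^sub>M leb01"
    and piecewise_C2_T: "\<And>\<omega>. \<omega> \<in> space M \<Longrightarrow> piecewise_C2 (T \<omega>)"
    and nonsingular_T:
      "\<And>\<omega>. \<omega> \<in> space M \<Longrightarrow> absolutely_continuous leb01 (distr leb01 leb01 (T \<omega>))"
    and deriv_bound_T:
      "\<exists>L>0. \<forall>\<omega>\<in>space M. \<forall>x\<in>{0<..<1}.
         T \<omega> differentiable (at x) \<longrightarrow> \<bar>deriv (T \<omega>) x\<bar> \<le> L"

section \<open>Functions of bounded variation\<close>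

definition variation01 :: "(real \<Rightarrow> 'b::real_normed_vector) \<Rightarrow> ennreal" where
  "variation01 f = (SUP xs\<in>{xs. sorted xs \<and> set xs \<subseteq> {0..1}}.
      \<Sum>i<length xs - 1. ennreal (norm (f (xs ! Suc i) - f (xs ! i))))"

definition ess_variation :: "(real \<Rightarrow> 'b::real_normed_vector) \<Rightarrow> ennreal" where
  "ess_variation f = (INF g\<in>{g. AE x in leb01. g x = f x}. variation01 g)"

text \<open>The elements of \<open>BV\<close> are representatives; equality in the Banach space \<open>BV\<close> is equality
  almost everywhere. The spectral assumptions use the complex space.\<close>

definition BV :: "(real \<Rightarrow> 'b::{banach, second_countable_topology}) set" where
  "BV = {f. integrable leb01 f \<and> ess_variation f < \<top>}"

definition L1_norm :: "real measure \<Rightarrow> (real \<Rightarrow> 'b::{banach, second_countable_topology}) \<Rightarrow> real" where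
  "L1_norm \<nu> f = (\<integral>x. norm (f x) \<partial>\<nu>)"

definition BV_norm :: "(real \<Rightarrow> 'b::{banach, second_countable_topology}) \<Rightarrow> real" where
  "BV_norm f = L1_norm leb01 f + enn2real (ess_variation f)"

section \<open>Transfer operators\<close>

text \<open>Both operators act on classes modulo null sets and are defined by selecting a representative
  of the unique class with the stated duality against \<open>L\<^sup>\<infinity>\<close>. The operator-valued integral defining
  the annealed operator is the weak one: \<open>\<integral> (P f) g dm = \<integral>\<^sub>\<Omega> (\<integral> (P\<^sub>\<omega> f) g dm) d\<P>(\<omega>)\<close>.\<close>

definition bounded_measurable :: "(real \<Rightarrow> complex) set" where
  "bounded_measurable = {g. g \<in> borel_measurable leb01 \<and> (\<exists>B. \<forall>x. norm (g x) \<le> B)}"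

definition transfer :: "(real \<Rightarrow> real) \<Rightarrow> (real \<Rightarrow> complex) \<Rightarrow> real \<Rightarrow> complex" where
  "transfer S f = (SOME h. integrable leb01 h \<and>
     (\<forall>g\<in>bounded_measurable. (\<integral>x. h x * g x \<partial>leb01) = (\<integral>x. f x * g (S x) \<partial>leb01)))"

definition annealed_transfer ::
    "'a measure \<Rightarrow> ('a \<Rightarrow> real \<Rightarrow> real) \<Rightarrow> (real \<Rightarrow> complex) \<Rightarrow> real \<Rightarrow> complex" where
  "annealed_transfer M T f = (SOME h. integrable leb01 h \<and>
     (\<forall>g\<in>bounded_measurable.
        (\<integral>x. h x * g x \<partial>leb01) = (\<integral>\<omega>. (\<integral>x. transfer (T \<omega>) f x * g x \<partial>leb01) \<partial>M)))"

definition annealed_koopman :: "'a measure \<Rightarrow> ('a \<Rightarrow> real \<Rightarrow> real) \<Rightarrow>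
    (real \<Rightarrow> 'b::{banach, second_countable_topology}) \<Rightarrow> real \<Rightarrow> 'b" where
  "annealed_koopman M T g x = (\<integral>\<omega>. g (T \<omega> x) \<partial>M)"

section \<open>Spectral assumptions, for an operator on the complex space \<open>BV\<close>\<close>

definition BV_bounded_operator :: "((real \<Rightarrow> complex) \<Rightarrow> real \<Rightarrow> complex) \<Rightarrow> bool" where
  "BV_bounded_operator P \<longleftrightarrow>
     (\<forall>f\<in>BV. P f \<in> BV) \<and> (\<exists>C. \<forall>f\<in>BV. BV_norm (P f) \<le> C * BV_norm f)"

definition lasota_yorke :: "((real \<Rightarrow> complex) \<Rightarrow> real \<Rightarrow> complex) \<Rightarrow> bool" where
  "lasota_yorke P \<longleftrightarrow> (\<exists>N\<ge>1. \<exists>\<rho><1. \<exists>K\<ge>0. \<forall>f\<in>BV.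
     BV_norm ((P ^^ N) f) \<le> \<rho> * BV_norm f + K * L1_norm leb01 f)"

definition BV_eigenvalue :: "((real \<Rightarrow> complex) \<Rightarrow> real \<Rightarrow> complex) \<Rightarrow> complex \<Rightarrow> bool" where
  "BV_eigenvalue P z \<longleftrightarrow>
     (\<exists>f\<in>BV. \<not> (AE x in leb01. f x = 0) \<and> (AE x in leb01. P f x = z * f x))"

definition BV_resolvent :: "((real \<Rightarrow> complex) \<Rightarrow> real \<Rightarrow> complex) \<Rightarrow> complex \<Rightarrow> bool" where
  "BV_resolvent P z \<longleftrightarrow> (\<exists>C. \<forall>f\<in>BV. \<exists>g\<in>BV.
     (AE x in leb01. z * g x - P g x = f x) \<and> BV_norm g \<le> C * BV_norm f \<and>
     (\<forall>h\<in>BV. (AE x in leb01. z * h x - P h x = f x) \<longrightarrow> (AE x in leb01. h x = g x)))"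

text \<open>Simple means algebraic multiplicity one: the generalized eigenspace is one-dimensional.\<close>

definition BV_simple_eigenvalue :: "((real \<Rightarrow> complex) \<Rightarrow> real \<Rightarrow> complex) \<Rightarrow> complex \<Rightarrow> bool" where
  "BV_simple_eigenvalue P z \<longleftrightarrow>
     (\<exists>h\<in>BV. \<not> (AE x in leb01. h x = 0) \<and> (AE x in leb01. P h x = z * h x) \<and>
        (\<forall>k. \<forall>f\<in>BV. (AE x in leb01. ((\<lambda>u x. P u x - z * u x) ^^ k) f x = 0) \<longrightarrow>
           (\<exists>c. AE x in leb01. f x = c * h x)))"

definition spectral_gap_at_1 :: "((real \<Rightarrow> complex) \<Rightarrow> real \<Rightarrow> complex) \<Rightarrow> bool" where
  "spectral_gap_at_1 P \<longleftrightarrow>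
     BV_simple_eigenvalue P 1 \<and>
     (\<exists>r>0. \<forall>z. z \<noteq> 1 \<and> cmod (z - 1) < r \<longrightarrow> BV_resolvent P z) \<and>
     (\<forall>z. cmod z = 1 \<and> z \<noteq> 1 \<longrightarrow> \<not> BV_eigenvalue P z)"

section \<open>The stationary measure and the decay of correlations\<close>

definition ac_stationary :: "'a measure \<Rightarrow> ('a \<Rightarrow> real \<Rightarrow> real) \<Rightarrow> real measure \<Rightarrow> bool" where
  "ac_stationary M T \<mu> \<longleftrightarrow>
     prob_space \<mu> \<and> sets \<mu> = sets leb01 \<and> absolutely_continuous leb01 \<mu> \<and>
     (\<forall>A\<in>sets \<mu>. emeasure \<mu> A = (\<integral>\<^sup>+\<omega>. emeasure \<mu> (T \<omega> -` A \<inter> space \<mu>) \<partial>M))"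

definition decay_of_correlations ::
    "'a measure \<Rightarrow> ('a \<Rightarrow> real \<Rightarrow> real) \<Rightarrow> real measure \<Rightarrow> bool" where
  "decay_of_correlations M T \<mu> \<longleftrightarrow>
     (\<exists>C>0. \<exists>r<1. \<forall>n. \<forall>f\<in>BV. \<forall>g :: real \<Rightarrow> complex. integrable \<mu> g \<longrightarrow>
        cmod ((\<integral>x. f x * (annealed_koopman M T ^^ n) g x \<partial>\<mu>) - (\<integral>x. f x \<partial>\<mu>) * (\<integral>x. g x \<partial>\<mu>))
          \<le> C * r ^ n * BV_norm f * L1_norm \<mu> g)"

definition asymptotic_variance ::
    "'a measure \<Rightarrow> ('a \<Rightarrow> real \<Rightarrow> real) \<Rightarrow> real measure \<Rightarrow> (real \<Rightarrow> real) \<Rightarrow> real" where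
  "asymptotic_variance M T \<mu> \<phi> =
     (\<integral>x. (\<phi> x)\<^sup>2 \<partial>\<mu>) + 2 * (\<Sum>n. \<integral>x. \<phi> x * (annealed_koopman M T ^^ Suc n) \<phi> x \<partial>\<mu>)"

section \<open>The symbolic system\<close>

definition transition :: "'a measure \<Rightarrow> ('a \<Rightarrow> real \<Rightarrow> real) \<Rightarrow> real \<Rightarrow> real measure" where
  "transition M T x = distr M leb01 (\<lambda>\<omega>. T \<omega> x)"

text \<open>The conditional law of the coordinate \<open>n\<close> of the chain given the coordinates below \<open>n\<close>.\<close>

definition chain_kernel :: "'a measure \<Rightarrow> ('a \<Rightarrow> real \<Rightarrow> real) \<Rightarrow> real measure \<Rightarrow>
    nat \<Rightarrow> (nat \<Rightarrow> real) \<Rightarrow> real measure" where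
  "chain_kernel M T \<mu> n x = (case n of 0 \<Rightarrow> \<mu> | Suc k \<Rightarrow> transition M T (x k))"

text \<open>The law of the chain on the product space \<open>[0,1]\<^sup>\<nat>\<close> is the Ionescu-Tulcea extension of these
  kernels.\<close>

definition chain_law :: "'a measure \<Rightarrow> ('a \<Rightarrow> real \<Rightarrow> real) \<Rightarrow> real measure \<Rightarrow> (nat \<Rightarrow> real) measure" where
  "chain_law M T \<mu> = projective_family.lim UNIV
     (Ionescu_Tulcea.CI (chain_kernel M T \<mu>) (\<lambda>_. leb01)) (\<lambda>_. leb01)"

lemma (in random_system) Ionescu_Tulcea_chain_kernel:
  assumes "ac_stationary M T \<mu>"
  shows "Ionescu_Tulcea (chain_kernel M T \<mu>) (\<lambda>_. leb01)"
proof (rule Ionescu_Tulcea.intro)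
  have \<mu>: "prob_space \<mu>" "sets \<mu> = sets leb01"
    using assms by (auto simp: ac_stationary_def)
  have T_x: "(\<lambda>\<omega>. T \<omega> x) \<in> M \<rightarrow>\<^sub>M leb01" if "x \<in> space leb01" for x
    using measurable_compose[OF measurable_Pair2'[OF that] measurable_T] by simp
  have swap: "(\<lambda>(x, \<omega>). T \<omega> x) \<in> leb01 \<Otimes>\<^sub>M M \<rightarrow>\<^sub>M leb01"
    using measurable_compose[OF measurable_pair_swap' measurable_T]
    by (simp add: case_prod_beta')
  have "M \<in> space (subprob_algebra M)"
    by (simp add: space_subprob_algebra subprob_space_axioms)
  then have "transition M T \<in> leb01 \<rightarrow>\<^sub>M subprob_algebra leb01"
    unfolding transition_def[abs_def]
    by (intro measurable_distr2[of "\<lambda>x \<omega>. T \<omega> x" leb01 M leb01 "\<lambda>_. M", OF swap]) (auto intro: measurable_const)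
  then show "chain_kernel M T \<mu> i \<in> PiM {0..<i} (\<lambda>_. leb01) \<rightarrow>\<^sub>M subprob_algebra leb01" for i
    using \<mu> by (cases i)
      (auto simp: chain_kernel_def[abs_def] space_subprob_algebra prob_space_imp_subprob_space
        intro!: measurable_compose[OF measurable_component_singleton])
  show "prob_space (chain_kernel M T \<mu> i x)" if "x \<in> space (PiM {0..<i} (\<lambda>_. leb01))" for i x
  proof (cases i)
    case 0
    with \<mu> show ?thesis by (simp add: chain_kernel_def)
  next
    case (Suc k)
    with that have "x k \<in> space leb01"
      by (auto simp: space_PiM)
    with Suc show ?thesis
      by (simp add: chain_kernel_def transition_def prob_space_distr T_x)
  qed
qed

definition left_shift :: "(nat \<Rightarrow> real) \<Rightarrow> nat \<Rightarrow> real" where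
  "left_shift x = (\<lambda>k. x (Suc k))"

definition coord0 :: "(nat \<Rightarrow> real) \<Rightarrow> real" where
  "coord0 x = x 0"

definition birkhoff_sum :: "(real \<Rightarrow> real) \<Rightarrow> nat \<Rightarrow> (nat \<Rightarrow> real) \<Rightarrow> real" where
  "birkhoff_sum \<phi> n x = (\<Sum>j<n. (\<phi> \<circ> coord0) ((left_shift ^^ j) x))"

text \<open>\<open>I\<close> is a rate function on the open interval \<open>J\<close> and the large deviation principle holds for all
  positive points of \<open>J\<close>. Since \<open>I \<epsilon> > 0\<close> for such points, the limit excludes that the probability
  vanishes for infinitely many \<open>n\<close>, so the convention \<open>ln 0 = 0\<close> is harmless.\<close>

definition annealed_rate_function ::
    "(nat \<Rightarrow> real) measure \<Rightarrow> (real \<Rightarrow> real) \<Rightarrow> real set \<Rightarrow> (real \<Rightarrow> real) \<Rightarrow> bool" where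
  "annealed_rate_function \<nu> \<phi> J I \<longleftrightarrow>
     open J \<and> is_interval J \<and> 0 \<in> J \<and>
     continuous_on J I \<and>
     (\<forall>s\<in>J. 0 \<le> I s \<and> (I s = 0 \<longleftrightarrow> s = 0)) \<and>
     (\<forall>s\<in>J. \<forall>t\<in>J. s \<noteq> t \<longrightarrow>
        (\<forall>u\<in>{0<..<1}. I ((1 - u) * s + u * t) < (1 - u) * I s + u * I t)) \<and>
     (\<forall>\<epsilon>\<in>J. 0 < \<epsilon> \<longrightarrow>
        (\<lambda>n. 1 / real n * ln (measure \<nu> {x \<in> space \<nu>. birkhoff_sum \<phi> n x > real n * \<epsilon>}))
          \<longlonglongrightarrow> - I \<epsilon>)"

text \<open>For the finitely many \<open>n\<close> where the length below is \<open>0\<close> or exceeds \<open>n\<close>, averages and index ranges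
  take default values, which does not affect limits in \<open>n\<close>.\<close>

definition window :: "(real \<Rightarrow> real) \<Rightarrow> real \<Rightarrow> nat \<Rightarrow> nat" where
  "window I \<alpha> n = nat \<lfloor>ln (real n) / I \<alpha>\<rfloor>"

end

theory Submission
  imports Defs
begin

text \<open>
  The law of the longest windows is a competition between the number \<open>n\<close> of available starting points
  and the probability that a window of length \<open>l\<close> has an average above \<open>x\<close>, which by the large deviation
  principle is \<open>exp (- l * I x)\<close> up to subexponential factors. The length \<open>l = log n / I \<alpha>\<close> is the one for which
  they balance exactly at \<open>x = \<alpha>\<close>; above \<open>\<alpha>\<close> the rate is larger and below it is smaller, because \<open>I\<close> is
  strictly convex with minimum \<open>I 0 = 0\<close> (\<open>rate_strict_mono\<close>).

  The upper bound is a union bound with stationarity and the Borel-Cantelli lemma (\<open>AE_upper_bound\<close>),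
  carried out for each window length \<open>l\<close> rather than for each \<open>n\<close>. All \<open>n\<close> with the same window length
  are handled together, which makes the probabilities summable (\<open>window_maximum_tendsto\<close>).

  For the lower bound one looks at disjoint windows separated by gaps proportional to \<open>l\<close> and has to show
  that they rarely all fail to reach \<open>\<gamma> < \<alpha>\<close>. This would be immediate for independent windows. The decay of
  correlations gives approximate independence, but only for a present observable of bounded variation,
  and the event that a window fails is not of this kind. Three devices remove the obstacle.

  First, the values along the path are rounded at random to a fine grid by a Lipschitz partition of
  unity (\<open>grid_mixture\<close>), which changes averages by at most the mesh. The smoothed event is then an
  exponentially large sum of products of one-point functions of bounded variation.

  Second, the bounded variation is looked for at the end of the window and not at its beginning. The
  individual random maps may have arbitrarily many branches, so nothing can be said about the variation
  in the starting point; but the density of the final point of the weighted chain arises by alternately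
  multiplying with one-point functions and applying the annealed transfer operator, which is bounded on
  \<open>BV\<close> (\<open>grid_mixture_density\<close>). Its norm grows exponentially in \<open>l\<close>, and a gap proportional to \<open>l\<close> compensates
  this.

  Third, this density \<open>d\<close> refers to Lebesgue measure and the decay of correlations to \<open>\<mu>\<close>, whose density \<open>h\<close>
  is not bounded below. As \<open>0 \<le> d \<le> h\<close>, the quotient \<open>d / max h \<delta>\<close> replaces \<open>d / h\<close> at the cost of an
  error \<open>\<delta>\<close> that can be taken exponentially small (\<open>decoupling\<close>). This uses that \<open>h\<close> is of bounded variation,
  which the Lasota-Yorke inequality implies for every absolutely continuous stationary measure
  (\<open>stationary_density_bv\<close>).

  All computations with paths take place in an explicit model of the chain, the orbits of the random maps
  under independent noise (\<open>chain_law_eq_distr_orbit\<close>).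
\<close>

section \<open>Functions of bounded variation\<close>

lemma space_leb01 [simp]: "space leb01 = {0..1}"
  by (simp add: leb01_def space_restrict_space)

lemma prob_space_leb01: "prob_space leb01"
  by (rule prob_spaceI) (simp add: leb01_def emeasure_restrict_space space_restrict_space)

interpretation leb01: prob_space leb01
  by (rule prob_space_leb01)

text \<open>Sums, products, quotients and Lipschitz images all have increments dominated by a combination of
  the increments of their ingredients; this one estimate yields each of their variation bounds.\<close>

lemma variation01_combine:
  fixes f :: "real \<Rightarrow> 'b::real_normed_vector" and g :: "real \<Rightarrow> 'c::real_normed_vector"
    and k :: "real \<Rightarrow> 'd::real_normed_vector"
  assumes le: "\<And>x y. x \<in> {0..1} \<Longrightarrow> y \<in> {0..1} \<Longrightarrow>
      norm (k x - k y) \<le> a * norm (f x - f y) + b * norm (g x - g y)"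
    and a: "0 \<le> a" and b: "0 \<le> b"
  shows "variation01 k \<le> ennreal a * variation01 f + ennreal b * variation01 g"
  unfolding variation01_def[of k]
proof (rule SUP_least, safe)
  fix xs :: "real list" assume xs: "sorted xs" "set xs \<subseteq> {0..1}"
  let ?n = "length xs - 1"
  have "(\<Sum>i<?n. ennreal (norm (k (xs ! Suc i) - k (xs ! i))))
      \<le> (\<Sum>i<?n. ennreal a * ennreal (norm (f (xs ! Suc i) - f (xs ! i)))
          + ennreal b * ennreal (norm (g (xs ! Suc i) - g (xs ! i))))"
  proof (rule sum_mono)
    fix i assume "i \<in> {..<?n}"
    then have "xs ! i \<in> set xs" "xs ! Suc i \<in> set xs" by auto
    with xs have "xs ! i \<in> {0..1}" "xs ! Suc i \<in> {0..1}" by blast+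
    from le[OF this(2,1)] a b
    show "ennreal (norm (k (xs ! Suc i) - k (xs ! i)))
      \<le> ennreal a * ennreal (norm (f (xs ! Suc i) - f (xs ! i)))
          + ennreal b * ennreal (norm (g (xs ! Suc i) - g (xs ! i)))"
      by (simp add: ennreal_mult'[symmetric] ennreal_plus[symmetric] ennreal_leI del: ennreal_plus)
  qed
  also have "\<dots> = ennreal a * (\<Sum>i<?n. ennreal (norm (f (xs ! Suc i) - f (xs ! i))))
      + ennreal b * (\<Sum>i<?n. ennreal (norm (g (xs ! Suc i) - g (xs ! i))))"
    by (simp only: sum.distrib sum_distrib_left)
  also have "\<dots> \<le> ennreal a * variation01 f + ennreal b * variation01 g"
    unfolding variation01_def using xs by (intro add_mono mult_left_mono SUP_upper) auto
  finally show "(\<Sum>i<?n. ennreal (norm (k (xs ! Suc i) - k (xs ! i))))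
      \<le> ennreal a * variation01 f + ennreal b * variation01 g" .
qed

lemma norm_diff_le_variation01:
  assumes "x \<in> {0..1}" "y \<in> {0..1}"
  shows "ennreal (norm (f x - f y)) \<le> variation01 f"
proof -
  have *: "ennreal (norm (f u - f v)) \<le> variation01 f" if "u \<in> {0..1}" "v \<in> {0..1}" "v \<le> u" for u v
    unfolding variation01_def using that by (intro SUP_upper2[of "[v, u]"]) auto
  show ?thesis
    using *[of x y] *[of y x] assms by (cases "y \<le> x") (auto simp: norm_minus_commute)
qed

text \<open>A working version of membership in \<open>BV\<close>: one representative whose supremum and whose variation have
  the same bound \<open>B\<close>. No representative has to attain the essential variation, and iterated
  operations (multiply, apply the transfer operator, add up) merely multiply bounds, which is all
  that the exponential growth estimates below require.\<close>

definition bv_bounded :: "real \<Rightarrow> (real \<Rightarrow> 'b::{banach, second_countable_topology}) \<Rightarrow> bool" where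
  "bv_bounded B f \<longleftrightarrow> f \<in> borel_measurable leb01 \<and>
     (\<exists>g. (AE x in leb01. g x = f x) \<and> (\<forall>x\<in>{0..1}. norm (g x) \<le> B) \<and> variation01 g \<le> ennreal B)"

lemma bv_bounded_measurable: "bv_bounded B f \<Longrightarrow> f \<in> borel_measurable leb01"
  by (simp add: bv_bounded_def)

lemma bv_bounded_nonneg: "bv_bounded B f \<Longrightarrow> 0 \<le> B"
  unfolding bv_bounded_def using norm_ge_zero by (metis atLeastAtMost_iff order_refl order_trans zero_le_one)

lemma bv_bounded_AE: "bv_bounded B f \<Longrightarrow> AE x in leb01. norm (f x) \<le> B"
proof -
  assume "bv_bounded B f"
  then obtain g where g: "AE x in leb01. g x = f x" "\<forall>x\<in>{0..1}. norm (g x) \<le> B"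
    by (auto simp: bv_bounded_def)
  show ?thesis
    using AE_space[of leb01] g(1) by eventually_elim (metis g(2) space_leb01)
qed

lemma bv_bounded_integrable: "bv_bounded B f \<Longrightarrow> integrable leb01 f"
  by (rule leb01.integrable_const_bound[OF bv_bounded_AE bv_bounded_measurable])

lemma bv_bounded_imp_BV:
  assumes "bv_bounded B f"
  shows "f \<in> BV" "BV_norm f \<le> 2 * B"
proof -
  obtain g where g: "AE x in leb01. g x = f x" "variation01 g \<le> ennreal B"
    using assms by (auto simp: bv_bounded_def)
  have B: "0 \<le> B" by (rule bv_bounded_nonneg[OF assms])
  have ev: "ess_variation f \<le> ennreal B"
    unfolding ess_variation_def using g by (intro INF_lower2[of g]) auto
  then show "f \<in> BV"
    using bv_bounded_integrable[OF assms] by (auto simp: BV_def intro: le_less_trans)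
  have "L1_norm leb01 f \<le> (\<integral>x. B \<partial>leb01)"
    unfolding L1_norm_def using bv_bounded_AE[OF assms] bv_bounded_integrable[OF assms]
    by (intro integral_mono_AE) auto
  also have "\<dots> = B" using leb01.prob_space by simp
  finally have "L1_norm leb01 f \<le> B" .
  moreover have "enn2real (ess_variation f) \<le> B"
    using ev B by (simp add: enn2real_leI)
  ultimately show "BV_norm f \<le> 2 * B"
    by (simp add: BV_norm_def)
qed

text \<open>A value of a function on \<open>[0,1]\<close> differs from every other value by at most the variation, hence from
  the mean by at most the variation; this is how the \<open>L\<^sup>1\<close> norm and the variation control the
  supremum.\<close>

lemma BV_imp_bv_bounded:
  assumes f: "f \<in> BV" and B: "BV_norm f < B"
  shows "bv_bounded B f"
proof -
  have int: "integrable leb01 f" and ev: "ess_variation f < \<top>"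
    using f by (auto simp: BV_def)
  have L1: "0 \<le> L1_norm leb01 f" by (simp add: L1_norm_def)
  define v where "v = B - L1_norm leb01 f"
  have less: "enn2real (ess_variation f) < v"
    using B by (simp add: BV_norm_def v_def)
  then have v: "0 < v"
    using enn2real_nonneg[of "ess_variation f"] by linarith
  have "ess_variation f = ennreal (enn2real (ess_variation f))"
    using ev by simp
  also have "\<dots> < ennreal v"
    using less v by (simp add: ennreal_less_iff del: ennreal_enn2real)
  finally have "ess_variation f < ennreal v" .
  then obtain g where g: "AE x in leb01. g x = f x" and vg: "variation01 g < ennreal v"
    by (auto simp: ess_variation_def INF_less_iff)
  have "norm (g x) \<le> B" if x: "x \<in> {0..1}" for x
  proof -
    have "norm (g x) \<le> norm (g y) + v" if "y \<in> {0..1}" for y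
    proof -
      have "ennreal (norm (g x - g y)) \<le> ennreal v"
        using norm_diff_le_variation01[OF x that, of g] vg by simp
      then show ?thesis
        using v norm_triangle_ineq2[of "g x" "g y"] by simp
    qed
    note le = this
    have "AE y in leb01. norm (g x) \<le> norm (f y) + v"
      using AE_space[of leb01] g
    proof eventually_elim
      case (elim y)
      then show ?case using le[of y] by simp
    qed
    then have "(\<integral>y. norm (g x) \<partial>leb01) \<le> (\<integral>y. norm (f y) + v \<partial>leb01)"
      using int by (intro integral_mono_AE) auto
    then show ?thesis
      using int leb01.prob_space by (simp add: v_def L1_norm_def)
  qed
  moreover have "variation01 g \<le> ennreal B"
    using vg L1 by (intro order.trans[OF less_imp_le[OF vg]] ennreal_leI) (simp add: v_def)
  ultimately show ?thesis
    using g int by (auto simp: bv_bounded_def)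
qed

lemma bv_bounded_mono: "bv_bounded B f \<Longrightarrow> B \<le> B' \<Longrightarrow> bv_bounded B' f"
  unfolding bv_bounded_def by (meson ennreal_leI order_trans)

lemma bv_bounded_combine:
  fixes f :: "real \<Rightarrow> 'b::{banach, second_countable_topology}"
    and g :: "real \<Rightarrow> 'c::{banach, second_countable_topology}"
    and \<Psi> :: "'b \<Rightarrow> 'c \<Rightarrow> 'd::{banach, second_countable_topology}"
  assumes f: "bv_bounded B f" and g: "bv_bounded D g"
    and meas: "(\<lambda>x. \<Psi> (f x) (g x)) \<in> borel_measurable leb01"
    and bound: "\<And>a b. norm a \<le> B \<Longrightarrow> norm b \<le> D \<Longrightarrow> norm (\<Psi> a b) \<le> E"
    and lip: "\<And>a a' b b'. norm a \<le> B \<Longrightarrow> norm a' \<le> B \<Longrightarrow> norm b \<le> D \<Longrightarrow> norm b' \<le> D \<Longrightarrow>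
       norm (\<Psi> a b - \<Psi> a' b') \<le> p * norm (a - a') + q * norm (b - b')"
    and pq: "0 \<le> p" "0 \<le> q" "p * B + q * D \<le> E"
  shows "bv_bounded E (\<lambda>x. \<Psi> (f x) (g x))"
proof -
  obtain f' where f': "AE x in leb01. f' x = f x" "\<forall>x\<in>{0..1}. norm (f' x) \<le> B" "variation01 f' \<le> ennreal B"
    using f by (auto simp: bv_bounded_def)
  obtain g' where g': "AE x in leb01. g' x = g x" "\<forall>x\<in>{0..1}. norm (g' x) \<le> D" "variation01 g' \<le> ennreal D"
    using g by (auto simp: bv_bounded_def)
  have "AE x in leb01. \<Psi> (f' x) (g' x) = \<Psi> (f x) (g x)"
    using f'(1) g'(1) by eventually_elim simp
  moreover have "variation01 (\<lambda>x. \<Psi> (f' x) (g' x)) \<le> ennreal E"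
  proof -
    have "variation01 (\<lambda>x. \<Psi> (f' x) (g' x)) \<le> ennreal p * variation01 f' + ennreal q * variation01 g'"
      using f' g' pq by (intro variation01_combine lip) auto
    also have "\<dots> \<le> ennreal p * ennreal B + ennreal q * ennreal D"
      using f' g' by (intro add_mono mult_left_mono) auto
    also have "\<dots> = ennreal (p * B + q * D)"
      using pq bv_bounded_nonneg[OF f] bv_bounded_nonneg[OF g]
      by (simp add: ennreal_mult)
    also have "\<dots> \<le> ennreal E" using pq by (intro ennreal_leI)
    finally show ?thesis .
  qed
  ultimately show ?thesis
    unfolding bv_bounded_def using meas bound f' g'
    by (intro conjI exI[of _ "\<lambda>x. \<Psi> (f' x) (g' x)"]) auto
qed

lemma bv_bounded_add:
  assumes "bv_bounded B f" "bv_bounded D g"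
  shows "bv_bounded (B + D) (\<lambda>x. f x + g x)"
  using assms(1,2)
proof (rule bv_bounded_combine[where \<Psi>="\<lambda>a b. a + b" and p=1 and q=1])
  show "norm (a + b - (a' + b')) \<le> 1 * norm (a - a') + 1 * norm (b - b')" for a a' b b' :: 'a
    using norm_triangle_ineq[of "a - a'" "b - b'"] by (simp add: algebra_simps)
  show "norm a \<le> B \<Longrightarrow> norm b \<le> D \<Longrightarrow> norm (a + b) \<le> B + D" for a b :: 'a
    using norm_triangle_ineq[of a b] by linarith
qed (use assms in \<open>auto simp: bv_bounded_def\<close>)

lemma bv_bounded_sum:
  fixes f :: "'i \<Rightarrow> real \<Rightarrow> 'b::{banach, second_countable_topology}"
  assumes "finite A" "\<And>i. i \<in> A \<Longrightarrow> bv_bounded B (f i)"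
  shows "bv_bounded (real (card A) * B) (\<lambda>x. \<Sum>i\<in>A. f i x)"
  using assms
proof (induction A)
  case empty
  have "variation01 (\<lambda>x. 0::'b) = 0" 
    unfolding variation01_def by (intro antisym SUP_least) auto
  then show ?case by (auto simp: bv_bounded_def intro!: exI[of _ "\<lambda>x. 0"])
next
  case (insert i A)
  have "bv_bounded (B + real (card A) * B) (\<lambda>x. f i x + (\<Sum>i\<in>A. f i x))"
    using insert by (intro bv_bounded_add) auto
  with insert show ?case by (simp add: algebra_simps)
qed

lemma bv_bounded_mult:
  fixes f g :: "real \<Rightarrow> real"
  assumes f: "bv_bounded B f" and g: "bv_bounded D g"
  shows "bv_bounded (2 * B * D) (\<lambda>x. f x * g x)"
  using f g
proof (rule bv_bounded_combine[where \<Psi>="\<lambda>a b. a * b" and p=D and q=B])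
  note nn = bv_bounded_nonneg[OF f] bv_bounded_nonneg[OF g]
  show "norm (a * b - a' * b') \<le> D * norm (a - a') + B * norm (b - b')"
    if "norm a \<le> B" "norm a' \<le> B" "norm b \<le> D" "norm b' \<le> D" for a a' b b' :: real
  proof -
    have "a * b - a' * b' = (a - a') * b + a' * (b - b')" by (simp add: algebra_simps)
    then have "norm (a * b - a' * b') \<le> norm ((a - a') * b) + norm (a' * (b - b'))"
      by (metis norm_triangle_ineq)
    also have "\<dots> = norm b * norm (a - a') + norm a' * norm (b - b')" 
      unfolding norm_mult by (simp only: mult.commute)
    also have "\<dots> \<le> D * norm (a - a') + B * norm (b - b')"
      using that by (intro add_mono mult_right_mono) auto
    finally show ?thesis .
  qed
  show "norm (a * b) \<le> 2 * B * D" if "norm a \<le> B" "norm b \<le> D" for a b :: real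
  proof -
    have "norm (a * b) \<le> B * D" unfolding norm_mult using that nn by (intro mult_mono) auto
    then show ?thesis using mult_nonneg_nonneg[OF nn] by linarith
  qed
qed (use assms bv_bounded_nonneg[OF f] bv_bounded_nonneg[OF g] in \<open>auto simp: bv_bounded_def algebra_simps\<close>)

text \<open>The density \<open>h\<close> of the stationary measure may come arbitrarily close to \<open>0\<close>, so \<open>f / h\<close> need not have
  bounded variation. Truncating the denominator at \<open>\<delta>\<close> costs only a factor that is polynomial in
  \<open>1 / \<delta>\<close>.\<close>

lemma bv_bounded_truncated_quotient:
  fixes f h :: "real \<Rightarrow> real"
  assumes f: "bv_bounded B f" and h: "bv_bounded D h" and \<delta>: "0 < \<delta>"
  shows "bv_bounded (B / \<delta> + B * D / \<delta>\<^sup>2) (\<lambda>x. f x / max (h x) \<delta>)"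
  using f h
proof (rule bv_bounded_combine[where \<Psi>="\<lambda>a b. a / max b \<delta>" and p="1 / \<delta>" and q="B / \<delta>\<^sup>2"])
  note nn = bv_bounded_nonneg[OF f] bv_bounded_nonneg[OF h]
  show "norm (a / max b \<delta> - a' / max b' \<delta>) \<le> 1 / \<delta> * norm (a - a') + B / \<delta>\<^sup>2 * norm (b - b')"
    if "norm a \<le> B" "norm a' \<le> B" "norm b \<le> D" "norm b' \<le> D" for a a' b b' :: real
  proof -
    define m where "m = max b \<delta>"
    define m' where "m' = max b' \<delta>"
    have m: "\<delta> \<le> m" "\<delta> \<le> m'" "\<bar>m' - m\<bar> \<le> \<bar>b - b'\<bar>" "0 < m" "0 < m'"
      using \<delta> by (auto simp: m_def m'_def)
    have "a / m - a' / m' = (a - a') / m + a' * (m' - m) / (m * m')"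
      using m by (simp add: field_simps)
    then have "\<bar>a / m - a' / m'\<bar> \<le> \<bar>(a - a') / m\<bar> + \<bar>a' * (m' - m) / (m * m')\<bar>"
      by (metis abs_triangle_ineq)
    also have "\<dots> = \<bar>a - a'\<bar> / m + \<bar>a'\<bar> * \<bar>m' - m\<bar> / (m * m')"
      using m by (simp add: abs_mult)
    also have "\<dots> \<le> \<bar>a - a'\<bar> / \<delta> + B * \<bar>b - b'\<bar> / (\<delta> * \<delta>)"
      using m \<delta> that nn by (intro add_mono frac_le mult_mono mult_nonneg_nonneg) auto
    finally show ?thesis by (simp add: m_def m'_def power2_eq_square)
  qed
  show "norm (a / max b \<delta>) \<le> B / \<delta> + B * D / \<delta>\<^sup>2" if "norm a \<le> B" "norm b \<le> D" for a b :: real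
  proof -
    have "norm (a / max b \<delta>) \<le> B / \<delta>"
      using that \<delta> nn by (auto intro!: frac_le)
    then show ?thesis using nn \<delta> by (smt (verit) divide_nonneg_pos mult_nonneg_nonneg zero_less_power)
  qed
  show "(\<lambda>x. f x / max (h x) \<delta>) \<in> borel_measurable leb01"
    using bv_bounded_measurable[OF f] bv_bounded_measurable[OF h] by measurable
  show "0 \<le> 1 / \<delta>" "0 \<le> B / \<delta>\<^sup>2" using nn \<delta> by simp_all
  show "1 / \<delta> * B + B / \<delta>\<^sup>2 * D \<le> B / \<delta> + B * D / \<delta>\<^sup>2" by simp
qed

lemma bv_bounded_of_real:
  fixes f :: "real \<Rightarrow> real"
  assumes f: "bv_bounded B f"
  shows "bv_bounded B (\<lambda>x. complex_of_real (f x))"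
proof (rule bv_bounded_combine[where \<Psi>="\<lambda>a b. complex_of_real a" and p=1 and q=0, OF f f])
  have [measurable]: "f \<in> borel_measurable leb01" by (rule bv_bounded_measurable[OF f])
  show "(\<lambda>x. complex_of_real (f x)) \<in> borel_measurable leb01" by measurable
  show "norm (complex_of_real a - complex_of_real a') \<le> 1 * norm (a - a') + 0 * norm (b - b')"
    for a a' b b' :: real
  proof -
    have "complex_of_real a - complex_of_real a' = complex_of_real (a - a')" by simp
    then have "norm (complex_of_real a - complex_of_real a') = norm (a - a')"
      by (simp only: norm_of_real real_norm_def)
    then show ?thesis by (simp only: mult_1 mult_zero_left add_0_right order_refl)
  qed
qed simp_all

lemma bv_bounded_Re:
  assumes f: "bv_bounded B f"
  shows "bv_bounded B (\<lambda>x. Re (f x))"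
proof (rule bv_bounded_combine[where \<Psi>="\<lambda>a b. Re a" and p=1 and q=0, OF f f])
  have [measurable]: "f \<in> borel_measurable leb01" by (rule bv_bounded_measurable[OF f])
  show "(\<lambda>x. Re (f x)) \<in> borel_measurable leb01" by measurable
  show "norm (Re a - Re a') \<le> 1 * norm (a - a') + 0 * norm (b - b')" for a a' b b'
    using abs_Re_le_cmod[of "a - a'"] by simp
  show "norm (Re a) \<le> B" if "norm a \<le> B" for a
    using abs_Re_le_cmod[of a] that by simp
qed simp_all

lemma bv_bounded_lipschitz:
  fixes f :: "real \<Rightarrow> real" and G :: "real \<Rightarrow> real"
  assumes f: "bv_bounded B f" and bd: "\<And>a. \<bar>G a\<bar> \<le> E"
    and lip: "\<And>a b. \<bar>G a - G b\<bar> \<le> p * \<bar>a - b\<bar>" and p: "0 \<le> p" "p * B \<le> E"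
    and [measurable]: "G \<in> borel_measurable borel"
  shows "bv_bounded E (\<lambda>x. G (f x))"
proof -
  have [measurable]: "f \<in> borel_measurable leb01" by (rule bv_bounded_measurable[OF f])
  show ?thesis
    using f f by (rule bv_bounded_combine[where \<Psi>="\<lambda>a b. G a" and p=p and q=0]) (use assms in auto)
qed

text \<open>Lower semicontinuity of the variation. Along a subsequence the functions converge almost
  everywhere, but the limit needs values at the exceptional points as well. By Tychonoff's theorem the
  representatives have a pointwise cluster point in \<open>[-B,B]\<^bsup>\<real>\<^esup>\<close>. Finite sums of increments pass to the
  cluster point, and it agrees with the limit wherever the subsequence converges.\<close>

lemma bv_bounded_L1_limit:
  fixes fs :: "nat \<Rightarrow> real \<Rightarrow> real"
  assumes fs: "\<And>k. bv_bounded B (fs k)" and h: "integrable leb01 h"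
    and lim: "(\<lambda>k. \<integral>x. \<bar>fs k x - h x\<bar> \<partial>leb01) \<longlonglongrightarrow> 0"
  shows "bv_bounded B h"
proof -
  have int: "integrable leb01 (\<lambda>x. fs k x - h x)" for k
    using bv_bounded_integrable[OF fs] h by auto
  obtain r :: "nat \<Rightarrow> nat" where r: "strict_mono r" "AE x in leb01. (\<lambda>k. fs (r k) x - h x) \<longlonglongrightarrow> 0"
    using tendsto_L1_AE_subseq[of leb01 "\<lambda>k x. fs k x - h x"] int lim by auto
  have "\<exists>g. (AE x in leb01. g x = fs k x) \<and> (\<forall>x\<in>{0..1}. \<bar>g x\<bar> \<le> B) \<and> variation01 g \<le> ennreal B" for k
    using fs[of k] by (simp add: bv_bounded_def)
  then obtain g where g: "\<And>k. AE x in leb01. g k x = fs k x"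
      "\<And>k x. x \<in> {0..1} \<Longrightarrow> \<bar>g k x\<bar> \<le> B" "\<And>k. variation01 (g k) \<le> ennreal B"
    by metis
  have B: "0 \<le> B" by (rule bv_bounded_nonneg[OF fs])
  define G where "G k x = (if x \<in> {0..1} then g (r k) x else 0)" for k x
  have G_mem: "G k \<in> PiE UNIV (\<lambda>_::real. {-B..B})" for k
  proof -
    have "\<bar>G k x\<bar> \<le> B" for x by (simp only: G_def) (use g(2)[of x "r k"] B in simp)
    then have "-B \<le> G k x \<and> G k x \<le> B" for x by (meson abs_le_D1 abs_le_D2 minus_le_iff)
    then show ?thesis by (simp add: PiE_UNIV_domain)
  qed
  have "compactin (product_topology (\<lambda>_. euclidean) UNIV) (PiE UNIV (\<lambda>_::real. {-B..B}))"
    by (simp add: compactin_PiE)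
  then have "compact (PiE UNIV (\<lambda>_::real. {-B..B}))"
    by (simp add: euclidean_product_topology)
  moreover have "filtermap G sequentially \<noteq> bot" by (simp add: filtermap_bot_iff)
  moreover have "eventually (\<lambda>x. x \<in> PiE UNIV (\<lambda>_::real. {-B..B})) (filtermap G sequentially)"
    using G_mem by (simp add: eventually_filtermap)
  ultimately obtain g0 where g0: "g0 \<in> PiE UNIV (\<lambda>_::real. {-B..B})"
      "inf (nhds g0) (filtermap G sequentially) \<noteq> bot"
    unfolding compact_filter by blast
  \<comment> \<open>a filter finer than the sequence along which the representatives converge to the cluster point\<close>
  define F where "F = inf (filtercomap G (nhds g0)) sequentially"
  have F: "F \<noteq> bot"
  proof
    assume "F = bot"
    then have "eventually (\<lambda>_. False) F" by simp
    then obtain P Q where PQ: "eventually P (nhds g0)" "eventually Q sequentially" "\<And>k. P (G k) \<Longrightarrow> Q k \<Longrightarrow> False"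
      unfolding F_def eventually_inf eventually_filtercomap by blast
    have "eventually (\<lambda>_. False) (inf (nhds g0) (filtermap G sequentially))"
      unfolding eventually_inf eventually_filtermap
    proof (intro exI conjI)
      show "eventually (\<lambda>k. \<not> P (G k)) sequentially"
        using PQ(2) by eventually_elim (use PQ(3) in blast)
    qed (use PQ(1) in auto)
    with g0(2) show False by (simp add: trivial_limit_def)
  qed
  have F_le: "F \<le> sequentially" by (simp add: F_def)
  have "filterlim G (nhds g0) F"
    unfolding F_def by (meson filterlim_def filtermap_filtercomap filtermap_mono inf_le1 order_trans)
  then have tend: "((\<lambda>k. G k x) \<longlongrightarrow> g0 x) F" for x
    using continuous_on_tendsto_compose[OF continuous_on_product_coordinates, of G g0 F x] by simp
  have "AE x in leb01. g0 x = h x"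
  proof -
    have "AE x in leb01. \<forall>k. g k x = fs k x" using g(1) by (simp add: AE_all_countable)
    moreover note AE_space[of leb01]
    ultimately show ?thesis using r(2)
    proof eventually_elim
      case (elim x)
      have "(\<lambda>k. G k x - h x) \<longlonglongrightarrow> 0" using elim by (simp add: G_def)
      then have "(\<lambda>k. G k x) \<longlonglongrightarrow> h x" by (simp add: LIM_zero_iff)
      then have "((\<lambda>k. G k x) \<longlongrightarrow> h x) F" by (rule tendsto_mono[OF F_le])
      from tendsto_unique[OF F this tend] show ?case by simp
    qed
  qed
  moreover have "norm (g0 x) \<le> B" for x 
  proof -
    have "g0 x \<in> {-B..B}" using PiE_mem[OF g0(1), of x] by simp
    then show ?thesis by simp linarith
  qed
  moreover have "variation01 g0 \<le> ennreal B"
    unfolding variation01_def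
  proof (rule SUP_least, safe)
    fix xs :: "real list" assume xs: "sorted xs" "set xs \<subseteq> {0..1}"
    have conv: "((\<lambda>k. \<Sum>i<length xs - 1. ennreal (norm (G k (xs ! Suc i) - G k (xs ! i))))
       \<longlongrightarrow> (\<Sum>i<length xs - 1. ennreal (norm (g0 (xs ! Suc i) - g0 (xs ! i))))) F"
      by (intro tendsto_sum tendsto_ennrealI tendsto_norm tendsto_diff tend)
    have bd: "(\<Sum>i<length xs - 1. ennreal (norm (G k (xs ! Suc i) - G k (xs ! i)))) \<le> ennreal B" for k
    proof -
      have "(\<Sum>i<length xs - 1. ennreal (norm (G k (xs ! Suc i) - G k (xs ! i)))) \<le> variation01 (G k)"
        unfolding variation01_def using xs by (intro SUP_upper) auto
      also have "\<dots> \<le> ennreal 1 * variation01 (g (r k)) + ennreal 0 * variation01 (g (r k))"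
        by (intro variation01_combine) (auto simp: G_def)
      also have "\<dots> \<le> ennreal B" using g(3) by simp
      finally show ?thesis .
    qed
    show "(\<Sum>i<length xs - 1. ennreal (norm (g0 (xs ! Suc i) - g0 (xs ! i)))) \<le> ennreal B"
      by (rule tendsto_upperbound[OF conv always_eventually[OF allI[OF bd]] F])
  qed
  ultimately show ?thesis
    using h unfolding bv_bounded_def by (intro conjI exI[of _ g0]) auto
qed

section \<open>Density of bounded variation in \<open>L\<^sup>1\<close>\<close>

definition L1_approximable :: "(real \<Rightarrow> real) \<Rightarrow> bool" where
  "L1_approximable f \<longleftrightarrow> integrable leb01 f \<and>
     (\<forall>\<eta>>0. \<exists>B g. bv_bounded B g \<and> (\<integral>x. \<bar>g x - f x\<bar> \<partial>leb01) < \<eta>)"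

lemma L1_approximable_bv_bounded: "bv_bounded B f \<Longrightarrow> L1_approximable f"
  unfolding L1_approximable_def by (auto intro!: bv_bounded_integrable exI[of _ B] exI[of _ f])

lemma L1_approximable_limit:
  assumes s: "\<And>k::nat. L1_approximable (s k)" and f: "integrable leb01 f"
    and lim: "(\<lambda>k. \<integral>x. \<bar>s k x - f x\<bar> \<partial>leb01) \<longlonglongrightarrow> 0"
  shows "L1_approximable f"
  unfolding L1_approximable_def
proof (intro conjI f allI impI)
  fix \<eta> :: real assume "0 < \<eta>"
  then have "eventually (\<lambda>k. (\<integral>x. \<bar>s k x - f x\<bar> \<partial>leb01) < \<eta> / 2) sequentially"
    using lim by (intro order_tendstoD(2)[OF lim]) simp
  then obtain k where k: "(\<integral>x. \<bar>s k x - f x\<bar> \<partial>leb01) < \<eta> / 2"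
    by (auto simp: eventually_sequentially)
  have sk: "integrable leb01 (s k)" using s[of k] by (simp add: L1_approximable_def)
  obtain B g where g: "bv_bounded B g" "(\<integral>x. \<bar>g x - s k x\<bar> \<partial>leb01) < \<eta> / 2"
    using s[of k] \<open>0 < \<eta>\<close> unfolding L1_approximable_def by (metis half_gt_zero)
  note gi = bv_bounded_integrable[OF g(1)]
  have "(\<integral>x. \<bar>g x - f x\<bar> \<partial>leb01) \<le> (\<integral>x. \<bar>g x - s k x\<bar> + \<bar>s k x - f x\<bar> \<partial>leb01)"
    using gi sk f by (intro integral_mono) auto
  also have "\<dots> = (\<integral>x. \<bar>g x - s k x\<bar> \<partial>leb01) + (\<integral>x. \<bar>s k x - f x\<bar> \<partial>leb01)"
    using gi sk f by (intro Bochner_Integration.integral_add) auto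
  also have "\<dots> < \<eta>" using k g(2) by simp
  finally show "\<exists>B g. bv_bounded B g \<and> (\<integral>x. \<bar>g x - f x\<bar> \<partial>leb01) < \<eta>"
    using g(1) by blast
qed

lemma L1_approximable_add:
  assumes f: "L1_approximable f" and g: "L1_approximable g"
  shows "L1_approximable (\<lambda>x. f x + g x)"
  unfolding L1_approximable_def
proof (intro conjI allI impI)
  have fi: "integrable leb01 f" and gi: "integrable leb01 g"
    using f g by (auto simp: L1_approximable_def)
  then show "integrable leb01 (\<lambda>x. f x + g x)" by simp
  fix \<eta> :: real assume "0 < \<eta>"
  then have \<eta>: "0 < \<eta> / 2" by simp
  obtain B f' where f': "bv_bounded B f'" "(\<integral>x. \<bar>f' x - f x\<bar> \<partial>leb01) < \<eta> / 2"
    using f \<eta> unfolding L1_approximable_def by blast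
  obtain D g' where g': "bv_bounded D g'" "(\<integral>x. \<bar>g' x - g x\<bar> \<partial>leb01) < \<eta> / 2"
    using g \<eta> unfolding L1_approximable_def by blast
  note a = f' g'
  note int = fi gi bv_bounded_integrable[OF a(1)] bv_bounded_integrable[OF a(3)]
  have "(\<integral>x. \<bar>(f' x + g' x) - (f x + g x)\<bar> \<partial>leb01) \<le> (\<integral>x. \<bar>f' x - f x\<bar> + \<bar>g' x - g x\<bar> \<partial>leb01)"
    using int by (intro integral_mono) auto
  also have "\<dots> = (\<integral>x. \<bar>f' x - f x\<bar> \<partial>leb01) + (\<integral>x. \<bar>g' x - g x\<bar> \<partial>leb01)"
    using int by (intro Bochner_Integration.integral_add) auto
  also have "\<dots> < \<eta>" using a by simp
  finally show "\<exists>B g'. bv_bounded B g' \<and> (\<integral>x. \<bar>g' x - (f x + g x)\<bar> \<partial>leb01) < \<eta>"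
    using bv_bounded_add[OF a(1,3)] by blast
qed

lemma bv_bounded_const: "bv_bounded \<bar>c\<bar> (\<lambda>x. c :: real)"
proof -
  have "variation01 (\<lambda>x. c) \<le> 0"
    unfolding variation01_def by (intro SUP_least) auto
  then show ?thesis by (auto simp: bv_bounded_def intro!: exI[of _ "\<lambda>x. c"])
qed

lemma L1_approximable_cmult:
  assumes f: "L1_approximable f"
  shows "L1_approximable (\<lambda>x. c * f x)"
  unfolding L1_approximable_def
proof (intro conjI allI impI)
  have fi: "integrable leb01 f" using f by (auto simp: L1_approximable_def)
  then show "integrable leb01 (\<lambda>x. c * f x)" by simp
  fix \<eta> :: real assume "0 < \<eta>"
  then have "0 < \<eta> / (\<bar>c\<bar> + 1)" by simp
  then obtain B g where a: "bv_bounded B g" "(\<integral>x. \<bar>g x - f x\<bar> \<partial>leb01) < \<eta> / (\<bar>c\<bar> + 1)"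
    using f unfolding L1_approximable_def by blast
  have "(\<integral>x. \<bar>c * g x - c * f x\<bar> \<partial>leb01) = \<bar>c\<bar> * (\<integral>x. \<bar>g x - f x\<bar> \<partial>leb01)"
    by (simp add: abs_mult flip: right_diff_distrib)
  also have "\<dots> \<le> (\<bar>c\<bar> + 1) * (\<integral>x. \<bar>g x - f x\<bar> \<partial>leb01)"
    by (intro mult_right_mono) auto
  also have "\<dots> < \<eta>" using a(2) by (simp add: field_simps)
  finally show "\<exists>B g. bv_bounded B g \<and> (\<integral>x. \<bar>g x - c * f x\<bar> \<partial>leb01) < \<eta>"
    using bv_bounded_mult[OF bv_bounded_const a(1)] by blast
qed

text \<open>The increments of a monotone function telescope.\<close>

lemma bv_bounded_indicator_atMost: "bv_bounded 1 (indicator {..a} :: real \<Rightarrow> real)"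
proof -
  let ?f = "indicator {..a} :: real \<Rightarrow> real"
  have "variation01 ?f \<le> ennreal 1"
    unfolding variation01_def
  proof (rule SUP_least, safe)
    fix xs :: "real list" assume xs: "sorted xs" "set xs \<subseteq> {0..1}"
    have "(\<Sum>i<length xs - 1. ennreal (norm (?f (xs ! Suc i) - ?f (xs ! i))))
        = (\<Sum>i<length xs - 1. ennreal (?f (xs ! i) - ?f (xs ! Suc i)))"
    proof (intro sum.cong refl arg_cong[where f=ennreal])
      fix i assume "i \<in> {..<length xs - 1}"
      then have "xs ! i \<le> xs ! Suc i" using xs(1) by (intro sorted_nth_mono) auto
      then show "norm (?f (xs ! Suc i) - ?f (xs ! i)) = ?f (xs ! i) - ?f (xs ! Suc i)"
        by (auto simp: indicator_def)
    qed
    also have "\<dots> = ennreal (\<Sum>i<length xs - 1. ?f (xs ! i) - ?f (xs ! Suc i))"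
    proof (rule sum_ennreal)
      fix i assume "i \<in> {..<length xs - 1}"
      then have "xs ! i \<le> xs ! Suc i" using xs(1) by (intro sorted_nth_mono) auto
      then show "0 \<le> ?f (xs ! i) - ?f (xs ! Suc i)" by (auto simp: indicator_def)
    qed
    also have "\<dots> = ennreal (?f (xs ! 0) - ?f (xs ! (length xs - 1)))"
      by (subst sum_lessThan_telescope') simp
    also have "\<dots> \<le> ennreal 1" by (intro ennreal_leI) (auto simp: indicator_def)
    finally show "(\<Sum>i<length xs - 1. ennreal (norm (?f (xs ! Suc i) - ?f (xs ! i)))) \<le> ennreal 1" .
  qed
  moreover have "?f \<in> borel_measurable leb01"
    unfolding leb01_def by (intro measurable_restrict_space1) simp
  ultimately show ?thesis
    unfolding bv_bounded_def by (intro conjI exI[of _ ?f]) (auto simp: indicator_def)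
qed

lemma borel_measurable_leb01I: "f \<in> borel_measurable borel \<Longrightarrow> f \<in> borel_measurable leb01"
  unfolding leb01_def by (intro measurable_restrict_space1) simp

text \<open>The approximable sets form a Dynkin system that contains the half-lines.\<close>

lemma L1_approximable_indicator:
  assumes "A \<in> sets borel"
  shows "L1_approximable (indicator A)"
proof -
  have "Int_stable (range (\<lambda>a::real. {..a}))"
    by (auto simp: Int_stable_def)
  moreover have "range (\<lambda>a::real. {..a}) \<subseteq> Pow UNIV" by simp
  moreover have "A \<in> sigma_sets UNIV (range (\<lambda>a::real. {..a}))"
    using assms by (subst (asm) borel_eq_atMost) simp
  ultimately show ?thesis
  proof (induction A rule: sigma_sets_induct_disjoint)
    case (basic A)
    then show ?case by (auto intro: L1_approximable_bv_bounded[OF bv_bounded_indicator_atMost])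
  next
    case empty
    then show ?case using L1_approximable_bv_bounded[OF bv_bounded_const[of 0]] by simp
  next
    case (compl A)
    have "indicator (UNIV - A) = (\<lambda>x. 1 + (-1) * indicator A x :: real)"
      by (simp add: indicator_def fun_eq_iff)
    with L1_approximable_add[OF L1_approximable_bv_bounded[OF bv_bounded_const[of 1]]
        L1_approximable_cmult[OF compl(2), of "-1"]]
    show ?case by (simp only:)
  next
    case (union A)
    have meas: "(\<lambda>x. indicator S x :: real) \<in> borel_measurable leb01" if "S \<in> sets borel" for S :: "real set"
      by (intro borel_measurable_leb01I borel_measurable_indicator that)
    have A: "A i \<in> sets borel" for i
      using range_subsetD[OF union(2), of i] by (subst borel_eq_atMost) simp
    have sum: "L1_approximable (\<lambda>x. \<Sum>i<n. indicator (A i) x)" for n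
    proof (induction n)
      case 0
      then show ?case using L1_approximable_bv_bounded[OF bv_bounded_const[of 0]] by simp
    next
      case (Suc n)
      then show ?case using L1_approximable_add[OF Suc union(3)[of n]] by simp
    qed
    have sum_eq: "(\<Sum>i<n. indicator (A i) x) = (indicator (\<Union>i<n. A i) x :: real)" for n x
    proof (subst indicator_UN_disjoint)
      show "disjoint_family_on A {..<n}" using union(1) by (rule disjoint_family_on_mono[rotated]) simp
    qed simp_all
    show ?case
    proof (rule L1_approximable_limit)
      show "L1_approximable (\<lambda>x. indicator (\<Union>i<n. A i) x)" for n
        using sum[of n] by (simp add: sum_eq)
      have UA: "(\<Union>i. A i) \<in> sets borel" using A by blast
      show "integrable leb01 (indicator (\<Union>i. A i) :: real \<Rightarrow> real)"
        using meas[OF UA] by (intro leb01.integrable_const_bound[of _ 1]) auto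
      have "(\<lambda>n. \<integral>x. \<bar>indicator (\<Union>i<n. A i) x - indicator (\<Union>i. A i) x\<bar> \<partial>leb01) \<longlonglongrightarrow> (\<integral>x. (0::real) \<partial>leb01)"
      proof (rule integral_dominated_convergence[where w="\<lambda>_. 1"])
        show "(\<lambda>x. \<bar>indicator (\<Union>i<n. A i) x - indicator (\<Union>i. A i) x :: real\<bar>) \<in> borel_measurable leb01" for n
          using A UA by (intro borel_measurable_abs borel_measurable_diff meas) auto
        show "AE x in leb01. (\<lambda>n. \<bar>indicator (\<Union>i<n. A i) x - indicator (\<Union>i. A i) x :: real\<bar>) \<longlonglongrightarrow> 0"
        proof (intro AE_I2)
          fix x
          have "(\<lambda>n. indicator (\<Union>i<n. A i) x) \<longlonglongrightarrow> (indicator (\<Union>i. A i) x :: real)"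
            by (rule LIMSEQ_indicator_UN)
          from tendsto_rabs[OF tendsto_diff[OF this tendsto_const[of "indicator (\<Union>i. A i) x"]]]
          show "(\<lambda>n. \<bar>indicator (\<Union>i<n. A i) x - indicator (\<Union>i. A i) x :: real\<bar>) \<longlonglongrightarrow> 0" by simp
        qed
      qed (auto simp: indicator_def)
      then show "(\<lambda>n. \<integral>x. \<bar>indicator (\<Union>i<n. A i) x - indicator (\<Union>i. A i) x :: real\<bar> \<partial>leb01) \<longlonglongrightarrow> 0" by simp
    qed
  qed
qed

lemma integrable_imp_L1_approximable:
  fixes f :: "real \<Rightarrow> real"
  assumes "integrable leb01 f"
  shows "L1_approximable f"
  using assms
proof (induction rule: integrable_induct)
  case (base A c)
  then have "A \<in> sets borel" by (auto simp: leb01_def sets_restrict_space)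
  from L1_approximable_cmult[OF L1_approximable_indicator[OF this], of c]
  show ?case by (simp add: mult.commute)
next
  case (add f g)
  then show ?case by (intro L1_approximable_add)
next
  case (lim f s)
  show ?case
  proof (rule L1_approximable_limit)
    show "L1_approximable (s k)" for k by (rule lim(5))
    have "(\<lambda>k. \<integral>x. \<bar>s k x - f x\<bar> \<partial>leb01) \<longlonglongrightarrow> (\<integral>x. (0::real) \<partial>leb01)"
    proof (rule integral_dominated_convergence[where w="\<lambda>x. 3 * \<bar>f x\<bar>"])
      show "AE x in leb01. (\<lambda>k. \<bar>s k x - f x\<bar>) \<longlonglongrightarrow> 0"
      proof (intro AE_I2)
        fix x assume "x \<in> space leb01"
        from tendsto_rabs[OF tendsto_diff[OF lim(2)[OF this] tendsto_const[of "f x"]]]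
        show "(\<lambda>k. \<bar>s k x - f x\<bar>) \<longlonglongrightarrow> 0" by simp
      qed
      show "AE x in leb01. norm \<bar>s k x - f x\<bar> \<le> 3 * \<bar>f x\<bar>" for k
      proof (intro AE_I2)
        fix x assume "x \<in> space leb01"
        from lim(3)[OF this, of k] show "norm \<bar>s k x - f x\<bar> \<le> 3 * \<bar>f x\<bar>" by simp
      qed
      show "(\<lambda>x. \<bar>s k x - f x\<bar>) \<in> borel_measurable leb01" for k
        using borel_measurable_integrable[OF lim(1)] borel_measurable_integrable[OF lim(4)] by measurable
      show "integrable leb01 (\<lambda>x. 3 * \<bar>f x\<bar>)" using lim(4) by simp
    qed simp
    then show "(\<lambda>k. \<integral>x. \<bar>s k x - f x\<bar> \<partial>leb01) \<longlonglongrightarrow> 0" by simp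
  qed (rule lim(4))
qed

section \<open>Duality for the transfer operators\<close>

lemma unit_interval_in_sets_leb01 [simp, measurable]: "{0..1} \<in> sets leb01"
  using sets.top[of leb01] by simp

lemma integrable_mult_bounded:
  fixes a b :: "real \<Rightarrow> real"
  assumes a: "integrable leb01 a" and b: "b \<in> borel_measurable leb01" "\<And>x. x \<in> {0..1} \<Longrightarrow> \<bar>b x\<bar> \<le> 1"
  shows "integrable leb01 (\<lambda>x. a x * b x)"
proof (rule Bochner_Integration.integrable_bound[OF a])
  show "AE x in leb01. norm (a x * b x) \<le> norm (a x)"
    using b(2) by (intro AE_I2) (auto simp: abs_mult intro!: mult_left_le)
qed (use a b in measurable)

text \<open>The image of the measure with density \<open>f\<close> is absolutely continuous, and \<open>h\<close> is its Radon-Nikodym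
  derivative.\<close>

lemma pushforward_density_nonneg:
  fixes f :: "'b \<Rightarrow> real"
  assumes \<psi>[measurable]: "\<psi> \<in> N \<rightarrow>\<^sub>M leb01"
    and ac: "absolutely_continuous leb01 (distr N leb01 \<psi>)"
    and f: "integrable N f" "\<And>x. 0 \<le> f x"
  shows "\<exists>h :: real \<Rightarrow> real. integrable leb01 h \<and> (\<forall>g :: real \<Rightarrow> complex. g \<in> borel_measurable leb01 \<longrightarrow>
       (\<integral>x. h x *\<^sub>R g x \<partial>leb01) = (\<integral>y. f y *\<^sub>R g (\<psi> y) \<partial>N))"
proof -
  have fm[measurable]: "f \<in> borel_measurable N" using f by simp
  define \<nu> where "\<nu> = distr (density N (\<lambda>x. ennreal (f x))) leb01 \<psi>"
  have \<nu>: "emeasure \<nu> A = (\<integral>\<^sup>+x. ennreal (f x) * indicator (\<psi> -` A \<inter> space N) x \<partial>N)"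
    if "A \<in> sets leb01" for A
    unfolding \<nu>_def using that by (subst emeasure_distr) (auto simp: emeasure_density)
  have sets: "sets \<nu> = sets leb01" by (simp add: \<nu>_def)
  have "emeasure \<nu> (space \<nu>) \<le> (\<integral>\<^sup>+x. ennreal (f x) \<partial>N)"
    using \<nu>[of "space leb01"] by (auto simp: \<nu>_def intro!: nn_integral_mono split: split_indicator)
  also have "\<dots> < \<infinity>" using f(1) f(2) by (subst nn_integral_eq_integral) auto
  finally have fin: "finite_measure \<nu>" by (intro finite_measureI) auto
  have ac': "absolutely_continuous leb01 \<nu>"
    unfolding absolutely_continuous_def
  proof (intro subsetI)
    fix A assume A: "A \<in> null_sets leb01"
    then have As: "A \<in> sets leb01" by auto
    have "A \<in> null_sets (distr N leb01 \<psi>)" using ac A by (auto simp: absolutely_continuous_def)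
    then have "\<psi> -` A \<inter> space N \<in> null_sets N" by (simp add: null_sets_distr_iff)
    then have "AE x in N. x \<notin> \<psi> -` A \<inter> space N" by (rule AE_not_in)
    then have "emeasure \<nu> A = 0"
      unfolding \<nu>[OF As] using As
      by (subst nn_integral_0_iff_AE) (auto elim: eventually_mono)
    then show "A \<in> null_sets \<nu>" using As sets by (intro null_setsI) auto
  qed
  obtain h where h: "h \<in> borel_measurable leb01" "AE x in leb01. RN_deriv leb01 \<nu> x = ennreal (h x)" "\<And>x. 0 \<le> h x"
    using leb01.real_RN_deriv[OF fin ac' sets] by blast
  note h(1)[measurable]
  have dens: "density leb01 (\<lambda>x. ennreal (h x)) = \<nu>"
  proof -
    have "density leb01 (RN_deriv leb01 \<nu>) = \<nu>" by (rule leb01.density_RN_deriv[OF ac' sets])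
    moreover have "density leb01 (RN_deriv leb01 \<nu>) = density leb01 (\<lambda>x. ennreal (h x))"
      using h(2) by (intro density_cong) auto
    ultimately show ?thesis by simp
  qed
  have "(\<integral>\<^sup>+x. ennreal (h x) \<partial>leb01) = emeasure (density leb01 (\<lambda>x. ennreal (h x))) (space leb01)"
    by (subst emeasure_density) (auto intro!: nn_integral_cong split: split_indicator)
  also have "\<dots> < \<infinity>"
    unfolding dens using finite_measure.emeasure_finite[OF fin] by (simp add: less_top)
  finally have "integrable leb01 h" using h(3) by (intro integrableI_nonneg) auto
  moreover have "(\<integral>x. h x *\<^sub>R g x \<partial>leb01) = (\<integral>y. f y *\<^sub>R g (\<psi> y) \<partial>N)"
    if [measurable]: "g \<in> borel_measurable leb01" for g :: "real \<Rightarrow> complex"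
  proof -
    have "(\<integral>x. h x *\<^sub>R g x \<partial>leb01) = (\<integral>x. g x \<partial>\<nu>)"
      unfolding dens[symmetric] using h(3) by (subst integral_density) auto
    also have "\<dots> = (\<integral>y. g (\<psi> y) \<partial>density N (\<lambda>x. ennreal (f x)))"
      unfolding \<nu>_def by (subst integral_distr) auto
    also have "\<dots> = (\<integral>y. f y *\<^sub>R g (\<psi> y) \<partial>N)"
      using f(2) by (subst integral_density) auto
    finally show ?thesis .
  qed
  ultimately show ?thesis by blast
qed

lemma integrable_bounded_mult:
  fixes f g :: "'b \<Rightarrow> complex"
  assumes "integrable N f" "g \<in> borel_measurable N" "\<And>x. x \<in> space N \<Longrightarrow> norm (g x) \<le> B"
  shows "integrable N (\<lambda>x. f x * g x)"
proof (rule Bochner_Integration.integrable_bound)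
  show "integrable N (\<lambda>x. B * norm (f x))" using assms by simp
  show "AE x in N. norm (f x * g x) \<le> norm (B * norm (f x))"
  proof (rule AE_I2)
    fix x assume "x \<in> space N"
    from assms(3)[OF this] have "norm (f x * g x) \<le> B * norm (f x)"
      unfolding norm_mult by (subst mult.commute) (intro mult_right_mono, auto)
    then show "norm (f x * g x) \<le> norm (B * norm (f x))" by simp
  qed
qed (use assms in auto)

lemma pushforward_density_combine:
  fixes f1 f2 :: "'b \<Rightarrow> complex" and h1 h2 :: "real \<Rightarrow> complex"
  assumes \<psi>: "\<psi> \<in> N \<rightarrow>\<^sub>M leb01" and f: "integrable N f1" "integrable N f2"
    and h: "integrable leb01 h1" "integrable leb01 h2"
    and eq: "\<forall>g\<in>bounded_measurable. (\<integral>x. h1 x * g x \<partial>leb01) = (\<integral>y. f1 y * g (\<psi> y) \<partial>N)"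
      "\<forall>g\<in>bounded_measurable. (\<integral>x. h2 x * g x \<partial>leb01) = (\<integral>y. f2 y * g (\<psi> y) \<partial>N)"
  shows "integrable leb01 (\<lambda>x. h1 x + c * h2 x) \<and> (\<forall>g\<in>bounded_measurable.
    (\<integral>x. (h1 x + c * h2 x) * g x \<partial>leb01) = (\<integral>y. (f1 y + c * f2 y) * g (\<psi> y) \<partial>N))"
proof (intro conjI ballI)
  show "integrable leb01 (\<lambda>x. h1 x + c * h2 x)" using h by simp
  fix g assume g: "g \<in> bounded_measurable"
  then have gm: "g \<in> borel_measurable leb01" by (simp add: bounded_measurable_def)
  obtain B where B: "\<And>x. norm (g x) \<le> B" using g by (auto simp: bounded_measurable_def)
  note gN = measurable_compose[OF \<psi> gm]
  have "(\<integral>x. (h1 x + c * h2 x) * g x \<partial>leb01) = (\<integral>x. h1 x * g x \<partial>leb01) + c * (\<integral>x. h2 x * g x \<partial>leb01)"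
    using integrable_bounded_mult[OF h(1) gm B] integrable_bounded_mult[OF h(2) gm B]
    by (simp add: distrib_right mult.assoc)
  also have "\<dots> = (\<integral>y. f1 y * g (\<psi> y) \<partial>N) + c * (\<integral>y. f2 y * g (\<psi> y) \<partial>N)"
    using eq g by simp
  also have "\<dots> = (\<integral>y. (f1 y + c * f2 y) * g (\<psi> y) \<partial>N)"
    using integrable_bounded_mult[OF f(1) gN B] integrable_bounded_mult[OF f(2) gN B]
    by (simp add: distrib_right mult.assoc)
  finally show "(\<integral>x. (h1 x + c * h2 x) * g x \<partial>leb01) = (\<integral>y. (f1 y + c * f2 y) * g (\<psi> y) \<partial>N)" .
qed

text \<open>Applied to a single map, this is the existence of its transfer operator; applied to the product of
  the noise space with \<open>[0,1]\<close>, it is the existence of the annealed one.\<close>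

lemma pushforward_density:
  fixes f :: "'b \<Rightarrow> complex"
  assumes \<psi>: "\<psi> \<in> N \<rightarrow>\<^sub>M leb01"
    and ac: "absolutely_continuous leb01 (distr N leb01 \<psi>)"
    and f: "integrable N f"
  shows "\<exists>h :: real \<Rightarrow> complex. integrable leb01 h \<and>
    (\<forall>g\<in>bounded_measurable. (\<integral>x. h x * g x \<partial>leb01) = (\<integral>y. f y * g (\<psi> y) \<partial>N))"
proof -
  have pos: "\<exists>h :: real \<Rightarrow> complex. integrable leb01 h \<and>
    (\<forall>g\<in>bounded_measurable. (\<integral>x. h x * g x \<partial>leb01) = (\<integral>y. complex_of_real (max 0 (u y)) * g (\<psi> y) \<partial>N))"
    if u: "integrable N u" for u :: "'b \<Rightarrow> real"
  proof -
    have "integrable N (\<lambda>y. max 0 (u y))" using u by simp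
    from pushforward_density_nonneg[OF \<psi> ac this max.cobounded1] obtain h :: "real \<Rightarrow> real"
      where h: "integrable leb01 h" "\<forall>g :: real \<Rightarrow> complex. g \<in> borel_measurable leb01 \<longrightarrow>
        (\<integral>x. h x *\<^sub>R g x \<partial>leb01) = (\<integral>y. max 0 (u y) *\<^sub>R g (\<psi> y) \<partial>N)" by blast
    show ?thesis
      by (rule exI[of _ "\<lambda>x. complex_of_real (h x)"])
         (use h integrable_of_real[OF h(1)] in \<open>auto simp: scaleR_conv_of_real bounded_measurable_def\<close>)
  qed
  have int: "integrable N (\<lambda>y. complex_of_real (max 0 (u y)))" if "integrable N u" for u :: "'b \<Rightarrow> real"
    using that by (intro integrable_of_real) simp
  have re: "integrable N (\<lambda>y. Re (f y))" "integrable N (\<lambda>y. - Re (f y))"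
    and im: "integrable N (\<lambda>y. Im (f y))" "integrable N (\<lambda>y. - Im (f y))"
    using f by (simp_all add: integrable_Re integrable_Im)
  obtain h1 h2 h3 h4 where
    h1: "integrable leb01 h1" "\<forall>g\<in>bounded_measurable. (\<integral>x. h1 x * g x \<partial>leb01) = (\<integral>y. complex_of_real (max 0 (Re (f y))) * g (\<psi> y) \<partial>N)" and
    h2: "integrable leb01 h2" "\<forall>g\<in>bounded_measurable. (\<integral>x. h2 x * g x \<partial>leb01) = (\<integral>y. complex_of_real (max 0 (- Re (f y))) * g (\<psi> y) \<partial>N)" and
    h3: "integrable leb01 h3" "\<forall>g\<in>bounded_measurable. (\<integral>x. h3 x * g x \<partial>leb01) = (\<integral>y. complex_of_real (max 0 (Im (f y))) * g (\<psi> y) \<partial>N)" and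
    h4: "integrable leb01 h4" "\<forall>g\<in>bounded_measurable. (\<integral>x. h4 x * g x \<partial>leb01) = (\<integral>y. complex_of_real (max 0 (- Im (f y))) * g (\<psi> y) \<partial>N)"
    using pos[OF re(1)] pos[OF re(2)] pos[OF im(1)] pos[OF im(2)] by blast
  note A = pushforward_density_combine[OF \<psi> int[OF re(1)] int[OF re(2)] h1(1) h2(1) h1(2) h2(2), of "-1"]
  note B = pushforward_density_combine[OF \<psi> int[OF im(1)] int[OF im(2)] h3(1) h4(1) h3(2) h4(2), of "-1"]
  let ?fA = "\<lambda>y. complex_of_real (max 0 (Re (f y))) + - 1 * complex_of_real (max 0 (- Re (f y)))"
  let ?fB = "\<lambda>y. complex_of_real (max 0 (Im (f y))) + - 1 * complex_of_real (max 0 (- Im (f y)))"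
  have iA: "integrable N ?fA" "integrable N ?fB"
    by (intro Bochner_Integration.integrable_add integrable_mult_right int re im)+
  have "f y = ?fA y + \<i> * ?fB y" for y by (simp add: complex_eq_iff max_def)
  then have "(\<lambda>y. ?fA y + \<i> * ?fB y) = f" by auto
  with pushforward_density_combine[OF \<psi> iA conjunct1[OF A] conjunct1[OF B] conjunct2[OF A] conjunct2[OF B], of \<i>]
  show ?thesis by metis
qed

lemma bounded_measurable_restrict:
  fixes g :: "real \<Rightarrow> complex"
  assumes "g \<in> borel_measurable leb01" "\<And>x. x \<in> {0..1} \<Longrightarrow> norm (g x) \<le> B"
  shows "(\<lambda>x. indicator {0..1} x *\<^sub>R g x) \<in> bounded_measurable"
proof -
  have "(\<lambda>x. indicator {0..1} x *\<^sub>R g x) \<in> borel_measurable leb01"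
    using assms(1) by measurable
  moreover have "norm (indicator {0..1} x *\<^sub>R g x) \<le> max B 0" for x
    using assms(2)[of x]
    by (cases "x \<in> {0..1}") (auto intro: max.coboundedI1)
  ultimately show ?thesis unfolding bounded_measurable_def by blast
qed

context random_system
begin

lemma measurable_T_comp [measurable (raw)]:
  assumes "f \<in> N \<rightarrow>\<^sub>M M" "g \<in> N \<rightarrow>\<^sub>M leb01"
  shows "(\<lambda>y. T (f y) (g y)) \<in> N \<rightarrow>\<^sub>M leb01"
  using measurable_compose[OF measurable_Pair[OF assms] measurable_T] by simp

lemma T_in_unit_interval: "\<omega> \<in> space M \<Longrightarrow> x \<in> {0..1} \<Longrightarrow> T \<omega> x \<in> {0..1}"
  using measurable_space[OF measurable_T, of "(\<omega>, x)"] by (simp add: space_pair_measure)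

lemma pair_prob_space_leb01: "pair_prob_space M leb01"
  by unfold_locales

lemma koopman_measurable [measurable (raw)]:
  fixes g :: "real \<Rightarrow> 'b::{banach, second_countable_topology}"
  assumes [measurable]: "g \<in> borel_measurable leb01"
  shows "annealed_koopman M T g \<in> borel_measurable leb01"
  unfolding annealed_koopman_def[abs_def] by measurable

lemma koopman_bounded:
  fixes g :: "real \<Rightarrow> 'b::{banach, second_countable_topology}"
  assumes [measurable]: "g \<in> borel_measurable leb01" and B: "\<And>x. x \<in> {0..1} \<Longrightarrow> norm (g x) \<le> B"
    and x: "x \<in> {0..1}"
  shows "integrable M (\<lambda>\<omega>. g (T \<omega> x))" "norm (annealed_koopman M T g x) \<le> B"
proof -
  have meas: "(\<lambda>\<omega>. g (T \<omega> x)) \<in> borel_measurable M"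
  proof -
    have "(\<lambda>\<omega>. x) \<in> M \<rightarrow>\<^sub>M leb01" using x by (intro measurable_const) simp
    then show ?thesis by measurable
  qed
  have bd: "norm (g (T \<omega> x)) \<le> B" if "\<omega> \<in> space M" for \<omega>
    using B[OF T_in_unit_interval[OF that x]] .
  show int: "integrable M (\<lambda>\<omega>. g (T \<omega> x))"
    by (rule integrable_const_bound[of _ B]) (use meas bd in auto)
  have "norm (annealed_koopman M T g x) \<le> (\<integral>\<omega>. norm (g (T \<omega> x)) \<partial>M)"
    unfolding annealed_koopman_def by (rule integral_norm_bound)
  also have "\<dots> \<le> (\<integral>\<omega>. B \<partial>M)"
    using int bd by (intro integral_mono) auto
  also have "\<dots> = B" by (simp add: prob_space)
  finally show "norm (annealed_koopman M T g x) \<le> B" .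
qed

lemma transfer_duality:
  assumes \<omega>: "\<omega> \<in> space M" and f: "integrable leb01 f" and g: "g \<in> bounded_measurable"
  shows "(\<integral>x. transfer (T \<omega>) f x * g x \<partial>leb01) = (\<integral>x. f x * g (T \<omega> x) \<partial>leb01)"
proof -
  have "T \<omega> \<in> leb01 \<rightarrow>\<^sub>M leb01"
    using measurable_T_comp[of "\<lambda>_. \<omega>" leb01 "\<lambda>x. x"] \<omega> by simp
  from someI_ex[OF pushforward_density[OF this nonsingular_T[OF \<omega>] f]] g
  show ?thesis unfolding transfer_def by blast
qed

text \<open>Both transfer operators are Hilbert choices, so everything about them rests on the existence of a
  function with the defining duality. Fubini's theorem turns the average of the dual pairings into
  a pairing with the annealed Koopman operator.\<close>

lemma annealed_transfer_duality:
  assumes f: "integrable leb01 f"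
  shows "integrable leb01 (annealed_transfer M T f)"
    and "\<And>g. g \<in> bounded_measurable \<Longrightarrow>
      (\<integral>x. annealed_transfer M T f x * g x \<partial>leb01) = (\<integral>x. f x * annealed_koopman M T g x \<partial>leb01)"
proof -
  interpret P: pair_prob_space M leb01 by (rule pair_prob_space_leb01)
  let ?N = "M \<Otimes>\<^sub>M leb01"
  have fm[measurable]: "f \<in> borel_measurable leb01" using f by simp
  have fN: "integrable ?N (\<lambda>z. f (snd z))"
    by (rule P.Fubini_integrable) (use f in \<open>auto simp: prob_space\<close>)
  have ac: "absolutely_continuous leb01 (distr ?N leb01 (\<lambda>(\<omega>, x). T \<omega> x))"
    unfolding absolutely_continuous_def
  proof (intro subsetI)
    fix A assume A: "A \<in> null_sets leb01"
    then have As[measurable]: "A \<in> sets leb01" by auto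
    have "emeasure (distr ?N leb01 (\<lambda>(\<omega>, x). T \<omega> x)) A
        = emeasure ?N ((\<lambda>(\<omega>, x). T \<omega> x) -` A \<inter> space ?N)"
      by (rule emeasure_distr[OF measurable_T As])
    also have "\<dots> = (\<integral>\<^sup>+\<omega>. emeasure leb01 (Pair \<omega> -` ((\<lambda>(\<omega>, x). T \<omega> x) -` A \<inter> space ?N)) \<partial>M)"
      by (intro leb01.emeasure_pair_measure_alt measurable_sets[OF measurable_T As])
    also have "\<dots> = (\<integral>\<^sup>+\<omega>. 0 \<partial>M)"
    proof (intro nn_integral_cong)
      fix \<omega> assume \<omega>: "\<omega> \<in> space M"
      have T\<omega>: "T \<omega> \<in> leb01 \<rightarrow>\<^sub>M leb01"
        using measurable_T_comp[of "\<lambda>_. \<omega>" leb01 "\<lambda>x. x"] \<omega> by simp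
      have "A \<in> null_sets (distr leb01 leb01 (T \<omega>))"
        using nonsingular_T[OF \<omega>] A by (auto simp: absolutely_continuous_def)
      then have "emeasure leb01 (T \<omega> -` A \<inter> space leb01) = 0"
        using emeasure_distr[OF T\<omega> As] by auto
      moreover have "Pair \<omega> -` ((\<lambda>(\<omega>, x). T \<omega> x) -` A \<inter> space ?N) = T \<omega> -` A \<inter> space leb01"
        using \<omega> by (auto simp: space_pair_measure)
      ultimately show "emeasure leb01 (Pair \<omega> -` ((\<lambda>(\<omega>, x). T \<omega> x) -` A \<inter> space ?N)) = 0" by simp
    qed
    finally show "A \<in> null_sets (distr ?N leb01 (\<lambda>(\<omega>, x). T \<omega> x))"
      using As by (intro null_setsI) auto
  qed
  have iter: "(\<integral>z. f (snd z) * g (case z of (\<omega>, x) \<Rightarrow> T \<omega> x) \<partial>?N)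
      = (\<integral>\<omega>. (\<integral>x. f x * g (T \<omega> x) \<partial>leb01) \<partial>M)"
    and swap: "(\<integral>\<omega>. (\<integral>x. f x * g (T \<omega> x) \<partial>leb01) \<partial>M) = (\<integral>x. f x * annealed_koopman M T g x \<partial>leb01)"
    if g: "g \<in> bounded_measurable" for g
  proof -
    have gm[measurable]: "g \<in> borel_measurable leb01" using g by (simp add: bounded_measurable_def)
    obtain B where B: "\<And>x. norm (g x) \<le> B" using g by (auto simp: bounded_measurable_def)
    have int: "integrable ?N (\<lambda>z. f (snd z) * g (T (fst z) (snd z)))"
      using fN by (rule integrable_bounded_mult[where B=B]) (use B in measurable)
    show "(\<integral>z. f (snd z) * g (case z of (\<omega>, x) \<Rightarrow> T \<omega> x) \<partial>?N) = (\<integral>\<omega>. (\<integral>x. f x * g (T \<omega> x) \<partial>leb01) \<partial>M)"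
      using P.integral_fst'[OF int] by (simp add: case_prod_beta')
    have "(\<integral>\<omega>. (\<integral>x. f x * g (T \<omega> x) \<partial>leb01) \<partial>M) = (\<integral>x. (\<integral>\<omega>. f x * g (T \<omega> x) \<partial>M) \<partial>leb01)"
      using P.Fubini_integral[of "\<lambda>\<omega> x. f x * g (T \<omega> x)"] int by (simp add: case_prod_beta')
    also have "\<dots> = (\<integral>x. f x * annealed_koopman M T g x \<partial>leb01)"
      unfolding annealed_koopman_def
    proof (intro Bochner_Integration.integral_cong refl)
      fix x assume x: "x \<in> space leb01"
      show "(\<integral>\<omega>. f x * g (T \<omega> x) \<partial>M) = f x * (\<integral>\<omega>. g (T \<omega> x) \<partial>M)"
        by simp
    qed
    finally show "(\<integral>\<omega>. (\<integral>x. f x * g (T \<omega> x) \<partial>leb01) \<partial>M) = (\<integral>x. f x * annealed_koopman M T g x \<partial>leb01)" .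
  qed
  have tr: "(\<integral>\<omega>. (\<integral>x. transfer (T \<omega>) f x * g x \<partial>leb01) \<partial>M) = (\<integral>\<omega>. (\<integral>x. f x * g (T \<omega> x) \<partial>leb01) \<partial>M)"
    if g: "g \<in> bounded_measurable" for g
    by (intro Bochner_Integration.integral_cong refl transfer_duality f g)
  have "\<exists>h. integrable leb01 h \<and> (\<forall>g\<in>bounded_measurable.
        (\<integral>x. h x * g x \<partial>leb01) = (\<integral>\<omega>. (\<integral>x. transfer (T \<omega>) f x * g x \<partial>leb01) \<partial>M))"
    using pushforward_density[OF measurable_T ac fN] iter tr by simp
  from someI_ex[OF this]
  have *: "integrable leb01 (annealed_transfer M T f) \<and> (\<forall>g\<in>bounded_measurable.
        (\<integral>x. annealed_transfer M T f x * g x \<partial>leb01) = (\<integral>\<omega>. (\<integral>x. transfer (T \<omega>) f x * g x \<partial>leb01) \<partial>M))"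
    unfolding annealed_transfer_def .
  then show "integrable leb01 (annealed_transfer M T f)" by blast
  show "(\<integral>x. annealed_transfer M T f x * g x \<partial>leb01) = (\<integral>x. f x * annealed_koopman M T g x \<partial>leb01)"
    if "g \<in> bounded_measurable" for g
    using * tr[OF that] swap[OF that] that by simp
qed

text \<open>The spectral hypotheses concern complex functions, while densities of the chain are real.\<close>

definition real_transfer :: "(real \<Rightarrow> real) \<Rightarrow> real \<Rightarrow> real" where
  "real_transfer d x = Re (annealed_transfer M T (\<lambda>x. complex_of_real (d x)) x)"

lemma real_transfer_duality:
  fixes g :: "real \<Rightarrow> real"
  assumes d: "integrable leb01 d" and g: "g \<in> borel_measurable leb01"
    and B: "\<And>x. x \<in> {0..1} \<Longrightarrow> \<bar>g x\<bar> \<le> B"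
  shows "(\<integral>x. real_transfer d x * g x \<partial>leb01) = (\<integral>x. d x * annealed_koopman M T g x \<partial>leb01)"
proof -
  define g' where "g' x = indicator {0..1} x *\<^sub>R complex_of_real (g x)" for x
  let ?P = "annealed_transfer M T (\<lambda>x. complex_of_real (d x))"
  have dc: "integrable leb01 (\<lambda>x. complex_of_real (d x))" by (rule integrable_of_real[OF d])
  have g': "g' \<in> bounded_measurable"
    unfolding g'_def using g B by (intro bounded_measurable_restrict[where B=B]) auto
  have int: "integrable leb01 (\<lambda>x. ?P x * g' x)"
    using annealed_transfer_duality(1)[OF dc] g' unfolding bounded_measurable_def
    by (auto intro: integrable_bounded_mult)
  have eq: "annealed_koopman M T g' x = complex_of_real (annealed_koopman M T g x)" if x: "x \<in> {0..1}" for x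
  proof -
    have "annealed_koopman M T g' x = (\<integral>\<omega>. complex_of_real (g (T \<omega> x)) \<partial>M)"
      unfolding annealed_koopman_def
      by (intro Bochner_Integration.integral_cong refl) (use T_in_unit_interval x in \<open>simp add: g'_def\<close>)
    then show ?thesis by (simp add: annealed_koopman_def)
  qed
  have "(\<integral>x. real_transfer d x * g x \<partial>leb01) = (\<integral>x. Re (?P x * g' x) \<partial>leb01)"
    by (intro Bochner_Integration.integral_cong refl) (simp add: real_transfer_def g'_def)
  also have "\<dots> = Re (\<integral>x. ?P x * g' x \<partial>leb01)"
    by (rule integral_Re[OF int])
  also have "(\<integral>x. ?P x * g' x \<partial>leb01) = (\<integral>x. complex_of_real (d x) * annealed_koopman M T g' x \<partial>leb01)"
    by (rule annealed_transfer_duality(2)[OF dc g'])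
  also have "\<dots> = (\<integral>x. complex_of_real (d x * annealed_koopman M T g x) \<partial>leb01)"
    by (intro Bochner_Integration.integral_cong refl) (simp add: eq)
  also have "Re \<dots> = (\<integral>x. d x * annealed_koopman M T g x \<partial>leb01)"
    by (simp only: integral_complex_of_real Re_complex_of_real)
  finally show ?thesis .
qed

lemma real_transfer_bv:
  assumes bdd: "\<forall>f\<in>BV. annealed_transfer M T f \<in> BV" 
    and C: "\<forall>f\<in>BV. BV_norm (annealed_transfer M T f) \<le> C * BV_norm f"
    and d: "bv_bounded B d" and B: "0 < B"
  shows "bv_bounded ((2 * \<bar>C\<bar> + 1) * B) (real_transfer d)"
proof -
  have dc: "bv_bounded B (\<lambda>x. complex_of_real (d x))" by (rule bv_bounded_of_real[OF d])
  note BV = bv_bounded_imp_BV[OF dc]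
  have nn: "0 \<le> BV_norm (\<lambda>x. complex_of_real (d x))"
    by (simp add: BV_norm_def L1_norm_def)
  have "BV_norm (annealed_transfer M T (\<lambda>x. complex_of_real (d x))) \<le> C * BV_norm (\<lambda>x. complex_of_real (d x))"
    using C BV(1) by blast
  also have "\<dots> \<le> \<bar>C\<bar> * (2 * B)"
    using BV(2) nn by (intro mult_mono) auto
  also have "\<dots> < (2 * \<bar>C\<bar> + 1) * B" using B by (simp add: algebra_simps)
  finally have "bv_bounded ((2 * \<bar>C\<bar> + 1) * B) (annealed_transfer M T (\<lambda>x. complex_of_real (d x)))"
    using bdd BV(1) by (intro BV_imp_bv_bounded) auto
  then show ?thesis unfolding real_transfer_def[abs_def] by (rule bv_bounded_Re)
qed

section \<open>The density of the stationary measure\<close>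

text \<open>Stationarity says that \<open>\<mu>\<close> is the image of the product of the noise law and \<open>\<mu>\<close> under the random map.\<close>

lemma stationary_integral:
  fixes g :: "real \<Rightarrow> 'b::{banach, second_countable_topology}"
  assumes st: "ac_stationary M T \<mu>" and gm: "g \<in> borel_measurable leb01"
    and B: "\<And>x. x \<in> {0..1} \<Longrightarrow> norm (g x) \<le> B"
  shows "(\<integral>x. annealed_koopman M T g x \<partial>\<mu>) = (\<integral>x. g x \<partial>\<mu>)"
proof -
  have ps: "prob_space \<mu>" and sets: "sets \<mu> = sets leb01"
    using st by (auto simp: ac_stationary_def)
  interpret \<mu>: prob_space \<mu> by (rule ps)
  interpret P: pair_prob_space M \<mu> by unfold_locales
  have space: "space \<mu> = {0..1}" using sets_eq_imp_space_eq[OF sets] by simp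
  have mT: "(\<lambda>(\<omega>, x). T \<omega> x) \<in> M \<Otimes>\<^sub>M \<mu> \<rightarrow>\<^sub>M leb01"
    using measurable_T by (simp cong: measurable_cong_sets add: sets sets_pair_measure_cong[OF refl sets])
  have distr: "distr (M \<Otimes>\<^sub>M \<mu>) leb01 (\<lambda>(\<omega>, x). T \<omega> x) = \<mu>"
  proof (rule measure_eqI)
    fix A assume "A \<in> sets (distr (M \<Otimes>\<^sub>M \<mu>) leb01 (\<lambda>(\<omega>, x). T \<omega> x))"
    then have A: "A \<in> sets leb01" by simp
    have "emeasure (distr (M \<Otimes>\<^sub>M \<mu>) leb01 (\<lambda>(\<omega>, x). T \<omega> x)) A
      = emeasure (M \<Otimes>\<^sub>M \<mu>) ((\<lambda>(\<omega>, x). T \<omega> x) -` A \<inter> space (M \<Otimes>\<^sub>M \<mu>))"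
      by (rule emeasure_distr[OF mT A])
    also have "\<dots> = (\<integral>\<^sup>+\<omega>. emeasure \<mu> (Pair \<omega> -` ((\<lambda>(\<omega>, x). T \<omega> x) -` A \<inter> space (M \<Otimes>\<^sub>M \<mu>))) \<partial>M)"
      by (intro \<mu>.emeasure_pair_measure_alt measurable_sets[OF mT A])
    also have "\<dots> = (\<integral>\<^sup>+\<omega>. emeasure \<mu> (T \<omega> -` A \<inter> space \<mu>) \<partial>M)"
      by (intro nn_integral_cong arg_cong2[where f=emeasure] refl) (auto simp: space_pair_measure)
    also have "\<dots> = emeasure \<mu> A"
      using st A sets by (auto simp: ac_stationary_def)
    finally show "emeasure (distr (M \<Otimes>\<^sub>M \<mu>) leb01 (\<lambda>(\<omega>, x). T \<omega> x)) A = emeasure \<mu> A" .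
  qed (simp add: sets)
  have int: "integrable (M \<Otimes>\<^sub>M \<mu>) (\<lambda>(\<omega>, x). g (T \<omega> x))"
  proof (rule P.integrable_const_bound[of _ B])
    show "(\<lambda>(\<omega>, x). g (T \<omega> x)) \<in> borel_measurable (M \<Otimes>\<^sub>M \<mu>)"
      using measurable_compose[OF mT gm] by (simp add: case_prod_beta')
    show "AE z in M \<Otimes>\<^sub>M \<mu>. norm (case z of (\<omega>, x) \<Rightarrow> g (T \<omega> x)) \<le> B"
      by (rule AE_I2) (auto simp: space_pair_measure space intro!: B T_in_unit_interval)
  qed
  have "(\<integral>x. g x \<partial>\<mu>) = (\<integral>x. g x \<partial>distr (M \<Otimes>\<^sub>M \<mu>) leb01 (\<lambda>(\<omega>, x). T \<omega> x))"
    by (simp only: distr)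
  also have "\<dots> = (\<integral>z. g (case z of (\<omega>, x) \<Rightarrow> T \<omega> x) \<partial>(M \<Otimes>\<^sub>M \<mu>))"
    by (rule integral_distr[OF mT gm])
  also have "\<dots> = (\<integral>z. (case z of (\<omega>, x) \<Rightarrow> g (T \<omega> x)) \<partial>(M \<Otimes>\<^sub>M \<mu>))"
    by (intro Bochner_Integration.integral_cong refl) (simp add: case_prod_beta')
  also have "\<dots> = (\<integral>x. (\<integral>\<omega>. g (T \<omega> x) \<partial>M) \<partial>\<mu>)"
    by (rule P.integral_snd[OF int, symmetric])
  finally show ?thesis by (simp add: annealed_koopman_def)
qed

lemma ac_stationary_density:
  assumes st: "ac_stationary M T \<mu>"
  obtains h :: "real \<Rightarrow> real" where "integrable leb01 h" "\<And>x. 0 \<le> h x" "\<mu> = density leb01 (\<lambda>x. ennreal (h x))"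
proof -
  have ps: "prob_space \<mu>" and sets: "sets \<mu> = sets leb01" and ac: "absolutely_continuous leb01 \<mu>"
    using st by (auto simp: ac_stationary_def)
  interpret \<mu>: prob_space \<mu> by (rule ps)
  obtain h where h: "h \<in> borel_measurable leb01" "AE x in leb01. RN_deriv leb01 \<mu> x = ennreal (h x)" "\<And>x. 0 \<le> h x"
    using leb01.real_RN_deriv[OF \<mu>.finite_measure_axioms ac sets] by blast
  have "density leb01 (RN_deriv leb01 \<mu>) = \<mu>" by (rule leb01.density_RN_deriv[OF ac sets])
  moreover have "density leb01 (RN_deriv leb01 \<mu>) = density leb01 (\<lambda>x. ennreal (h x))"
    using h(1,2) by (intro density_cong) auto
  ultimately have dens: "\<mu> = density leb01 (\<lambda>x. ennreal (h x))" by simp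
  have "(\<integral>\<^sup>+x. ennreal (h x) \<partial>leb01) = emeasure (density leb01 (\<lambda>x. ennreal (h x))) (space leb01)"
    using h(1) by (subst emeasure_density) (auto intro!: nn_integral_cong split: split_indicator)
  also have "\<dots> < \<infinity>"
    unfolding dens[symmetric] using \<mu>.emeasure_finite by (simp add: less_top[symmetric])
  finally have "integrable leb01 h" using h(1,3) by (intro integrableI_nonneg) auto
  from that[OF this h(3) dens] show thesis .
qed

lemma mult_cnj_sgn: "z * cnj (sgn z) = complex_of_real (cmod z)"
proof (cases "z = 0")
  case False
  have "z * cnj (sgn z) = (z * cnj z) / complex_of_real (cmod z)"
    by (simp add: sgn_eq)
  also have "\<dots> = complex_of_real (cmod z)"
    using False by (simp add: complex_norm_square[symmetric] power2_eq_square)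
  finally show ?thesis .
qed simp

text \<open>The density \<open>h\<close> is fixed by the transfer operator and the operator contracts \<open>L\<^sup>1\<close>. Testing the
  difference against its conjugate sign shows both at once, through the dual operator, which is
  bounded by \<open>1\<close> on \<open>L\<^sup>\<infinity>\<close>.\<close>

lemma annealed_transfer_contraction:
  assumes st: "ac_stationary M T \<mu>"
    and h: "integrable leb01 h" "\<And>x. 0 \<le> h x" "\<mu> = density leb01 (\<lambda>x. ennreal (h x))"
    and f: "integrable leb01 f"
  shows "(\<integral>x. cmod (annealed_transfer M T f x - complex_of_real (h x)) \<partial>leb01)
    \<le> (\<integral>x. cmod (f x - complex_of_real (h x)) \<partial>leb01)"
proof -
  let ?P = "annealed_transfer M T f" and ?h = "\<lambda>x. complex_of_real (h x)"
  have hc: "integrable leb01 ?h" by (rule integrable_of_real[OF h(1)])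
  note P = annealed_transfer_duality[OF f]
  define g where "g x = cnj (sgn (?P x - ?h x))" for x
  have g1: "cmod (g x) \<le> 1" for x by (simp add: g_def norm_sgn)
  have gm[measurable]: "g \<in> borel_measurable leb01"
  proof -
    have [measurable]: "?P \<in> borel_measurable leb01" "?h \<in> borel_measurable leb01"
      using P(1) hc by auto
    have "(\<lambda>x. sgn (?P x - ?h x)) \<in> borel_measurable leb01"
      unfolding sgn_div_norm by measurable
    then show ?thesis unfolding g_def[abs_def] by (rule borel_measurable_continuous_on[rotated]) (intro continuous_intros)
  qed
  have g: "g \<in> bounded_measurable" using gm g1 by (auto simp: bounded_measurable_def)
  have Km: "annealed_koopman M T g \<in> borel_measurable leb01" by measurable
  have K1: "cmod (annealed_koopman M T g x) \<le> 1" if "x \<in> {0..1}" for x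
    using koopman_bounded(2)[OF gm g1 that] .
  have hst: "(\<integral>x. ?h x * annealed_koopman M T g x \<partial>leb01) = (\<integral>x. ?h x * g x \<partial>leb01)"
  proof -
    have "(\<integral>x. annealed_koopman M T g x \<partial>\<mu>) = (\<integral>x. g x \<partial>\<mu>)"
      by (rule stationary_integral[OF st gm g1])
    then show ?thesis
      unfolding h(3) using h(1,2) Km gm
      by (simp add: integral_density scaleR_conv_of_real)
  qed
  have i1: "integrable leb01 (\<lambda>x. ?P x * g x)" "integrable leb01 (\<lambda>x. ?h x * g x)"
    by (rule integrable_bounded_mult[OF _ gm g1], rule P(1) hc)+
  have i2: "integrable leb01 (\<lambda>x. f x * annealed_koopman M T g x)"
    "integrable leb01 (\<lambda>x. ?h x * annealed_koopman M T g x)"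
    using integrable_bounded_mult[OF f Km, of 1] integrable_bounded_mult[OF hc Km, of 1] K1 by simp_all
  have "complex_of_real (\<integral>x. cmod (?P x - ?h x) \<partial>leb01) = (\<integral>x. (?P x - ?h x) * g x \<partial>leb01)"
    by (simp add: g_def mult_cnj_sgn)
  also have "\<dots> = (\<integral>x. ?P x * g x \<partial>leb01) - (\<integral>x. ?h x * g x \<partial>leb01)"
    using i1 by (simp add: left_diff_distrib)
  also have "\<dots> = (\<integral>x. f x * annealed_koopman M T g x \<partial>leb01) - (\<integral>x. ?h x * annealed_koopman M T g x \<partial>leb01)"
    by (simp only: P(2)[OF g] hst)
  also have "\<dots> = (\<integral>x. (f x - ?h x) * annealed_koopman M T g x \<partial>leb01)"
    using i2 by (simp add: left_diff_distrib)
  finally have eq: "complex_of_real (\<integral>x. cmod (?P x - ?h x) \<partial>leb01)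
     = (\<integral>x. (f x - ?h x) * annealed_koopman M T g x \<partial>leb01)" .
  have fh: "integrable leb01 (\<lambda>x. f x - ?h x)" using f hc by simp
  have "(\<integral>x. cmod (?P x - ?h x) \<partial>leb01) = cmod (complex_of_real (\<integral>x. cmod (?P x - ?h x) \<partial>leb01))"
    by (simp only: norm_of_real) (simp add: abs_of_nonneg)
  also have "\<dots> \<le> (\<integral>x. cmod ((f x - ?h x) * annealed_koopman M T g x) \<partial>leb01)"
    unfolding eq by (rule integral_norm_bound)
  also have "\<dots> \<le> (\<integral>x. cmod (f x - ?h x) \<partial>leb01)"
  proof (rule integral_mono)
    show "integrable leb01 (\<lambda>x. cmod ((f x - ?h x) * annealed_koopman M T g x))"
      using integrable_bounded_mult[OF fh Km, of 1] K1 by (intro integrable_norm) simp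
    show "integrable leb01 (\<lambda>x. cmod (f x - ?h x))" using fh by (rule integrable_norm)
    show "cmod ((f x - ?h x) * annealed_koopman M T g x) \<le> cmod (f x - ?h x)" if "x \<in> space leb01" for x
      unfolding norm_mult using K1[of x] that by (intro mult_left_le) auto
  qed
  finally show ?thesis .
qed

text \<open>Stationarity only provides an integrable density. Let \<open>f\<close> be of bounded variation and \<open>L\<^sup>1\<close>-close to
  \<open>h\<close>. All iterates \<open>P\<^sup>n f\<close> stay as close to \<open>h\<close>, while the Lasota-Yorke inequality eventually brings
  their norm below a bound that depends only on the \<open>L\<^sup>1\<close> norm, not on \<open>f\<close>. Hence \<open>h\<close> is an \<open>L\<^sup>1\<close> limit
  of functions of uniformly bounded variation.\<close>

lemma stationary_density_bv:
  assumes st: "ac_stationary M T \<mu>"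
    and h: "integrable leb01 h" "\<And>x. 0 \<le> h x" "\<mu> = density leb01 (\<lambda>x. ennreal (h x))"
    and bdd: "BV_bounded_operator (annealed_transfer M T)"
    and ly: "lasota_yorke (annealed_transfer M T)"
  shows "\<exists>B. bv_bounded B h"
proof -
  let ?P = "annealed_transfer M T" and ?h = "\<lambda>x. complex_of_real (h x)"
  obtain N \<rho> K where N: "\<rho> < 1" "0 \<le> K"
    and LY: "\<And>f. f \<in> BV \<Longrightarrow> BV_norm ((?P ^^ N) f) \<le> \<rho> * BV_norm f + K * L1_norm leb01 f"
    using ly unfolding lasota_yorke_def by blast
  have BV: "?P f \<in> BV" if "f \<in> BV" for f using bdd that by (auto simp: BV_bounded_operator_def)
  define Q where "Q = ?P ^^ N"
  define \<rho>' where "\<rho>' = max \<rho> 0"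
  have \<rho>': "0 \<le> \<rho>'" "\<rho>' < 1" using N by (auto simp: \<rho>'_def)
  define I where "I f = (\<integral>x. cmod (f x - ?h x) \<partial>leb01)" for f
  have hc: "integrable leb01 ?h" by (rule integrable_of_real[OF h(1)])
  have norm_nonneg: "0 \<le> BV_norm f" for f :: "real \<Rightarrow> complex" by (simp add: BV_norm_def L1_norm_def)
  have Pn: "(?P ^^ n) f \<in> BV \<and> I ((?P ^^ n) f) \<le> I f" if "f \<in> BV" for f n
  proof (induction n)
    case (Suc n)
    then have "integrable leb01 ((?P ^^ n) f)" by (simp add: BV_def)
    from annealed_transfer_contraction[OF st h this] Suc BV show ?case
      by (auto simp: I_def)
  qed (use that in simp)
  have Qn: "(Q ^^ n) f \<in> BV" "I ((Q ^^ n) f) \<le> I f" if "f \<in> BV" for f n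
    using Pn[OF that, of "N * n"] by (simp_all add: Q_def funpow_mult)
  \<comment> \<open>bounds the \<open>L\<^sup>1\<close> norm of everything within distance \<open>1\<close> of \<open>h\<close>\<close>
  define c where "c = (\<integral>x. h x \<partial>leb01) + 1"
  have c: "0 \<le> c" using h(2) by (simp add: c_def)
  have L1: "L1_norm leb01 f \<le> c" if "f \<in> BV" "I f \<le> 1" for f
  proof -
    have fi: "integrable leb01 f" using that by (simp add: BV_def)
    have "L1_norm leb01 f \<le> (\<integral>x. cmod (f x - ?h x) + h x \<partial>leb01)"
      unfolding L1_norm_def
    proof (rule integral_mono)
      show "cmod (f x) \<le> cmod (f x - ?h x) + h x" for x
        using norm_triangle_ineq[of "f x - ?h x" "?h x"] h(2)[of x] by simp
    qed (use fi hc h(1) in auto)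
    also have "\<dots> = I f + (\<integral>x. h x \<partial>leb01)"
      unfolding I_def using fi hc h(1) by (intro Bochner_Integration.integral_add) auto
    finally show ?thesis using that by (simp add: c_def)
  qed
  have iter: "BV_norm ((Q ^^ n) f) \<le> \<rho>' ^ n * BV_norm f + K * c / (1 - \<rho>')" if "f \<in> BV" "I f \<le> 1" for f n
  proof (induction n)
    case 0
    then show ?case using N(2) c \<rho>' by simp
  next
    case (Suc n)
    have "BV_norm ((Q ^^ Suc n) f) \<le> \<rho> * BV_norm ((Q ^^ n) f) + K * L1_norm leb01 ((Q ^^ n) f)"
      using LY[OF Qn(1)[OF that(1)], of n] by (simp add: Q_def)
    also have "\<dots> \<le> \<rho>' * BV_norm ((Q ^^ n) f) + K * c"
      using L1[OF Qn(1)[OF that(1)], of n] Qn(2)[OF that(1), of n] that(2) N(2) norm_nonneg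
      by (intro add_mono mult_right_mono mult_left_mono) (auto simp: \<rho>'_def)
    also have "\<dots> \<le> \<rho>' * (\<rho>' ^ n * BV_norm f + K * c / (1 - \<rho>')) + K * c"
      using Suc \<rho>' by (intro add_right_mono mult_left_mono) auto
    also have "\<dots> = \<rho>' ^ Suc n * BV_norm f + K * c / (1 - \<rho>')"
      using \<rho>' by (simp add: field_simps)
    finally show ?case .
  qed
  \<comment> \<open>\<open>K * c / (1 - \<rho>')\<close> is the fixed point of the Lasota-Yorke recursion\<close>
  define B where "B = K * c / (1 - \<rho>') + 1"
  have ex: "\<exists>f. bv_bounded B f \<and> (\<integral>x. \<bar>f x - h x\<bar> \<partial>leb01) \<le> 1 / real (Suc k)" for k
  proof -
    have "0 < 1 / real (Suc k)" by simp
    then obtain D g where g: "bv_bounded D g" "(\<integral>x. \<bar>g x - h x\<bar> \<partial>leb01) < 1 / real (Suc k)"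
      using integrable_imp_L1_approximable[OF h(1)] unfolding L1_approximable_def by blast
    define gc where "gc x = complex_of_real (g x)" for x
    have gBV: "gc \<in> BV" unfolding gc_def[abs_def] by (rule bv_bounded_imp_BV(1)[OF bv_bounded_of_real[OF g(1)]])
    have "cmod (gc x - ?h x) = \<bar>g x - h x\<bar>" for x
      unfolding gc_def of_real_diff[symmetric] norm_of_real by simp
    then have Ig: "I gc < 1 / real (Suc k)" using g(2) by (simp add: I_def)
    moreover have "1 / real (Suc k) \<le> 1" by simp
    ultimately have Ig1: "I gc \<le> 1" by linarith
    have "(\<lambda>n. \<rho>' ^ n * BV_norm gc) \<longlonglongrightarrow> 0 * BV_norm gc"
      using \<rho>' by (intro tendsto_mult LIMSEQ_power_zero tendsto_const) auto
    then have "eventually (\<lambda>n. \<rho>' ^ n * BV_norm gc < 1) sequentially"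
      by (intro order_tendstoD(2)) auto
    then obtain n where n: "\<rho>' ^ n * BV_norm gc < 1" by (auto simp: eventually_sequentially)
    have "BV_norm ((Q ^^ n) gc) < B" using iter[OF gBV Ig1, of n] n by (simp add: B_def)
    then have bv: "bv_bounded B (\<lambda>x. Re ((Q ^^ n) gc x))"
      by (intro bv_bounded_Re BV_imp_bv_bounded Qn gBV)
    have Qi: "integrable leb01 ((Q ^^ n) gc)" using Qn(1)[OF gBV] by (simp add: BV_def)
    have "(\<integral>x. \<bar>Re ((Q ^^ n) gc x) - h x\<bar> \<partial>leb01) \<le> I ((Q ^^ n) gc)"
      unfolding I_def
    proof (rule integral_mono)
      show "\<bar>Re ((Q ^^ n) gc x) - h x\<bar> \<le> cmod ((Q ^^ n) gc x - ?h x)" for x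
        using abs_Re_le_cmod[of "(Q ^^ n) gc x - ?h x"] by simp
    qed (use Qi hc h(1) in auto)
    also have "\<dots> \<le> 1 / real (Suc k)" using Qn(2)[OF gBV, of n] Ig by simp
    finally show ?thesis using bv by blast
  qed
  then obtain fs where fs: "\<And>k. bv_bounded B (fs k)" "\<And>k. (\<integral>x. \<bar>fs k x - h x\<bar> \<partial>leb01) \<le> 1 / real (Suc k)"
    by metis
  have "(\<lambda>k. \<integral>x. \<bar>fs k x - h x\<bar> \<partial>leb01) \<longlonglongrightarrow> 0"
  proof (rule tendsto_sandwich[OF _ _ tendsto_const])
    show "(\<lambda>k. 1 / real (Suc k)) \<longlonglongrightarrow> 0" using LIMSEQ_inverse_real_of_nat by (simp add: inverse_eq_divide)
    show "\<forall>\<^sub>F k in sequentially. (\<integral>x. \<bar>fs k x - h x\<bar> \<partial>leb01) \<le> 1 / real (Suc k)" using fs(2) by simp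
  qed simp
  from bv_bounded_L1_limit[OF fs(1) h(1) this] show ?thesis by blast
qed

end

section \<open>The chain as a random orbit\<close>

abbreviation path_space :: "(nat \<Rightarrow> real) measure" where
  "path_space \<equiv> Pi\<^sub>M UNIV (\<lambda>_. leb01)"

lemma left_shift_measurable [measurable]: "left_shift \<in> path_space \<rightarrow>\<^sub>M path_space"
  unfolding left_shift_def[abs_def]
  by (rule measurable_PiM_single') (auto simp: space_PiM PiE_UNIV_domain)

context random_system
begin

sublocale noise: sequence_space M
  by unfold_locales

text \<open>The orbit of \<open>x\<close> under independent noise \<open>\<omega>\<close>. It realises the chain on an explicit product space, where
  the Markov property is the splitting of a sequence into its first entry and its tail.\<close>

primrec orbit :: "real \<Rightarrow> (nat \<Rightarrow> 'a) \<Rightarrow> nat \<Rightarrow> real" where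
  "orbit x \<omega> 0 = x"
| "orbit x \<omega> (Suc n) = T (\<omega> n) (orbit x \<omega> n)"

lemma orbit_case_nat: "orbit x (case_nat s \<omega>) (Suc n) = orbit (T s x) \<omega> n"
  by (induction n) auto

lemma left_shift_orbit_case_nat: "left_shift (orbit x (case_nat s \<omega>)) = orbit (T s x) \<omega>"
  unfolding left_shift_def using orbit_case_nat by auto

lemma orbit_cong: "(\<And>i. i < n \<Longrightarrow> \<omega> i = \<omega>' i) \<Longrightarrow> orbit x \<omega> n = orbit x \<omega>' n"
  by (induction n) auto

lemma measurable_orbit_component [measurable (raw)]:
  assumes [measurable]: "f \<in> N \<rightarrow>\<^sub>M leb01" "g \<in> N \<rightarrow>\<^sub>M noise.S"
  shows "(\<lambda>z. orbit (f z) (g z) n) \<in> N \<rightarrow>\<^sub>M leb01"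
proof (induction n)
  case (Suc n)
  note [measurable] = Suc
  have "(\<lambda>z. g z n) \<in> N \<rightarrow>\<^sub>M M" by measurable
  then show ?case by (simp add: measurable_T_comp Suc)
qed simp

lemma measurable_orbit [measurable (raw)]:
  assumes [measurable]: "f \<in> N \<rightarrow>\<^sub>M leb01" "g \<in> N \<rightarrow>\<^sub>M noise.S"
  shows "(\<lambda>z. orbit (f z) (g z)) \<in> N \<rightarrow>\<^sub>M path_space"
proof (rule measurable_PiM_single')
  show m: "(\<lambda>z. orbit (f z) (g z) i) \<in> N \<rightarrow>\<^sub>M leb01" for i by measurable
  show "(\<lambda>z. orbit (f z) (g z)) \<in> space N \<rightarrow> (\<Pi>\<^sub>E i\<in>UNIV. space leb01)"
    unfolding PiE_UNIV_domain by (intro funcsetI PiE_I Pi_I measurable_space[OF m])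
qed

lemma orbit_in_path_space: "x \<in> {0..1} \<Longrightarrow> \<omega> \<in> space noise.S \<Longrightarrow> orbit x \<omega> \<in> space path_space"
  using measurable_space[OF measurable_orbit[OF measurable_const[of x leb01] measurable_ident[of noise.S]]]
  by (simp add: id_def)

text \<open>The expectation of a functional of the chain started at \<open>x\<close>.\<close>

definition path_expectation :: "((nat \<Rightarrow> real) \<Rightarrow> real) \<Rightarrow> real \<Rightarrow> real" where
  "path_expectation \<Phi> x = (\<integral>\<omega>. \<Phi> (orbit x \<omega>) \<partial>noise.S)"

lemma path_expectation_measurable [measurable (raw)]:
  assumes [measurable]: "\<Phi> \<in> borel_measurable path_space"
  shows "path_expectation \<Phi> \<in> borel_measurable leb01"
  unfolding path_expectation_def[abs_def] by measurable

lemma integrable_orbit: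
  assumes [measurable]: "\<Phi> \<in> borel_measurable path_space"
    and B: "\<And>p. p \<in> space path_space \<Longrightarrow> \<bar>\<Phi> p\<bar> \<le> B" and x: "x \<in> {0..1}"
  shows "integrable noise.S (\<lambda>\<omega>. \<Phi> (orbit x \<omega>) :: real)"
proof (rule noise.P.integrable_const_bound[of _ B])
  have "(\<lambda>\<omega>. x) \<in> noise.S \<rightarrow>\<^sub>M leb01" using x by (intro measurable_const) simp
  then show "(\<lambda>\<omega>. \<Phi> (orbit x \<omega>)) \<in> borel_measurable noise.S" by measurable
  show "AE \<omega> in noise.S. norm (\<Phi> (orbit x \<omega>)) \<le> B"
    using B orbit_in_path_space[OF x] by (intro AE_I2) simp
qed

lemma path_expectation_bounds:
  assumes "\<Phi> \<in> borel_measurable path_space"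
    and B: "\<And>p. p \<in> space path_space \<Longrightarrow> a \<le> \<Phi> p \<and> \<Phi> p \<le> b" and x: "x \<in> {0..1}"
  shows "a \<le> path_expectation \<Phi> x" "path_expectation \<Phi> x \<le> b"
proof -
  have B': "\<bar>\<Phi> p\<bar> \<le> max \<bar>a\<bar> \<bar>b\<bar>" if "p \<in> space path_space" for p
    using B[OF that] by linarith
  have int: "integrable noise.S (\<lambda>\<omega>. \<Phi> (orbit x \<omega>))" by (rule integrable_orbit[OF assms(1) B' x])
  have "(\<integral>\<omega>. a \<partial>noise.S) \<le> path_expectation \<Phi> x"
    unfolding path_expectation_def
    by (rule integral_mono[OF _ int]) (use B orbit_in_path_space[OF x] in auto)
  then show "a \<le> path_expectation \<Phi> x" by (simp add: noise.P.prob_space)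
  have "path_expectation \<Phi> x \<le> (\<integral>\<omega>. b \<partial>noise.S)"
    unfolding path_expectation_def
    by (rule integral_mono[OF int]) (use B orbit_in_path_space[OF x] in auto)
  then show "path_expectation \<Phi> x \<le> b" by (simp add: noise.P.prob_space)
qed

text \<open>The Markov property at time \<open>1\<close>: the tail of an orbit is the orbit, under the shifted noise, of its
  second point.\<close>

lemma path_expectation_step:
  assumes \<Phi>[measurable]: "\<Phi> \<in> borel_measurable path_space"
    and B: "\<And>p. p \<in> space path_space \<Longrightarrow> \<bar>\<Phi> p\<bar> \<le> B" and x: "x \<in> {0..1}"
  shows "path_expectation (\<lambda>p. c (p 0) * \<Phi> (left_shift p)) x = c x * annealed_koopman M T (path_expectation \<Phi>) x"
proof -
  interpret P: pair_prob_space M noise.S by unfold_locales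
  have xS: "(\<lambda>\<omega>. x) \<in> noise.S \<rightarrow>\<^sub>M leb01" using x by (intro measurable_const) simp
  have xP: "(\<lambda>\<omega>. x) \<in> M \<Otimes>\<^sub>M noise.S \<rightarrow>\<^sub>M leb01" using x by (intro measurable_const) simp
  have case_meas: "(\<lambda>(s, \<omega>). case_nat s \<omega>) \<in> M \<Otimes>\<^sub>M noise.S \<rightarrow>\<^sub>M noise.S" by measurable
  have m1: "(\<lambda>\<omega>. \<Phi> (left_shift (orbit x \<omega>))) \<in> borel_measurable noise.S"
    using xS by measurable
  have int: "integrable (M \<Otimes>\<^sub>M noise.S) (\<lambda>(s, \<omega>). \<Phi> (orbit (T s x) \<omega>))"
  proof (rule P.integrable_const_bound[of _ B])
    show "(\<lambda>(s, \<omega>). \<Phi> (orbit (T s x) \<omega>)) \<in> borel_measurable (M \<Otimes>\<^sub>M noise.S)"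
      using xP by measurable
    show "AE z in M \<Otimes>\<^sub>M noise.S. norm (case z of (s, \<omega>) \<Rightarrow> \<Phi> (orbit (T s x) \<omega>)) \<le> B"
      by (rule AE_I2) (auto simp: space_pair_measure intro!: B orbit_in_path_space T_in_unit_interval[OF _ x, simplified])
  qed
  have "path_expectation (\<lambda>p. c (p 0) * \<Phi> (left_shift p)) x = c x * (\<integral>\<omega>. \<Phi> (left_shift (orbit x \<omega>)) \<partial>noise.S)"
    by (simp add: path_expectation_def)
  also have "(\<integral>\<omega>. \<Phi> (left_shift (orbit x \<omega>)) \<partial>noise.S)
      = (\<integral>\<omega>. \<Phi> (left_shift (orbit x \<omega>)) \<partial>distr (M \<Otimes>\<^sub>M noise.S) noise.S (\<lambda>(s, \<omega>). case_nat s \<omega>))"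
    by (simp only: noise.PiM_iter)
  also have "\<dots> = (\<integral>z. \<Phi> (left_shift (orbit x (case z of (s, \<omega>) \<Rightarrow> case_nat s \<omega>))) \<partial>(M \<Otimes>\<^sub>M noise.S))"
    by (rule integral_distr[OF case_meas m1])
  also have "\<dots> = (\<integral>z. (case z of (s, \<omega>) \<Rightarrow> \<Phi> (orbit (T s x) \<omega>)) \<partial>(M \<Otimes>\<^sub>M noise.S))"
    by (intro Bochner_Integration.integral_cong refl) (auto simp: left_shift_orbit_case_nat split: prod.splits)
  also have "\<dots> = (\<integral>s. (\<integral>\<omega>. \<Phi> (orbit (T s x) \<omega>) \<partial>noise.S) \<partial>M)"
    using P.integral_fst'[OF int] by simp
  also have "\<dots> = annealed_koopman M T (path_expectation \<Phi>) x"
    by (simp add: annealed_koopman_def path_expectation_def)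
  finally show ?thesis .
qed

text \<open>The noise at time \<open>n\<close> is independent of the orbit up to time \<open>n\<close>, so integrating it out replaces a
  function of the last point by its average over one step. Iterating this removes the coordinates
  from the end, the order in which the Ionescu-Tulcea kernels are composed.\<close>

lemma orbit_law_step:
  fixes G :: "(nat \<Rightarrow> real) \<Rightarrow> ennreal" and g :: "real \<Rightarrow> ennreal"
  assumes f[measurable]: "\<And>i. f i \<in> borel_measurable leb01" and g[measurable]: "g \<in> borel_measurable leb01"
    and x: "x \<in> {0..1}"
  shows "(\<integral>\<^sup>+\<omega>. (\<Prod>i<Suc n. f i (orbit x \<omega> i)) * g (orbit x \<omega> (Suc n)) \<partial>noise.S)
    = (\<integral>\<^sup>+\<omega>. (\<Prod>i<n. f i (orbit x \<omega> i)) * (f n (orbit x \<omega> n) * (\<integral>\<^sup>+s. g (T s (orbit x \<omega> n)) \<partial>M)) \<partial>noise.S)"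
proof -
  have xS[measurable]: "(\<lambda>\<omega>. x) \<in> noise.S \<rightarrow>\<^sub>M leb01" using x by (intro measurable_const) simp
  have xP[measurable]: "(\<lambda>\<omega>. x) \<in> noise.S \<Otimes>\<^sub>M noise.S \<rightarrow>\<^sub>M leb01" using x by (intro measurable_const) simp
  let ?F = "\<lambda>\<omega>. (\<Prod>i<Suc n. f i (orbit x \<omega> i)) * g (orbit x \<omega> (Suc n))"
  have Fm: "?F \<in> borel_measurable noise.S"
    by (intro borel_measurable_times_ennreal borel_measurable_prod_ennreal measurable_compose[OF _ f]
        measurable_compose[OF _ g] measurable_orbit_component[OF xS measurable_ident_sets[OF refl]])
  have cm: "(\<lambda>(\<omega>, \<omega>'). comb_seq n \<omega> \<omega>') \<in> noise.S \<Otimes>\<^sub>M noise.S \<rightarrow>\<^sub>M noise.S"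
    by (rule measurable_comb_seq)
  have orb: "orbit x (comb_seq n \<omega> \<omega>') i = orbit x \<omega> i" if "i \<le> n" for \<omega> \<omega>' i
    using that by (intro orbit_cong) (simp add: comb_seq_def)
  have comb: "?F (comb_seq n \<omega> \<omega>') = (\<Prod>i<Suc n. f i (orbit x \<omega> i)) * g (T (\<omega>' 0) (orbit x \<omega> n))" for \<omega> \<omega>'
    by (simp add: orb comb_seq_def)
  have "(\<integral>\<^sup>+\<omega>. ?F \<omega> \<partial>noise.S) = (\<integral>\<^sup>+\<omega>. ?F \<omega> \<partial>distr (noise.S \<Otimes>\<^sub>M noise.S) noise.S (\<lambda>(\<omega>, \<omega>'). comb_seq n \<omega> \<omega>'))"
    by (simp only: noise.PiM_comb_seq)
  also have "\<dots> = (\<integral>\<^sup>+z. ?F (case z of (\<omega>, \<omega>') \<Rightarrow> comb_seq n \<omega> \<omega>') \<partial>(noise.S \<Otimes>\<^sub>M noise.S))"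
    by (rule nn_integral_distr[OF cm]) (simp only: measurable_distr_eq1 Fm)
  also have "\<dots> = (\<integral>\<^sup>+z. (\<Prod>i<Suc n. f i (orbit x (fst z) i)) * g (T (snd z 0) (orbit x (fst z) n)) \<partial>(noise.S \<Otimes>\<^sub>M noise.S))"
    by (intro nn_integral_cong) (simp only: case_prod_beta' comb)
  also have "\<dots> = (\<integral>\<^sup>+\<omega>. (\<integral>\<^sup>+\<omega>'. (\<Prod>i<Suc n. f i (orbit x \<omega> i)) * g (T (\<omega>' 0) (orbit x \<omega> n)) \<partial>noise.S) \<partial>noise.S)"
  proof -
    have sm: "(\<lambda>z. snd z 0) \<in> noise.S \<Otimes>\<^sub>M noise.S \<rightarrow>\<^sub>M M"
      by (rule measurable_compose[OF measurable_snd measurable_component_singleton]) simp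
    have om: "(\<lambda>z. orbit x (fst z) i) \<in> noise.S \<Otimes>\<^sub>M noise.S \<rightarrow>\<^sub>M leb01" for i
      by (rule measurable_orbit_component[OF xP measurable_fst])
    have "(\<lambda>z. (\<Prod>i<Suc n. f i (orbit x (fst z) i)) * g (T (snd z 0) (orbit x (fst z) n))) \<in> borel_measurable (noise.S \<Otimes>\<^sub>M noise.S)"
      by (intro borel_measurable_times_ennreal borel_measurable_prod_ennreal
          measurable_compose[OF om f] measurable_compose[OF measurable_T_comp[OF sm om] g])
    from noise.P.nn_integral_fst[OF this] show ?thesis by (simp only: fst_conv snd_conv)
  qed
  also have "\<dots> = (\<integral>\<^sup>+\<omega>. (\<Prod>i<Suc n. f i (orbit x \<omega> i)) * (\<integral>\<^sup>+s. g (T s (orbit x \<omega> n)) \<partial>M) \<partial>noise.S)"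
  proof (intro nn_integral_cong)
    fix \<omega> assume \<omega>: "\<omega> \<in> space noise.S"
    have y: "orbit x \<omega> n \<in> {0..1}"
      using orbit_in_path_space[OF x \<omega>] by (auto simp: space_PiM)
    then have gm: "(\<lambda>s. g (T s (orbit x \<omega> n))) \<in> borel_measurable M"
      by (intro measurable_compose[OF _ g] measurable_T_comp measurable_ident_sets measurable_const) auto
    have m0: "(\<lambda>\<omega>'. \<omega>' 0) \<in> noise.S \<rightarrow>\<^sub>M M" by (rule measurable_component_singleton) simp
    have "(\<integral>\<^sup>+\<omega>'. (\<Prod>i<Suc n. f i (orbit x \<omega> i)) * g (T (\<omega>' 0) (orbit x \<omega> n)) \<partial>noise.S)
      = (\<Prod>i<Suc n. f i (orbit x \<omega> i)) * (\<integral>\<^sup>+\<omega>'. g (T (\<omega>' 0) (orbit x \<omega> n)) \<partial>noise.S)"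
      by (rule nn_integral_cmult[OF measurable_compose[OF m0 gm]])
    also have "(\<integral>\<^sup>+\<omega>'. g (T (\<omega>' 0) (orbit x \<omega> n)) \<partial>noise.S) = (\<integral>\<^sup>+s. g (T s (orbit x \<omega> n)) \<partial>distr noise.S M (\<lambda>\<omega>'. \<omega>' 0))"
      by (rule nn_integral_distr[OF m0, symmetric]) (simp only: measurable_distr_eq1 gm)
    also have "distr noise.S M (\<lambda>\<omega>'. \<omega>' 0) = M" using noise.PiM_component[of 0] by simp
    finally show "(\<integral>\<^sup>+\<omega>'. (\<Prod>i<Suc n. f i (orbit x \<omega> i)) * g (T (\<omega>' 0) (orbit x \<omega> n)) \<partial>noise.S)
      = (\<Prod>i<Suc n. f i (orbit x \<omega> i)) * (\<integral>\<^sup>+s. g (T s (orbit x \<omega> n)) \<partial>M)" .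
  qed
  finally show ?thesis by (simp add: mult.assoc)
qed

text \<open>On both sides, integrating out the last coordinate replaces \<open>f n\<close> by \<open>f n\<close> times the one-step
  average of \<open>g\<close>; the induction therefore runs over all \<open>g\<close> simultaneously.\<close>

lemma finite_dim_laws_agree:
  assumes st: "ac_stationary M T \<mu>"
    and f[measurable]: "\<And>i. f i \<in> borel_measurable leb01" and g: "g \<in> borel_measurable leb01"
  shows "(\<integral>\<^sup>+p. (\<Prod>i<n. f i (p i)) * g (p n) \<partial>Ionescu_Tulcea.C (chain_kernel M T \<mu>) (\<lambda>_. leb01) 0 (Suc n) (\<lambda>_. undefined))
    = (\<integral>\<^sup>+x. (\<integral>\<^sup>+\<omega>. (\<Prod>i<n. f i (orbit x \<omega> i)) * g (orbit x \<omega> n) \<partial>noise.S) \<partial>\<mu>)"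
proof -
  interpret IT: Ionescu_Tulcea "chain_kernel M T \<mu>" "\<lambda>_. leb01"
    by (rule Ionescu_Tulcea_chain_kernel[OF st])
  have sets\<mu>: "sets \<mu> = sets leb01" using st by (simp add: ac_stationary_def)
  have space\<mu>: "space \<mu> = {0..1}" using sets_eq_imp_space_eq[OF sets\<mu>] by simp
  let ?u = "\<lambda>_::nat. undefined :: real"
  have u: "?u \<in> space (PiM {0..<0} (\<lambda>_. leb01))" by (simp add: space_PiM)
  have cmeas: "(\<lambda>p. p i) \<in> PiM {0..<Suc n} (\<lambda>_. leb01) \<rightarrow>\<^sub>M leb01" if "i \<le> n" for i n
    using that by (intro measurable_component_singleton) auto
  show ?thesis using g
  proof (induction n arbitrary: g)
    case 0
    note [measurable] = 0
    have gm: "(\<lambda>p. g (p 0)) \<in> borel_measurable (PiM {0..<Suc 0} (\<lambda>_. leb01))"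
      by (rule measurable_compose[OF cmeas]) (use 0 in auto)
    have "(\<integral>\<^sup>+p. g (p 0) \<partial>IT.C 0 (Suc 0) ?u) = (\<integral>\<^sup>+p. (\<integral>\<^sup>+q. g (q 0) \<partial>IT.eP 0 p) \<partial>return (PiM {0..<0} (\<lambda>_. leb01)) ?u)"
      unfolding IT.C.simps add_0
      by (rule nn_integral_bind[OF gm]) (simp only: measurable_return1, rule IT.measurable_eP)
    also have "\<dots> = (\<integral>\<^sup>+q. g (q 0) \<partial>IT.eP 0 ?u)"
      using measurable_compose[OF IT.measurable_eP nn_integral_measurable_subprob_algebra[OF gm]]
      by (subst nn_integral_return[OF u]) auto
    also have "\<dots> = (\<integral>\<^sup>+y. g y \<partial>\<mu>)"
      by (subst IT.nn_integral_eP[OF u gm]) (simp add: chain_kernel_def)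
    finally show ?case by (simp add: noise.P.emeasure_space_1)
  next
    case (Suc n)
    note [measurable] = Suc.prems
    define k where "k y = f n y * (\<integral>\<^sup>+s. g (T s y) \<partial>M)" for y
    have k[measurable]: "k \<in> borel_measurable leb01"
      unfolding k_def[abs_def] by measurable
    let ?F = "\<lambda>p. (\<Prod>i<Suc n. f i (p i)) * g (p (Suc n))"
    have Fm: "?F \<in> borel_measurable (PiM {0..<Suc (Suc n)} (\<lambda>_. leb01))"
    proof (intro borel_measurable_times_ennreal borel_measurable_prod_ennreal)
      show "(\<lambda>p. f i (p i)) \<in> borel_measurable (PiM {0..<Suc (Suc n)} (\<lambda>_. leb01))" if "i \<in> {..<Suc n}" for i
        by (rule measurable_compose[OF cmeas f]) (use that in auto)
      show "(\<lambda>p. g (p (Suc n))) \<in> borel_measurable (PiM {0..<Suc (Suc n)} (\<lambda>_. leb01))"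
        by (rule measurable_compose[OF cmeas Suc.prems]) auto
    qed
    have sC: "sets (IT.C 0 (Suc n) ?u) = sets (PiM {0..<Suc n} (\<lambda>_. leb01))"
      using IT.sets_C[OF u, of "Suc n"] by simp
    have "(\<integral>\<^sup>+p. ?F p \<partial>IT.C 0 (Suc (Suc n)) ?u) = (\<integral>\<^sup>+p. (\<integral>\<^sup>+q. ?F q \<partial>IT.eP (Suc n) p) \<partial>IT.C 0 (Suc n) ?u)"
      unfolding IT.C.simps(2)[of 0 "Suc n"] add_0
      by (rule nn_integral_bind[OF Fm]) (simp only: measurable_cong_sets[OF sC refl], rule IT.measurable_eP)
    also have "\<dots> = (\<integral>\<^sup>+p. (\<Prod>i<n. f i (p i)) * k (p n) \<partial>IT.C 0 (Suc n) ?u)"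
    proof (intro nn_integral_cong)
      fix p assume "p \<in> space (IT.C 0 (Suc n) ?u)"
      then have p: "p \<in> space (PiM {0..<Suc n} (\<lambda>_. leb01))" using sets_eq_imp_space_eq[OF sC] by simp
      then have pn: "p n \<in> {0..1}" by (auto simp: space_PiM)
      have Tm: "(\<lambda>s. T s (p n)) \<in> M \<rightarrow>\<^sub>M leb01"
        by (intro measurable_T_comp measurable_ident measurable_const) (use pn in auto)
      have kern: "chain_kernel M T \<mu> (Suc n) p = distr M leb01 (\<lambda>s. T s (p n))"
        by (simp add: chain_kernel_def transition_def)
      have "(\<integral>\<^sup>+q. ?F q \<partial>IT.eP (Suc n) p) = (\<integral>\<^sup>+y. ?F (p(Suc n := y)) \<partial>chain_kernel M T \<mu> (Suc n) p)"
        by (rule IT.nn_integral_eP[OF p Fm])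
      also have "\<dots> = (\<integral>\<^sup>+y. (\<Prod>i<Suc n. f i (p i)) * g y \<partial>distr M leb01 (\<lambda>s. T s (p n)))"
        unfolding kern
        by (intro nn_integral_cong arg_cong2[where f=times] prod.cong) auto
      also have "\<dots> = (\<integral>\<^sup>+s. (\<Prod>i<Suc n. f i (p i)) * g (T s (p n)) \<partial>M)"
        by (rule nn_integral_distr[OF Tm]) simp
      also have "\<dots> = (\<Prod>i<Suc n. f i (p i)) * (\<integral>\<^sup>+s. g (T s (p n)) \<partial>M)"
        by (rule nn_integral_cmult) (rule measurable_compose[OF Tm Suc.prems])
      finally show "(\<integral>\<^sup>+q. ?F q \<partial>IT.eP (Suc n) p) = (\<Prod>i<n. f i (p i)) * k (p n)"
        by (simp add: k_def mult.assoc)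
    qed
    also have "\<dots> = (\<integral>\<^sup>+x. (\<integral>\<^sup>+\<omega>. (\<Prod>i<n. f i (orbit x \<omega> i)) * k (orbit x \<omega> n) \<partial>noise.S) \<partial>\<mu>)"
      by (rule Suc.IH[OF k])
    also have "\<dots> = (\<integral>\<^sup>+x. (\<integral>\<^sup>+\<omega>. ?F (orbit x \<omega>) \<partial>noise.S) \<partial>\<mu>)"
      unfolding k_def by (intro nn_integral_cong orbit_law_step[symmetric] f Suc.prems) (simp add: space\<mu>)
    finally show ?case .
  qed
qed

text \<open>Cylinder sets determine a probability measure on the path space, and an indicator of a cylinder is a
  product of functions of the single coordinates.\<close>

lemma chain_law_eq_distr_orbit:
  assumes st: "ac_stationary M T \<mu>"
  shows "chain_law M T \<mu> = distr (\<mu> \<Otimes>\<^sub>M noise.S) path_space (\<lambda>z. orbit (fst z) (snd z))"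
proof -
  interpret IT: Ionescu_Tulcea "chain_kernel M T \<mu>" "\<lambda>_. leb01"
    by (rule Ionescu_Tulcea_chain_kernel[OF st])
  have sets\<mu>: "sets \<mu> = sets leb01" using st by (simp add: ac_stationary_def)
  have law: "chain_law M T \<mu> = IT.PF.lim" by (simp add: chain_law_def)
  let ?D = "distr (\<mu> \<Otimes>\<^sub>M noise.S) path_space (\<lambda>z. orbit (fst z) (snd z))"
  interpret \<mu>: prob_space \<mu> using st by (simp add: ac_stationary_def)
  interpret Q: pair_prob_space \<mu> noise.S by unfold_locales
  have om: "(\<lambda>z. orbit (fst z) (snd z)) \<in> \<mu> \<Otimes>\<^sub>M noise.S \<rightarrow>\<^sub>M path_space"
  proof (rule measurable_orbit)
    show "fst \<in> \<mu> \<Otimes>\<^sub>M noise.S \<rightarrow>\<^sub>M leb01"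
      using measurable_fst[of \<mu> noise.S] by (simp cong: measurable_cong_sets add: sets\<mu>)
  qed simp
  have "?D = IT.PF.lim"
  proof (rule measure_eqI_PiM_infinite)
    show "finite_measure ?D"
      using Q.P.prob_space_distr[OF om] by (rule prob_space.finite_measure)
  next
    fix A and J :: "nat set" assume J: "finite J" "J \<subseteq> UNIV" and A: "\<And>i. i \<in> J \<Longrightarrow> A i \<in> sets leb01"
    define n where "n = Max (insert 0 J)"
    have Jn: "J \<subseteq> {0..<Suc n}" using J by (auto simp: n_def less_Suc_eq_le)
    define f :: "nat \<Rightarrow> real \<Rightarrow> ennreal" where "f i = (if i \<in> J then indicator (A i) else (\<lambda>_. 1))" for i
    have f: "f i \<in> borel_measurable leb01" for i using A by (auto simp: f_def)
    have prod: "(\<Prod>i<n. f i (p i)) * f n (p n) = indicator {p. \<forall>i\<in>J. p i \<in> A i} p" for p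
    proof -
      have "(\<Prod>i<n. f i (p i)) * f n (p n) = (\<Prod>i<Suc n. f i (p i))" by simp
      also have "\<dots> = (\<Prod>i\<in>J. f i (p i))"
        using Jn by (intro prod.mono_neutral_right) (auto simp: f_def lessThan_atLeast0)
      also have "\<dots> = (\<Prod>i\<in>J. indicator (A i) (p i))" by (intro prod.cong) (auto simp: f_def)
      also have "\<dots> = indicator {p. \<forall>i\<in>J. p i \<in> A i} p"
        using J(1) by (induction J rule: finite_induct) (auto simp: indicator_def)
      finally show ?thesis .
    qed
    have PJ: "Pi\<^sub>E J A \<in> sets (PiM J (\<lambda>_. leb01))" using J A by (intro sets_PiM_I_finite) auto
    let ?E = "prod_emb UNIV (\<lambda>_. leb01) J (Pi\<^sub>E J A)"
    have E: "?E \<in> sets path_space" using J A by (intro sets_PiM_I) auto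
    let ?C = "IT.C 0 (Suc n) (\<lambda>_. undefined)"
    have u: "(\<lambda>_. undefined) \<in> space (PiM {0..<0::nat} (\<lambda>_. leb01))" by (simp add: space_PiM)
    have sC: "sets ?C = sets (PiM {0..<Suc n} (\<lambda>_. leb01))" using IT.sets_C[OF u, of "Suc n"] by simp
    have EC: "prod_emb {0..<Suc n} (\<lambda>_. leb01) J (Pi\<^sub>E J A) \<in> sets ?C"
      unfolding sC by (rule measurable_prod_emb[OF Jn PJ])
    have "emeasure IT.PF.lim ?E = emeasure ?C (prod_emb {0..<Suc n} (\<lambda>_. leb01) J (Pi\<^sub>E J A))"
      using IT.lim[OF J(1) PJ] IT.emeasure_CI[OF Jn PJ] by simp
    also have "\<dots> = (\<integral>\<^sup>+p. indicator {p. \<forall>i\<in>J. p i \<in> A i} p \<partial>?C)"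
      using sets_eq_imp_space_eq[OF sC]
      by (subst nn_integral_indicator[OF EC, symmetric], intro nn_integral_cong)
         (auto simp: prod_emb_def space_PiM indicator_def PiE_iff split: if_splits)
    also have "\<dots> = (\<integral>\<^sup>+x. (\<integral>\<^sup>+\<omega>. indicator {p. \<forall>i\<in>J. p i \<in> A i} (orbit x \<omega>) \<partial>noise.S) \<partial>\<mu>)"
      using finite_dim_laws_agree[where f=f and g="f n" and n=n, OF st f f] by (simp only: prod)
    also have "\<dots> = (\<integral>\<^sup>+x. (\<integral>\<^sup>+\<omega>. indicator ?E (orbit x \<omega>) \<partial>noise.S) \<partial>\<mu>)"
    proof (intro nn_integral_cong)
      fix x \<omega> assume "x \<in> space \<mu>" "\<omega> \<in> space noise.S"
      then have "orbit x \<omega> \<in> space path_space"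
        using sets_eq_imp_space_eq[OF sets\<mu>] by (intro orbit_in_path_space) auto
      then show "indicator {p. \<forall>i\<in>J. p i \<in> A i} (orbit x \<omega>) = (indicator ?E (orbit x \<omega>) :: ennreal)"
        by (auto simp: prod_emb_def space_PiM indicator_def)
    qed
    also have "\<dots> = (\<integral>\<^sup>+z. indicator ?E (orbit (fst z) (snd z)) \<partial>(\<mu> \<Otimes>\<^sub>M noise.S))"
      using om E by (subst noise.P.nn_integral_fst[symmetric]) (simp_all add: measurable_compose[OF om])
    also have "\<dots> = emeasure ?D ?E"
      using E by (subst nn_integral_distr[OF om, symmetric]) auto
    finally show "emeasure ?D ?E = emeasure IT.PF.lim ?E" by simp
  qed simp_all
  then show ?thesis by (simp add: law)
qed

end

section \<open>Expectations under the chain law\<close>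

lemma left_shift_funpow: "(left_shift ^^ j) p k = p (j + k)"
  by (induction j arbitrary: k) (auto simp: left_shift_def)

lemma birkhoff_sum_eq: "birkhoff_sum \<phi> n p = (\<Sum>j<n. \<phi> (p j))"
  by (simp add: birkhoff_sum_def coord0_def left_shift_funpow)

lemma birkhoff_sum_Suc: "birkhoff_sum \<phi> (Suc n) p = \<phi> (p 0) + birkhoff_sum \<phi> n (left_shift p)"
  unfolding birkhoff_sum_eq by (subst sum.lessThan_Suc_shift) (simp add: left_shift_def)

lemma measurable_left_shift_funpow [measurable]: "left_shift ^^ n \<in> path_space \<rightarrow>\<^sub>M path_space"
  by (induction n) (auto intro!: measurable_comp left_shift_measurable simp: id_def)

context random_system
begin

lemma measurable_coordinate: "f \<in> borel_measurable leb01 \<Longrightarrow> (\<lambda>p. f (p k)) \<in> borel_measurable path_space"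
  by (rule measurable_compose[OF measurable_component_singleton]) auto

lemma birkhoff_sum_measurable:
  "\<phi> \<in> borel_measurable leb01 \<Longrightarrow> birkhoff_sum \<phi> l \<in> borel_measurable path_space"
  unfolding birkhoff_sum_eq[abs_def] by (intro borel_measurable_sum measurable_coordinate)

lemma path_expectation_coord0: "path_expectation (\<lambda>p. f (p 0)) x = f x"
  by (simp add: path_expectation_def noise.P.prob_space)

lemma path_expectation_funpow:
  assumes \<Phi>: "\<Phi> \<in> borel_measurable path_space"
    and B: "\<And>p. p \<in> space path_space \<Longrightarrow> \<bar>\<Phi> p\<bar> \<le> B" and x: "x \<in> {0..1}"
  shows "path_expectation (\<lambda>p. \<Phi> ((left_shift ^^ n) p)) x = (annealed_koopman M T ^^ n) (path_expectation \<Phi>) x"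
  using x
proof (induction n arbitrary: x)
  case (Suc n)
  have m: "(\<lambda>p. \<Phi> ((left_shift ^^ n) p)) \<in> borel_measurable path_space"
    by (rule measurable_compose[OF measurable_left_shift_funpow \<Phi>])
  have b: "\<bar>\<Phi> ((left_shift ^^ n) p)\<bar> \<le> B" if "p \<in> space path_space" for p
    by (rule B[OF measurable_space[OF measurable_left_shift_funpow that]])
  have "path_expectation (\<lambda>p. \<Phi> ((left_shift ^^ Suc n) p)) x
      = path_expectation (\<lambda>p. 1 * \<Phi> ((left_shift ^^ n) (left_shift p))) x"
    by (simp only: funpow_Suc_right o_apply mult_1)
  also have "\<dots> = 1 * annealed_koopman M T (path_expectation (\<lambda>p. \<Phi> ((left_shift ^^ n) p))) x"
    by (rule path_expectation_step[OF m b Suc.prems, where c="\<lambda>_. 1"])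
  also have "\<dots> = annealed_koopman M T ((annealed_koopman M T ^^ n) (path_expectation \<Phi>)) x"
    unfolding annealed_koopman_def[of M T "path_expectation _"] annealed_koopman_def[of M T "(annealed_koopman M T ^^ n) _"]
    by (simp, intro Bochner_Integration.integral_cong refl Suc.IH T_in_unit_interval Suc.prems)
  finally show ?case by simp
qed simp

lemma koopman_funpow_of_real:
  "(annealed_koopman M T ^^ n) (\<lambda>x. complex_of_real (g x)) = (\<lambda>x. complex_of_real ((annealed_koopman M T ^^ n) g x))"
  by (induction n) (auto simp: annealed_koopman_def)

end

locale stationary_chain = random_system +
  fixes \<mu> :: "real measure"
  assumes stationary: "ac_stationary M T \<mu>"
begin

abbreviation chain :: "(nat \<Rightarrow> real) measure" where
  "chain \<equiv> chain_law M T \<mu>"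

lemma sets_\<mu>: "sets \<mu> = sets leb01"
  using stationary by (simp add: ac_stationary_def)

lemma space_\<mu>: "space \<mu> = {0..1}"
  using sets_eq_imp_space_eq[OF sets_\<mu>] by simp

sublocale \<mu>: prob_space \<mu>
  using stationary by (simp add: ac_stationary_def)

lemma orbit_measurable_\<mu>: "(\<lambda>z. orbit (fst z) (snd z)) \<in> \<mu> \<Otimes>\<^sub>M noise.S \<rightarrow>\<^sub>M path_space"
proof (rule measurable_orbit)
  show "fst \<in> \<mu> \<Otimes>\<^sub>M noise.S \<rightarrow>\<^sub>M leb01"
    using measurable_fst[of \<mu> noise.S] by (simp cong: measurable_cong_sets add: sets_\<mu>)
qed simp

lemma sets_chain [measurable_cong, simp]: "sets chain = sets path_space"
  by (simp add: chain_law_eq_distr_orbit[OF stationary])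

lemma space_chain [simp]: "space chain = space path_space"
  by (simp add: chain_law_eq_distr_orbit[OF stationary])

sublocale chain: prob_space chain
proof -
  interpret Q: pair_prob_space \<mu> noise.S by unfold_locales
  show "prob_space chain"
    unfolding chain_law_eq_distr_orbit[OF stationary] by (rule Q.P.prob_space_distr[OF orbit_measurable_\<mu>])
qed

lemma chain_integral:
  fixes \<Phi> :: "(nat \<Rightarrow> real) \<Rightarrow> real"
  assumes \<Phi>: "\<Phi> \<in> borel_measurable path_space"
    and B: "\<And>p. p \<in> space path_space \<Longrightarrow> \<bar>\<Phi> p\<bar> \<le> B"
  shows "(\<integral>p. \<Phi> p \<partial>chain) = (\<integral>x. path_expectation \<Phi> x \<partial>\<mu>)"
proof -
  interpret Q: pair_prob_space \<mu> noise.S by unfold_locales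
  have int: "integrable (\<mu> \<Otimes>\<^sub>M noise.S) (\<lambda>z. \<Phi> (orbit (fst z) (snd z)))"
    by (rule Q.P.integrable_const_bound[of _ B])
       (use measurable_space[OF orbit_measurable_\<mu>] B measurable_compose[OF orbit_measurable_\<mu> \<Phi>] in auto)
  have "(\<integral>p. \<Phi> p \<partial>chain) = (\<integral>z. \<Phi> (orbit (fst z) (snd z)) \<partial>(\<mu> \<Otimes>\<^sub>M noise.S))"
    unfolding chain_law_eq_distr_orbit[OF stationary] by (rule integral_distr[OF orbit_measurable_\<mu> \<Phi>])
  also have "\<dots> = (\<integral>x. path_expectation \<Phi> x \<partial>\<mu>)"
    using Q.integral_fst'[OF int] by (simp add: path_expectation_def)
  finally show ?thesis .
qed

text \<open>Invariance under the shift is the Markov property at time \<open>1\<close> followed by stationarity.\<close>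

lemma chain_shift_invariant: "distr chain path_space left_shift = chain"
proof (rule measure_eqI)
  have sm: "left_shift \<in> chain \<rightarrow>\<^sub>M path_space" by measurable
  fix A assume "A \<in> sets (distr chain path_space left_shift)"
  then have A: "A \<in> sets path_space" by simp
  interpret D: prob_space "distr chain path_space left_shift" by (rule chain.prob_space_distr[OF sm])
  let ?I = "\<lambda>p. indicator A p :: real"
  have Im: "?I \<in> borel_measurable path_space" using A by measurable
  have I1: "\<bar>?I p\<bar> \<le> 1" for p by (simp add: indicator_def)
  have pe: "path_expectation ?I \<in> borel_measurable leb01" using Im by measurable
  have peb: "\<bar>path_expectation ?I x\<bar> \<le> 1" if "x \<in> {0..1}" for x
    using path_expectation_bounds[OF Im _ that, of 0 1] by (simp add: indicator_def)
  have "measure (distr chain path_space left_shift) A = (\<integral>p. ?I p \<partial>distr chain path_space left_shift)"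
    using A by simp
  also have "\<dots> = (\<integral>p. ?I (left_shift p) \<partial>chain)" by (rule integral_distr[OF sm Im])
  also have "\<dots> = (\<integral>x. path_expectation (\<lambda>p. ?I (left_shift p)) x \<partial>\<mu>)"
    using measurable_compose[OF left_shift_measurable Im] I1 by (intro chain_integral)
  also have "\<dots> = (\<integral>x. annealed_koopman M T (path_expectation ?I) x \<partial>\<mu>)"
    using path_expectation_step[OF Im I1, where c="\<lambda>_. 1"] space_\<mu>
    by (intro Bochner_Integration.integral_cong refl) simp
  also have "\<dots> = (\<integral>x. path_expectation ?I x \<partial>\<mu>)"
    by (rule stationary_integral[OF stationary pe]) (use peb in simp)
  also have "\<dots> = (\<integral>p. ?I p \<partial>chain)" by (rule chain_integral[symmetric, OF Im I1])
  also have "\<dots> = measure chain A" using A by simp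
  finally show "emeasure (distr chain path_space left_shift) A = emeasure chain A"
    by (simp add: D.emeasure_eq_measure chain.emeasure_eq_measure)
qed simp

lemma chain_shift_funpow_invariant: "distr chain path_space (left_shift ^^ n) = chain"
proof (induction n)
  case 0
  have "distr chain path_space (\<lambda>x. x) = distr chain chain (\<lambda>x. x)" by (intro distr_cong) auto
  then show ?case by (simp add: id_def distr_id)
next
  case (Suc n)
  have "left_shift ^^ n \<in> chain \<rightarrow>\<^sub>M path_space" by measurable
  from distr_distr[OF left_shift_measurable this]
  have "distr chain path_space (left_shift ^^ Suc n) = distr (distr chain path_space (left_shift ^^ n)) path_space left_shift"
    by (simp only: funpow.simps(2))
  then show ?case by (simp only: Suc chain_shift_invariant)
qed

lemma measure_chain_shift:
  assumes "{p \<in> space path_space. Q p} \<in> sets path_space"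
  shows "measure chain {p \<in> space path_space. Q ((left_shift ^^ n) p)} = measure chain {p \<in> space path_space. Q p}"
proof -
  have m: "left_shift ^^ n \<in> chain \<rightarrow>\<^sub>M path_space" by measurable
  have "measure chain {p \<in> space path_space. Q p} = measure (distr chain path_space (left_shift ^^ n)) {p \<in> space path_space. Q p}"
    by (simp only: chain_shift_funpow_invariant)
  also have "\<dots> = measure chain ((left_shift ^^ n) -` {p \<in> space path_space. Q p} \<inter> space chain)"
    by (rule measure_distr[OF m assms])
  also have "(left_shift ^^ n) -` {p \<in> space path_space. Q p} \<inter> space chain = {p \<in> space path_space. Q ((left_shift ^^ n) p)}"
    using measurable_space[OF m] by auto
  finally show ?thesis by simp
qed

text \<open>Every coordinate of the stationary chain has the law \<open>\<mu>\<close>, which is absolutely continuous. Observables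
  that agree Lebesgue almost everywhere therefore have the same Birkhoff sums along almost every path.\<close>

lemma AE_chain_eq:
  fixes f g :: "real \<Rightarrow> real"
  assumes f: "f \<in> borel_measurable leb01" and g: "g \<in> borel_measurable leb01"
    and eq: "AE x in leb01. f x = g x"
  shows "AE p in chain. \<forall>k. f (p k) = g (p k)"
proof -
  define D where "D = {x \<in> space leb01. f x \<noteq> g x}"
  have D: "D \<in> sets leb01" unfolding D_def using f g by measurable
  let ?I = "\<lambda>x. indicator D x :: real"
  have Im: "?I \<in> borel_measurable leb01" using D by (rule borel_measurable_indicator)
  have Pm: "(\<lambda>p. ?I (p 0)) \<in> borel_measurable path_space" by (rule measurable_coordinate[OF Im])
  define A where "A k = {p \<in> space path_space. p k \<in> D}" for k
  have A: "A k \<in> sets path_space" for k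
  proof -
    have eq: "A k = (\<lambda>p. p k) -` D \<inter> space path_space" unfolding A_def by blast
    have m: "(\<lambda>p. p k) \<in> path_space \<rightarrow>\<^sub>M leb01" by (rule measurable_component_singleton) simp
    show ?thesis unfolding eq by (rule measurable_sets[OF m D])
  qed
  have "AE x in leb01. ?I x = 0"
    using eq by eventually_elim (simp add: D_def)
  moreover have "absolutely_continuous leb01 \<mu>" using stationary by (simp add: ac_stationary_def)
  ultimately have "AE x in \<mu>. ?I x = 0"
    using absolutely_continuous_AE[OF sets_\<mu>] by blast
  then have "(\<integral>x. ?I x \<partial>\<mu>) = 0" by (rule integral_eq_zero_AE)
  moreover have "(\<integral>p. ?I (p 0) \<partial>chain) = (\<integral>x. ?I x \<partial>\<mu>)"
  proof -
    have pe: "path_expectation (\<lambda>p. ?I (p 0)) = ?I" by (rule ext) (rule path_expectation_coord0[where f="?I"])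
    have b: "\<bar>?I (p 0)\<bar> \<le> 1" for p by (simp add: indicator_def)
    have "(\<integral>p. ?I (p 0) \<partial>chain) = (\<integral>x. path_expectation (\<lambda>p. ?I (p 0)) x \<partial>\<mu>)"
      by (rule chain_integral[OF Pm]) (rule b)
    then show ?thesis by (simp only: pe)
  qed
  moreover have "(\<integral>p. ?I (p 0) \<partial>chain) = (\<integral>p. indicator (A 0) p \<partial>chain)"
    by (intro Bochner_Integration.integral_cong refl) (simp add: A_def indicator_def)
  moreover have "(\<integral>p. indicator (A 0) p \<partial>chain) = measure chain (A 0)"
    using A[of 0] by simp
  ultimately have A0: "measure chain (A 0) = 0" by simp
  have "AE p in chain. f (p k) = g (p k)" for k
  proof -
    have "A k = {p \<in> space path_space. (left_shift ^^ k) p 0 \<in> D}"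
      by (simp add: A_def left_shift_funpow)
    then have "measure chain (A k) = 0"
      using measure_chain_shift[of "\<lambda>p. p 0 \<in> D" k] A[of 0] A0 by (simp add: A_def)
    then have "A k \<in> null_sets chain"
      using A by (intro null_setsI) (auto simp: chain.emeasure_eq_measure)
    from AE_not_in[OF this] AE_space[of chain] show ?thesis
    proof eventually_elim
      case (elim p)
      then have "p k \<in> space leb01" using measurable_space[OF measurable_component_singleton[of k UNIV "\<lambda>_. leb01"]] by simp
      with elim show ?case by (auto simp: A_def D_def)
    qed
  qed
  then show ?thesis by (simp add: AE_all_countable)
qed

end

section \<open>Randomly rounded Birkhoff sums\<close>

text \<open>Translates of this tent function by the integers form a Lipschitz partition of unity.\<close>

definition hat :: "real \<Rightarrow> real" where
  "hat z = max 0 (1 - \<bar>z\<bar>)"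

lemma hat_bounds: "0 \<le> hat z" "hat z \<le> 1"
  by (auto simp: hat_def)

lemma hat_lipschitz: "\<bar>hat z - hat w\<bar> \<le> \<bar>z - w\<bar>"
  by (auto simp: hat_def max_def)

lemma hat_measurable [measurable]: "hat \<in> borel_measurable borel"
  unfolding hat_def[abs_def] by measurable

lemma hat_nonzero_imp: "hat z \<noteq> 0 \<Longrightarrow> \<bar>z\<bar> \<le> 1"
  by (auto simp: hat_def max_def split: if_splits)

lemma hat_partition_of_unity:
  fixes N :: int
  assumes z: "\<bar>z\<bar> \<le> of_int N"
  shows "(\<Sum>i\<in>{-N-1..N+1}. hat (z - of_int i)) = 1"
proof -
  define k where "k = \<lfloor>z\<rfloor>"
  have k: "of_int k \<le> z" "z < of_int k + 1" by (auto simp: k_def)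
  have "of_int (-N - 1) < (of_int k :: real)" "(of_int k :: real) \<le> of_int N" using k z by auto
  then have kN: "-N - 1 < k" "k \<le> N" by (simp_all only: of_int_less_iff of_int_le_iff)
  have "(\<Sum>i\<in>{-N-1..N+1}. hat (z - of_int i)) = (\<Sum>i\<in>{k, k + 1}. hat (z - of_int i))"
  proof (rule sum.mono_neutral_right)
    show "\<forall>i\<in>{-N-1..N+1} - {k, k + 1}. hat (z - of_int i) = 0"
    proof
      fix i assume "i \<in> {-N-1..N+1} - {k, k + 1}"
      then have "i + 1 \<le> k \<or> k + 2 \<le> i" by auto
      then have "of_int (i + 1) \<le> (of_int k :: real) \<or> of_int (k + 2) \<le> (of_int i :: real)"
        by (simp only: of_int_le_iff)
      then show "hat (z - of_int i) = 0" using k by (auto simp: hat_def max_def)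
    qed
  qed (use kN in auto)
  also have "\<dots> = hat (z - of_int k) + hat (z - of_int (k + 1))" by simp
  also have "\<dots> = 1" using k by (simp add: hat_def max_def)
  finally show ?thesis .
qed

text \<open>A smooth stand-in for \<open>v\<close> evaluated at the rounded Birkhoff sum. Each value \<open>\<psi> (p j)\<close> is rounded at
  random to a multiple \<open>\<eta> * i\<close> of the mesh, with the tent weights as probabilities, and \<open>v\<close> is averaged over
  the sum of the \<open>i\<close>. The indicator of a half-line, evaluated at the Birkhoff sum, need not have bounded
  variation as a function of the starting point. The mixture is instead a sum of \<open>card Z ^ k\<close> products of one-point functions of bounded variation, to which the
  transfer operator can be applied one step at a time.\<close>

primrec grid_mixture :: "(real \<Rightarrow> real) \<Rightarrow> real \<Rightarrow> int set \<Rightarrow> nat \<Rightarrow> (int \<Rightarrow> real) \<Rightarrow> (nat \<Rightarrow> real) \<Rightarrow> real" where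
  "grid_mixture \<psi> \<eta> Z 0 v p = v 0"
| "grid_mixture \<psi> \<eta> Z (Suc k) v p =
     (\<Sum>i\<in>Z. hat (\<psi> (p 0) / \<eta> - of_int i) * grid_mixture \<psi> \<eta> Z k (\<lambda>s. v (i + s)) (left_shift p))"

lemma grid_mixture_measurable:
  assumes \<psi>: "\<psi> \<in> borel_measurable leb01"
  shows "grid_mixture \<psi> \<eta> Z k v \<in> borel_measurable path_space"
proof (induction k arbitrary: v)
  case 0
  have "grid_mixture \<psi> \<eta> Z 0 v = (\<lambda>_. v 0)" by (rule ext) simp
  then show ?case by simp
next
  case (Suc k)
  have \<psi>0: "(\<lambda>p. \<psi> (p 0)) \<in> borel_measurable path_space"
    by (rule measurable_compose[where f="\<lambda>p. p 0", OF _ \<psi>]) (rule measurable_component_singleton, simp)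
  have "(\<lambda>p. hat (\<psi> (p 0) / \<eta> - of_int i)) \<in> borel_measurable path_space" for i
    by (rule measurable_compose[OF _ hat_measurable]) (use \<psi>0 in measurable)
  moreover have "(\<lambda>p. grid_mixture \<psi> \<eta> Z k (\<lambda>s. v (i + s)) (left_shift p)) \<in> borel_measurable path_space" for i
    by (rule measurable_compose[OF left_shift_measurable Suc])
  ultimately show ?case
    unfolding grid_mixture.simps[abs_def] by (intro borel_measurable_sum borel_measurable_times)
qed

lemma grid_mixture_bounds:
  assumes part: "\<And>y. (\<Sum>i\<in>Z. hat (\<psi> y / \<eta> - of_int i)) = 1"
    and v: "\<And>s. 0 \<le> v s \<and> v s \<le> 1"
  shows "0 \<le> grid_mixture \<psi> \<eta> Z k v p \<and> grid_mixture \<psi> \<eta> Z k v p \<le> 1"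
  using v
proof (induction k arbitrary: v p)
  case (Suc k)
  let ?G = "\<lambda>i. grid_mixture \<psi> \<eta> Z k (\<lambda>s. v (i + s)) (left_shift p)"
  have G: "0 \<le> ?G i \<and> ?G i \<le> 1" for i by (rule Suc.IH) (rule Suc.prems)
  have "(\<Sum>i\<in>Z. hat (\<psi> (p 0) / \<eta> - of_int i) * ?G i) \<le> (\<Sum>i\<in>Z. hat (\<psi> (p 0) / \<eta> - of_int i) * 1)"
    using G hat_bounds(1) by (intro sum_mono mult_left_mono) auto
  moreover have "0 \<le> (\<Sum>i\<in>Z. hat (\<psi> (p 0) / \<eta> - of_int i) * ?G i)"
    using G hat_bounds(1) by (intro sum_nonneg mult_nonneg_nonneg) auto
  ultimately show ?case using part by simp
qed simp

text \<open>Rounding moves each summand by at most the mesh \<open>\<eta>\<close>, hence the Birkhoff sum by at most \<open>k * \<eta>\<close>.\<close>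

lemma grid_mixture_eqI:
  assumes part: "\<And>y. (\<Sum>i\<in>Z. hat (\<psi> y / \<eta> - of_int i)) = 1" and \<eta>: "0 < \<eta>"
    and v: "\<And>s. \<bar>\<eta> * of_int s - birkhoff_sum \<psi> k p\<bar> \<le> real k * \<eta> \<Longrightarrow> v s = \<kappa>"
  shows "grid_mixture \<psi> \<eta> Z k v p = \<kappa>"
  using v
proof (induction k arbitrary: v p)
  case 0
  then show ?case by (simp add: birkhoff_sum_eq)
next
  case (Suc k)
  have eq: "hat (\<psi> (p 0) / \<eta> - of_int i) * grid_mixture \<psi> \<eta> Z k (\<lambda>s. v (i + s)) (left_shift p)
     = hat (\<psi> (p 0) / \<eta> - of_int i) * \<kappa>" for i
  proof (cases "hat (\<psi> (p 0) / \<eta> - of_int i) = 0")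
    case False
    then have "\<bar>\<psi> (p 0) / \<eta> - of_int i\<bar> \<le> 1" by (rule hat_nonzero_imp)
    then have "\<eta> * \<bar>\<psi> (p 0) / \<eta> - of_int i\<bar> \<le> \<eta> * 1" using \<eta> by (intro mult_left_mono) auto
    moreover have "\<eta> * \<bar>\<psi> (p 0) / \<eta> - of_int i\<bar> = \<bar>\<eta> * (\<psi> (p 0) / \<eta> - of_int i)\<bar>"
      using \<eta> by (simp add: abs_mult)
    moreover have "\<eta> * (\<psi> (p 0) / \<eta> - of_int i) = \<psi> (p 0) - \<eta> * of_int i"
      using \<eta> by (simp add: right_diff_distrib)
    ultimately have i: "\<bar>\<psi> (p 0) - \<eta> * of_int i\<bar> \<le> \<eta>" by simp
    have "grid_mixture \<psi> \<eta> Z k (\<lambda>s. v (i + s)) (left_shift p) = \<kappa>"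
    proof (rule Suc.IH)
      fix s assume s: "\<bar>\<eta> * of_int s - birkhoff_sum \<psi> k (left_shift p)\<bar> \<le> real k * \<eta>"
      show "v (i + s) = \<kappa>"
      proof (rule Suc.prems)
        have "\<eta> * of_int (i + s) - birkhoff_sum \<psi> (Suc k) p
          = (\<eta> * of_int s - birkhoff_sum \<psi> k (left_shift p)) - (\<psi> (p 0) - \<eta> * of_int i)"
          by (simp add: birkhoff_sum_Suc algebra_simps)
        then have "\<bar>\<eta> * of_int (i + s) - birkhoff_sum \<psi> (Suc k) p\<bar> \<le> real k * \<eta> + \<eta>"
          using s i by linarith
        then show "\<bar>\<eta> * of_int (i + s) - birkhoff_sum \<psi> (Suc k) p\<bar> \<le> real (Suc k) * \<eta>"
          by (simp add: algebra_simps)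
      qed
    qed
    then show ?thesis by simp
  qed simp
  show ?case unfolding grid_mixture.simps eq sum_distrib_right[symmetric] part by simp
qed

context random_system
begin

lemma path_expectation_abs_le:
  assumes "\<Phi> \<in> borel_measurable path_space"
    and B: "\<And>p. p \<in> space path_space \<Longrightarrow> \<bar>\<Phi> p\<bar> \<le> B" and x: "x \<in> {0..1}"
  shows "\<bar>path_expectation \<Phi> x\<bar> \<le> B"
proof -
  have "-B \<le> \<Phi> p \<and> \<Phi> p \<le> B" if "p \<in> space path_space" for p using B[OF that] by linarith
  from path_expectation_bounds[OF assms(1) this x] show ?thesis by linarith
qed

text \<open>Start the chain with density \<open>d0\<close>, weight the paths with the mixture, and look at time \<open>k\<close>: the
  weighted law of the current point has a density of bounded variation whose bound grows at most
  exponentially in \<open>k\<close>. Peeling off the first coordinate turns \<open>d0\<close> into the densities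
  \<open>P (d0 * tent)\<close>, one for each rounding of the first value, and \<open>P\<close> is bounded on \<open>BV\<close>.\<close>

lemma grid_mixture_density:
  assumes bdd: "\<forall>f\<in>BV. annealed_transfer M T f \<in> BV"
    and C: "\<forall>f\<in>BV. BV_norm (annealed_transfer M T f) \<le> C * BV_norm f"
    and part: "\<And>y. (\<Sum>i\<in>Z. hat (\<psi> y / \<eta> - of_int i)) = 1"
    and \<psi>: "\<psi> \<in> borel_measurable leb01"
    and E: "0 < E" "\<And>i. bv_bounded E (\<lambda>y. hat (\<psi> y / \<eta> - of_int i))"
    and Z: "finite Z"
    and d0: "bv_bounded B d0" "0 < B"
    and v: "\<And>s. 0 \<le> v s \<and> v s \<le> 1"
  shows "\<exists>d. bv_bounded ((real (card Z) * ((2 * \<bar>C\<bar> + 1) * (2 * E))) ^ k * (2 * B)) d \<and>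
    (\<forall>\<Phi>. \<Phi> \<in> borel_measurable path_space \<longrightarrow> (\<forall>p\<in>space path_space. \<bar>\<Phi> p\<bar> \<le> 1) \<longrightarrow>
      (\<integral>x. d0 x * path_expectation (\<lambda>p. grid_mixture \<psi> \<eta> Z k v p * \<Phi> ((left_shift ^^ k) p)) x \<partial>leb01)
        = (\<integral>x. d x * path_expectation \<Phi> x \<partial>leb01))"
  using d0 v
proof (induction k arbitrary: d0 B v)
  case 0
  have "bv_bounded (2 * B * \<bar>v 0\<bar>) (\<lambda>x. d0 x * v 0)"
    by (rule bv_bounded_mult[OF 0(1) bv_bounded_const])
  moreover have "2 * B * \<bar>v 0\<bar> \<le> 2 * B"
    using 0(2) 0(3)[of 0] by (intro mult_left_le) auto
  ultimately have "bv_bounded (2 * B) (\<lambda>x. d0 x * v 0)" by (rule bv_bounded_mono)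
  then show ?case
    by (intro exI[of _ "\<lambda>x. d0 x * v 0"]) (simp add: path_expectation_def mult.assoc)
next
  case (Suc k)
  let ?c = "2 * \<bar>C\<bar> + 1" 
  let ?R = "real (card Z) * (?c * (2 * E))"
  let ?h = "\<lambda>i y. hat (\<psi> y / \<eta> - of_int i)"
  let ?d = "\<lambda>i. real_transfer (\<lambda>x. d0 x * ?h i x)"
  let ?v = "\<lambda>i s. v (i + s)"
  have d0h: "bv_bounded (2 * B * E) (\<lambda>x. d0 x * ?h i x)" for i
    by (rule bv_bounded_mult[OF Suc.prems(1) E(2)])
  have di: "bv_bounded (?c * (2 * B * E)) (?d i)" for i
    using Suc.prems(2) E(1) by (intro real_transfer_bv[OF bdd C d0h]) simp
  have pos: "0 < ?c * (2 * B * E)" using Suc.prems(2) E(1) by (intro mult_pos_pos) auto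
  define good where "good i d \<longleftrightarrow> bv_bounded (?R ^ k * (2 * (?c * (2 * B * E)))) d \<and>
    (\<forall>\<Phi>. \<Phi> \<in> borel_measurable path_space \<longrightarrow> (\<forall>p\<in>space path_space. \<bar>\<Phi> p\<bar> \<le> 1) \<longrightarrow>
      (\<integral>x. ?d i x * path_expectation (\<lambda>p. grid_mixture \<psi> \<eta> Z k (?v i) p * \<Phi> ((left_shift ^^ k) p)) x \<partial>leb01)
        = (\<integral>x. d x * path_expectation \<Phi> x \<partial>leb01))" for i d
  have "\<exists>d. good i d" for i
    unfolding good_def by (rule Suc.IH[OF di pos]) (rule Suc.prems(3))
  then obtain d where good: "\<And>i. good i (d i)" by metis
  then have d: "\<And>i. bv_bounded (?R ^ k * (2 * (?c * (2 * B * E)))) (d i)"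
    unfolding good_def by blast
  have dI: "(\<integral>x. ?d i x * path_expectation (\<lambda>p. grid_mixture \<psi> \<eta> Z k (?v i) p * \<Phi> ((left_shift ^^ k) p)) x \<partial>leb01)
        = (\<integral>x. d i x * path_expectation \<Phi> x \<partial>leb01)"
    if "\<Phi> \<in> borel_measurable path_space" "\<forall>p\<in>space path_space. \<bar>\<Phi> p\<bar> \<le> 1" for i \<Phi>
    using good[of i] that unfolding good_def by blast
  have "bv_bounded (real (card Z) * (?R ^ k * (2 * (?c * (2 * B * E))))) (\<lambda>x. \<Sum>i\<in>Z. d i x)"
    by (rule bv_bounded_sum[OF Z d])
  moreover have "real (card Z) * (?R ^ k * (2 * (?c * (2 * B * E)))) = ?R ^ Suc k * (2 * B)"
    by (simp add: algebra_simps)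
  ultimately have bv: "bv_bounded (?R ^ Suc k * (2 * B)) (\<lambda>x. \<Sum>i\<in>Z. d i x)" by (simp only:)
  have "(\<integral>x. d0 x * path_expectation (\<lambda>p. grid_mixture \<psi> \<eta> Z (Suc k) v p * \<Phi> ((left_shift ^^ Suc k) p)) x \<partial>leb01)
        = (\<integral>x. (\<Sum>i\<in>Z. d i x) * path_expectation \<Phi> x \<partial>leb01)"
    if \<Phi>: "\<Phi> \<in> borel_measurable path_space" and \<Phi>1: "\<forall>p\<in>space path_space. \<bar>\<Phi> p\<bar> \<le> 1" for \<Phi>
  proof -
    let ?F = "\<lambda>i p. grid_mixture \<psi> \<eta> Z k (?v i) p * \<Phi> ((left_shift ^^ k) p)"
    have Fm: "?F i \<in> borel_measurable path_space" for i
      by (intro borel_measurable_times grid_mixture_measurable \<psi> measurable_compose[OF measurable_left_shift_funpow \<Phi>])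
    have F1: "\<bar>?F i p\<bar> \<le> 1" if p: "p \<in> space path_space" for i p
    proof -
      have g: "\<bar>grid_mixture \<psi> \<eta> Z k (?v i) p\<bar> \<le> 1"
      proof -
        have "0 \<le> grid_mixture \<psi> \<eta> Z k (?v i) p \<and> grid_mixture \<psi> \<eta> Z k (?v i) p \<le> 1"
          by (rule grid_mixture_bounds[where \<psi>=\<psi>]) (rule part, rule Suc.prems(3))
        then show ?thesis by simp
      qed
      have f: "\<bar>\<Phi> ((left_shift ^^ k) p)\<bar> \<le> 1"
        using \<Phi>1 measurable_space[OF measurable_left_shift_funpow p] by blast
      show ?thesis unfolding abs_mult using mult_mono[OF g f] by simp
    qed
    have hm: "(\<lambda>p. ?h i (p 0)) \<in> borel_measurable path_space" for i
      using measurable_coordinate[OF bv_bounded_measurable[OF E(2)[of i]]] .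
    have pe: "path_expectation (\<lambda>p. grid_mixture \<psi> \<eta> Z (Suc k) v p * \<Phi> ((left_shift ^^ Suc k) p)) x
       = (\<Sum>i\<in>Z. ?h i x * annealed_koopman M T (path_expectation (?F i)) x)" if x: "x \<in> {0..1}" for x
    proof -
      have eq: "grid_mixture \<psi> \<eta> Z (Suc k) v p * \<Phi> ((left_shift ^^ Suc k) p) = (\<Sum>i\<in>Z. ?h i (p 0) * ?F i (left_shift p))" for p
        by (simp add: sum_distrib_right mult.assoc funpow_swap1)
      have int: "integrable noise.S (\<lambda>\<omega>. ?h i (orbit x \<omega> 0) * ?F i (left_shift (orbit x \<omega>)))" for i
      proof (rule integrable_orbit[where B=1, OF _ _ x])
        show "(\<lambda>p. ?h i (p 0) * ?F i (left_shift p)) \<in> borel_measurable path_space"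
          by (rule borel_measurable_times[OF hm measurable_compose[OF left_shift_measurable Fm]])
        show "\<bar>?h i (p 0) * ?F i (left_shift p)\<bar> \<le> 1" if p: "p \<in> space path_space" for p
        proof -
          have h: "\<bar>?h i (p 0)\<bar> \<le> 1" using hat_bounds by simp
          show ?thesis unfolding abs_mult[of "?h i (p 0)"]
            using mult_mono[OF h F1[OF measurable_space[OF left_shift_measurable p], of i]] by simp
        qed
      qed
      have "path_expectation (\<lambda>p. grid_mixture \<psi> \<eta> Z (Suc k) v p * \<Phi> ((left_shift ^^ Suc k) p)) x
        = (\<Sum>i\<in>Z. path_expectation (\<lambda>p. ?h i (p 0) * ?F i (left_shift p)) x)"
        unfolding path_expectation_def eq by (rule Bochner_Integration.integral_sum[OF int])
      also have "\<dots> = (\<Sum>i\<in>Z. ?h i x * annealed_koopman M T (path_expectation (?F i)) x)"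
        by (intro sum.cong refl path_expectation_step[OF Fm F1 x])
      finally show ?thesis .
    qed
    have pem: "path_expectation (?F i) \<in> borel_measurable leb01" for i
      by (rule path_expectation_measurable[OF Fm])
    have peb: "\<bar>path_expectation (?F i) x\<bar> \<le> 1" if "x \<in> {0..1}" for i x
      by (rule path_expectation_abs_le[OF Fm F1 that])
    have Km: "annealed_koopman M T (path_expectation (?F i)) \<in> borel_measurable leb01" for i
      by (rule koopman_measurable[OF pem])
    have Kb: "\<bar>annealed_koopman M T (path_expectation (?F i)) x\<bar> \<le> 1" if "x \<in> {0..1}" for i x
      using koopman_bounded(2)[OF pem _ that, of i 1] peb by simp
    have "(\<integral>x. d0 x * path_expectation (\<lambda>p. grid_mixture \<psi> \<eta> Z (Suc k) v p * \<Phi> ((left_shift ^^ Suc k) p)) x \<partial>leb01)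
      = (\<integral>x. (\<Sum>i\<in>Z. (d0 x * ?h i x) * annealed_koopman M T (path_expectation (?F i)) x) \<partial>leb01)"
      by (intro Bochner_Integration.integral_cong refl) (simp add: pe sum_distrib_left mult.assoc del: grid_mixture.simps funpow.simps)
    also have "\<dots> = (\<Sum>i\<in>Z. (\<integral>x. (d0 x * ?h i x) * annealed_koopman M T (path_expectation (?F i)) x \<partial>leb01))"
      by (intro Bochner_Integration.integral_sum integrable_mult_bounded bv_bounded_integrable[OF d0h] Km Kb)
    also have "\<dots> = (\<Sum>i\<in>Z. (\<integral>x. ?d i x * path_expectation (?F i) x \<partial>leb01))"
      by (intro sum.cong refl real_transfer_duality[OF bv_bounded_integrable[OF d0h] pem peb, symmetric])
    also have "\<dots> = (\<Sum>i\<in>Z. (\<integral>x. d i x * path_expectation \<Phi> x \<partial>leb01))"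
      by (intro sum.cong refl dI[OF \<Phi> \<Phi>1])
    also have "\<dots> = (\<integral>x. (\<Sum>i\<in>Z. d i x * path_expectation \<Phi> x) \<partial>leb01)"
    proof (rule Bochner_Integration.integral_sum[symmetric])
      fix i assume "i \<in> Z"
      have "\<bar>path_expectation \<Phi> x\<bar> \<le> 1" if "x \<in> {0..1}" for x
        by (rule path_expectation_abs_le[OF \<Phi> _ that]) (use \<Phi>1 in blast)
      then show "integrable leb01 (\<lambda>x. d i x * path_expectation \<Phi> x)"
        by (intro integrable_mult_bounded bv_bounded_integrable[OF d] path_expectation_measurable \<Phi>)
    qed
    finally show ?thesis by (simp add: sum_distrib_right)
  qed
  with bv show ?case by blast
qed

end

section \<open>Decoupling of distant blocks\<close>

text \<open>The set where \<open>f\<close> is negative is one of the test sets.\<close>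

lemma AE_nonneg_if_set_integrals_nonneg:
  fixes f :: "real \<Rightarrow> real"
  assumes f: "integrable leb01 f"
    and A: "\<And>A. A \<in> sets leb01 \<Longrightarrow> 0 \<le> (\<integral>x. f x * indicator A x \<partial>leb01)"
  shows "AE x in leb01. 0 \<le> f x"
proof -
  have fm: "f \<in> borel_measurable leb01" using f by simp
  define N where "N = {x \<in> space leb01. f x < 0}"
  have N: "N \<in> sets leb01" unfolding N_def using fm by measurable
  have int: "integrable leb01 (\<lambda>x. f x * indicator N x)"
    using integrable_mult_indicator[OF N f] by (simp add: mult.commute)
  have le: "f x * indicator N x \<le> 0" for x by (simp add: N_def indicator_def mult_nonneg_nonpos)
  have "(\<integral>x. - (f x * indicator N x) \<partial>leb01) = 0"
  proof (rule antisym)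
    show "(\<integral>x. - (f x * indicator N x) \<partial>leb01) \<le> 0" using A[OF N] by simp
    show "0 \<le> (\<integral>x. - (f x * indicator N x) \<partial>leb01)"
      by (rule Bochner_Integration.integral_nonneg) (use le in simp)
  qed
  then have "AE x in leb01. - (f x * indicator N x) = 0"
    using int le by (subst (asm) integral_nonneg_eq_0_iff_AE) auto
  with AE_space[of leb01] show ?thesis
  proof eventually_elim
    case (elim x)
    then show ?case by (cases "x \<in> N") (auto simp: N_def)
  qed
qed

lemma (in stationary_chain) prob_path_space [simp]: "measure chain (space path_space) = 1"
  using chain.prob_space by simp

text \<open>The hypotheses on the random system with their constants named: \<open>C\<close> bounds the transfer operator on
  \<open>BV\<close>, \<open>C'\<close> and \<open>r\<close> quantify the decay of correlations, and \<open>D\<close> bounds the stationary density \<open>h\<close>.\<close>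

locale mixing_chain = stationary_chain +
  fixes C C' r D :: real and h :: "real \<Rightarrow> real"
  assumes transfer_BV: "\<forall>f\<in>BV. annealed_transfer M T f \<in> BV"
    and transfer_norm: "\<forall>f\<in>BV. BV_norm (annealed_transfer M T f) \<le> C * BV_norm f"
    and h: "\<And>x. 0 \<le> h x" "\<mu> = density leb01 (\<lambda>x. ennreal (h x))" "bv_bounded D h"
    and D: "0 < D"
    and r: "0 < r" "r < 1" and C': "0 < C'"
    and decay: "\<And>n f (g :: real \<Rightarrow> complex). f \<in> BV \<Longrightarrow> integrable \<mu> g \<Longrightarrow>
      cmod ((\<integral>x. f x * (annealed_koopman M T ^^ n) g x \<partial>\<mu>) - (\<integral>x. f x \<partial>\<mu>) * (\<integral>x. g x \<partial>\<mu>))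
          \<le> C' * r ^ n * BV_norm f * L1_norm \<mu> g"
begin

lemma h_integrable: "integrable leb01 h"
  by (rule bv_bounded_integrable[OF h(3)])

lemma integral_\<mu>:
  fixes g :: "real \<Rightarrow> real"
  assumes "g \<in> borel_measurable leb01"
  shows "(\<integral>x. g x \<partial>\<mu>) = (\<integral>x. h x * g x \<partial>leb01)"
  unfolding h(2) using h(1) h_integrable assms by (subst integral_density) auto

lemma decay_real:
  fixes u g :: "real \<Rightarrow> real"
  assumes u: "bv_bounded B u" and g: "g \<in> borel_measurable leb01" "\<And>x. x \<in> {0..1} \<Longrightarrow> 0 \<le> g x \<and> g x \<le> 1"
  shows "(\<integral>x. u x * (annealed_koopman M T ^^ n) g x \<partial>\<mu>) \<le> (\<integral>x. u x \<partial>\<mu>) * (\<integral>x. g x \<partial>\<mu>) + C' * r ^ n * (2 * B)"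
proof -
  have uc: "bv_bounded B (\<lambda>x. complex_of_real (u x))" by (rule bv_bounded_of_real[OF u])
  have gm: "g \<in> borel_measurable \<mu>" using g(1) by (simp cong: measurable_cong_sets add: sets_\<mu>)
  have gi: "integrable \<mu> g"
    by (rule \<mu>.integrable_const_bound[of _ 1]) (use g gm space_\<mu> in auto)
  have gc: "integrable \<mu> (\<lambda>x. complex_of_real (g x))" by (rule integrable_of_real[OF gi])
  have L1: "L1_norm \<mu> (\<lambda>x. complex_of_real (g x)) \<le> 1"
  proof -
    have "L1_norm \<mu> (\<lambda>x. complex_of_real (g x)) = (\<integral>x. \<bar>g x\<bar> \<partial>\<mu>)" by (simp add: L1_norm_def)
    also have "\<dots> \<le> (\<integral>x. 1 \<partial>\<mu>)" using gi g space_\<mu> by (intro integral_mono) auto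
    finally show ?thesis by (simp add: \<mu>.prob_space)
  qed
  have L0: "0 \<le> L1_norm \<mu> (\<lambda>x. complex_of_real (g x))" by (simp add: L1_norm_def)
  let ?a = "\<integral>x. u x * (annealed_koopman M T ^^ n) g x \<partial>\<mu>" and ?b = "(\<integral>x. u x \<partial>\<mu>) * (\<integral>x. g x \<partial>\<mu>)"
  have eq: "(\<integral>x. complex_of_real (u x) * (annealed_koopman M T ^^ n) (\<lambda>x. complex_of_real (g x)) x \<partial>\<mu>)
      - (\<integral>x. complex_of_real (u x) \<partial>\<mu>) * (\<integral>x. complex_of_real (g x) \<partial>\<mu>) = complex_of_real (?a - ?b)"
    by (simp only: koopman_funpow_of_real of_real_mult[symmetric] integral_complex_of_real of_real_diff[symmetric])
  have "?a - ?b \<le> \<bar>?a - ?b\<bar>" by (rule abs_ge_self)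
  also have "\<dots> = cmod (complex_of_real (?a - ?b))" by (simp only: norm_of_real)
  also have "\<dots> \<le> C' * r ^ n * BV_norm (\<lambda>x. complex_of_real (u x)) * L1_norm \<mu> (\<lambda>x. complex_of_real (g x))"
    unfolding eq[symmetric] by (rule decay[OF bv_bounded_imp_BV(1)[OF uc] gc])
  also have "\<dots> \<le> C' * r ^ n * (2 * B) * 1"
    using bv_bounded_imp_BV(2)[OF uc] L1 L0 r C' bv_bounded_nonneg[OF u]
    by (intro mult_mono mult_left_mono) auto
  finally show ?thesis by simp
qed

end

text \<open>An observable \<open>\<psi>\<close> together with a mesh \<open>\<eta>\<close> and a finite range \<open>Z\<close> of grid points that covers its values.\<close>

locale observed_chain = mixing_chain +
  fixes \<psi> :: "real \<Rightarrow> real" and \<eta> E :: real and Z :: "int set"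
  assumes partition: "\<And>y. (\<Sum>i\<in>Z. hat (\<psi> y / \<eta> - of_int i)) = 1"
    and \<psi>: "\<psi> \<in> borel_measurable leb01" and \<eta>: "0 < \<eta>"
    and E: "0 < E" "\<And>i. bv_bounded E (\<lambda>y. hat (\<psi> y / \<eta> - of_int i))"
    and Z: "finite Z"
begin

text \<open>The factor by which one step of \<open>grid_mixture_density\<close> increases the bound of the density.\<close>

definition growth :: real where
  "growth = real (card Z) * ((2 * \<bar>C\<bar> + 1) * (2 * E))"

lemma growth_nonneg: "0 \<le> growth"
  using E(1) by (simp add: growth_def)

text \<open>The price of decoupling a block of length \<open>l\<close> from the future after a gap \<open>n\<close>: \<open>\<delta>\<close> for the truncation of the
  density, and the correlation bound for the truncated quotient.\<close>

definition decoupling_error :: "nat \<Rightarrow> nat \<Rightarrow> real \<Rightarrow> real" where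
  "decoupling_error l n \<delta> = \<delta> + C' * r ^ n * (2 * (growth ^ l * (2 * D) / \<delta> + growth ^ l * (2 * D) * D / \<delta>\<^sup>2))"

text \<open>Let \<open>d\<close> be the density at time \<open>l\<close> of the chain weighted by the mixture. The left side is the integral of
  \<open>d\<close> against \<open>U\<^sup>n g\<close>, where \<open>g\<close> is the path expectation of \<open>\<Phi>\<close>. The decay of correlations is formulated
  relative to \<open>\<mu>\<close>, so it needs \<open>d / h\<close>, which may fail to have bounded variation. Since the weight
  lies in \<open>[0,1]\<close>, however, \<open>0 \<le> d \<le> h\<close>. Replacing \<open>h\<close> by \<open>max h \<delta>\<close> in the denominator therefore alters
  the integral only where \<open>h < \<delta>\<close>, and there by at most \<open>\<delta>\<close>.\<close>

lemma decoupling: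
  assumes v: "\<And>s. 0 \<le> v s \<and> v s \<le> 1"
    and \<Phi>: "\<Phi> \<in> borel_measurable path_space" "\<And>p. p \<in> space path_space \<Longrightarrow> 0 \<le> \<Phi> p \<and> \<Phi> p \<le> 1"
    and \<delta>: "0 < \<delta>"
  shows "(\<integral>p. grid_mixture \<psi> \<eta> Z l v p * \<Phi> ((left_shift ^^ (l + n)) p) \<partial>chain)
    \<le> (\<integral>p. grid_mixture \<psi> \<eta> Z l v p \<partial>chain) * (\<integral>p. \<Phi> p \<partial>chain) + decoupling_error l n \<delta>"
proof -
  let ?H = "grid_mixture \<psi> \<eta> Z l v"
  let ?B = "growth ^ l * (2 * D)"
  obtain d where d: "bv_bounded ?B d"
    and dI: "\<And>\<Psi>. \<Psi> \<in> borel_measurable path_space \<Longrightarrow> (\<forall>p\<in>space path_space. \<bar>\<Psi> p\<bar> \<le> 1) \<Longrightarrow>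
      (\<integral>x. h x * path_expectation (\<lambda>p. ?H p * \<Psi> ((left_shift ^^ l) p)) x \<partial>leb01)
        = (\<integral>x. d x * path_expectation \<Psi> x \<partial>leb01)"
    using grid_mixture_density[where v=v and \<psi>=\<psi> and k=l, OF transfer_BV transfer_norm partition \<psi> E Z h(3) D v]
    unfolding growth_def by blast
  have di: "integrable leb01 d" by (rule bv_bounded_integrable[OF d])
  have dm: "d \<in> borel_measurable leb01" by (rule bv_bounded_measurable[OF d])
  have hm: "h \<in> borel_measurable leb01" by (rule bv_bounded_measurable[OF h(3)])
  have Hm: "?H \<in> borel_measurable path_space" by (rule grid_mixture_measurable[OF \<psi>])
  have H: "0 \<le> ?H p \<and> ?H p \<le> 1" for p
    by (rule grid_mixture_bounds[where \<psi>=\<psi>]) (rule partition, rule v)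
  have key: "(\<integral>p. ?H p * \<Psi> ((left_shift ^^ l) p) \<partial>chain) = (\<integral>x. d x * path_expectation \<Psi> x \<partial>leb01)"
    if \<Psi>m: "\<Psi> \<in> borel_measurable path_space" and \<Psi>1: "\<And>p. p \<in> space path_space \<Longrightarrow> \<bar>\<Psi> p\<bar> \<le> 1" for \<Psi>
  proof -
    let ?F = "\<lambda>p. ?H p * \<Psi> ((left_shift ^^ l) p)"
    have Fm: "?F \<in> borel_measurable path_space"
      by (intro borel_measurable_times Hm measurable_compose[OF measurable_left_shift_funpow \<Psi>m])
    have F1: "\<bar>?F p\<bar> \<le> 1" if "p \<in> space path_space" for p
    proof -
      have a: "\<bar>?H p\<bar> \<le> 1" using H[of p] by simp
      show ?thesis
        unfolding abs_mult using mult_mono[OF a \<Psi>1[OF measurable_space[OF measurable_left_shift_funpow that, of l]]] by simp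
    qed
    have "(\<integral>p. ?F p \<partial>chain) = (\<integral>x. path_expectation ?F x \<partial>\<mu>)" by (rule chain_integral[OF Fm F1])
    also have "\<dots> = (\<integral>x. h x * path_expectation ?F x \<partial>leb01)"
      by (rule integral_\<mu>[OF path_expectation_measurable[OF Fm]])
    also have "\<dots> = (\<integral>x. d x * path_expectation \<Psi> x \<partial>leb01)" using \<Psi>1 by (intro dI[OF \<Psi>m]) blast
    finally show ?thesis .
  qed
  \<comment> \<open>the weight lies between \<open>0\<close> and \<open>1\<close>, so the weighted law lies between \<open>0\<close> and \<open>\<mu>\<close>\<close>
  have dA: "0 \<le> (\<integral>x. d x * indicator A x \<partial>leb01)" "(\<integral>x. d x * indicator A x \<partial>leb01) \<le> (\<integral>x. h x * indicator A x \<partial>leb01)"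
    if A: "A \<in> sets leb01" for A
  proof -
    let ?I = "\<lambda>p. indicator A (p 0) :: real"
    have Am: "(\<lambda>x. indicator A x :: real) \<in> borel_measurable leb01" using A by simp
    have Im: "?I \<in> borel_measurable path_space" by (rule measurable_coordinate[OF Am])
    have I1: "\<bar>?I p\<bar> \<le> 1" for p by (simp add: indicator_def)
    have Is: "(\<lambda>p. ?I ((left_shift ^^ l) p)) \<in> borel_measurable path_space"
      by (rule measurable_compose[OF measurable_left_shift_funpow Im])
    have pe: "path_expectation ?I x = indicator A x" for x by (rule path_expectation_coord0)
    have "(\<integral>p. ?H p * ?I ((left_shift ^^ l) p) \<partial>chain) = (\<integral>x. d x * path_expectation ?I x \<partial>leb01)"
      by (rule key[OF Im]) (rule I1)
    then have eq: "(\<integral>x. d x * indicator A x \<partial>leb01) = (\<integral>p. ?H p * ?I ((left_shift ^^ l) p) \<partial>chain)"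
      by (simp only: pe)
    show "0 \<le> (\<integral>x. d x * indicator A x \<partial>leb01)"
      unfolding eq using H by (intro Bochner_Integration.integral_nonneg mult_nonneg_nonneg) auto
    have "(\<integral>p. ?H p * ?I ((left_shift ^^ l) p) \<partial>chain) \<le> (\<integral>p. ?I ((left_shift ^^ l) p) \<partial>chain)"
    proof (rule integral_mono)
      show "integrable chain (\<lambda>p. ?I ((left_shift ^^ l) p))"
        by (rule chain.integrable_const_bound[of _ 1]) (use Is in \<open>auto simp: indicator_def\<close>)
      show "integrable chain (\<lambda>p. ?H p * ?I ((left_shift ^^ l) p))"
      proof (rule chain.integrable_const_bound[of _ 1])
        show "(\<lambda>p. ?H p * ?I ((left_shift ^^ l) p)) \<in> borel_measurable chain" using Hm Is by measurable
      qed (use H in \<open>auto simp: indicator_def\<close>)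
      show "?H p * ?I ((left_shift ^^ l) p) \<le> ?I ((left_shift ^^ l) p)" for p
        using H[of p] by (simp add: indicator_def)
    qed
    also have "\<dots> = (\<integral>p. ?I p \<partial>distr chain path_space (left_shift ^^ l))"
      by (rule integral_distr[symmetric]) (use Im in measurable)
    also have "\<dots> = (\<integral>p. ?I p \<partial>chain)" by (simp only: chain_shift_funpow_invariant)
    also have "\<dots> = (\<integral>x. path_expectation ?I x \<partial>\<mu>)" by (rule chain_integral[OF Im]) (rule I1)
    also have "\<dots> = (\<integral>x. h x * indicator A x \<partial>leb01)"
      unfolding pe by (rule integral_\<mu>[OF Am])
    finally show "(\<integral>x. d x * indicator A x \<partial>leb01) \<le> (\<integral>x. h x * indicator A x \<partial>leb01)"
      unfolding eq .
  qed
  have d0: "AE x in leb01. 0 \<le> d x"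
    by (rule AE_nonneg_if_set_integrals_nonneg[OF di dA(1)])
  have dh: "AE x in leb01. 0 \<le> h x - d x"
  proof (rule AE_nonneg_if_set_integrals_nonneg)
    show "integrable leb01 (\<lambda>x. h x - d x)" using di h_integrable by simp
    fix A assume A: "A \<in> sets leb01"
    have "integrable leb01 (\<lambda>x. d x * indicator A x)" "integrable leb01 (\<lambda>x. h x * indicator A x)"
      using integrable_mult_indicator[OF A di] integrable_mult_indicator[OF A h_integrable] by (simp_all add: mult.commute)
    then have "(\<integral>x. (h x - d x) * indicator A x \<partial>leb01) = (\<integral>x. h x * indicator A x \<partial>leb01) - (\<integral>x. d x * indicator A x \<partial>leb01)"
      by (simp add: left_diff_distrib)
    then show "0 \<le> (\<integral>x. (h x - d x) * indicator A x \<partial>leb01)" using dA(2)[OF A] by simp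
  qed
  define u where "u x = d x / max (h x) \<delta>" for x
  have u: "bv_bounded (?B / \<delta> + ?B * D / \<delta>\<^sup>2) u"
    unfolding u_def[abs_def] by (rule bv_bounded_truncated_quotient[OF d h(3) \<delta>])
  have um: "u \<in> borel_measurable leb01" by (rule bv_bounded_measurable[OF u])
  define g where "g = path_expectation \<Phi>"
  have gm: "g \<in> borel_measurable leb01" unfolding g_def by (rule path_expectation_measurable[OF \<Phi>(1)])
  have g01: "0 \<le> g x \<and> g x \<le> 1" if "x \<in> {0..1}" for x
    unfolding g_def using path_expectation_bounds[OF \<Phi>(1,2) that] by blast
  let ?\<Psi> = "\<lambda>p. \<Phi> ((left_shift ^^ n) p)"
  have \<Psi>m: "?\<Psi> \<in> borel_measurable path_space" by (rule measurable_compose[OF measurable_left_shift_funpow \<Phi>(1)])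
  have \<Psi>01: "0 \<le> ?\<Psi> p \<and> ?\<Psi> p \<le> 1" if "p \<in> space path_space" for p
    by (rule \<Phi>(2)[OF measurable_space[OF measurable_left_shift_funpow that]])
  define w where "w = path_expectation ?\<Psi>"
  have wm: "w \<in> borel_measurable leb01" unfolding w_def by (rule path_expectation_measurable[OF \<Psi>m])
  have w01: "0 \<le> w x \<and> w x \<le> 1" if "x \<in> {0..1}" for x
    unfolding w_def using path_expectation_bounds[OF \<Psi>m \<Psi>01 that] by blast
  have wg: "w x = (annealed_koopman M T ^^ n) g x" if "x \<in> {0..1}" for x
    unfolding w_def g_def by (rule path_expectation_funpow[where B=1, OF \<Phi>(1) _ that]) (use \<Phi>(2) in auto)
  have pt: "AE x in leb01. d x * w x \<le> h x * (u x * w x) + \<delta> \<and> h x * u x \<le> d x \<and> 0 \<le> h x * u x"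
    using AE_space[of leb01] d0 dh
  proof eventually_elim
    case (elim x)
    have w: "0 \<le> w x" "w x \<le> 1" using w01 elim by auto
    have hu: "h x * u x \<le> d x \<and> d x \<le> h x * u x + \<delta> \<and> 0 \<le> h x * u x"
    proof (cases "\<delta> \<le> h x")
      case True
      then show ?thesis using \<delta> elim by (simp add: u_def max_def)
    next
      case False
      have "h x * u x = d x * (h x / \<delta>)" using False by (simp add: u_def max_def)
      moreover have "d x * (h x / \<delta>) \<le> d x" using elim False \<delta> h(1)[of x] by (intro mult_left_le) auto
      moreover have "0 \<le> d x * (h x / \<delta>)" using elim \<delta> h(1)[of x] by simp
      ultimately show ?thesis using elim False by linarith
    qed
    have "d x * w x \<le> (h x * u x + \<delta>) * w x" using hu w by (intro mult_right_mono) auto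
    also have "\<dots> = h x * (u x * w x) + \<delta> * w x" by (simp add: algebra_simps)
    also have "\<dots> \<le> h x * (u x * w x) + \<delta>" using w \<delta> by (simp add: mult_left_le)
    finally show ?case using hu by blast
  qed
  have hu_int: "integrable leb01 (\<lambda>x. h x * u x)"
    by (rule Bochner_Integration.integrable_bound[OF di]) (use hm um pt in \<open>auto elim: eventually_mono\<close>)
  have mult_int: "integrable leb01 (\<lambda>x. a x * w x)" if "integrable leb01 a" for a :: "real \<Rightarrow> real"
    by (rule integrable_mult_bounded[OF that wm]) (use w01 in force)
  have "(\<integral>p. ?H p * \<Phi> ((left_shift ^^ (l + n)) p) \<partial>chain) = (\<integral>p. ?H p * ?\<Psi> ((left_shift ^^ l) p) \<partial>chain)"
    by (simp add: add.commute[of l n] funpow_add)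
  also have "\<dots> = (\<integral>x. d x * w x \<partial>leb01)"
    unfolding w_def by (rule key[OF \<Psi>m]) (use \<Psi>01 in auto)
  also have "\<dots> \<le> (\<integral>x. h x * (u x * w x) + \<delta> \<partial>leb01)"
  proof (rule integral_mono_AE)
    show "integrable leb01 (\<lambda>x. h x * (u x * w x) + \<delta>)"
      using mult_int[OF hu_int] by (simp add: mult.assoc)
    show "AE x in leb01. d x * w x \<le> h x * (u x * w x) + \<delta>" using pt by eventually_elim blast
  qed (rule mult_int[OF di])
  also have "\<dots> = (\<integral>x. h x * (u x * w x) \<partial>leb01) + \<delta>"
    using mult_int[OF hu_int] leb01.prob_space by (simp add: mult.assoc)
  also have "(\<integral>x. h x * (u x * w x) \<partial>leb01) = (\<integral>x. u x * w x \<partial>\<mu>)"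
    by (rule integral_\<mu>[symmetric]) (use um wm in measurable)
  also have "\<dots> = (\<integral>x. u x * (annealed_koopman M T ^^ n) g x \<partial>\<mu>)"
    by (intro Bochner_Integration.integral_cong refl) (simp add: wg space_\<mu>)
  also have "\<dots> \<le> (\<integral>x. u x \<partial>\<mu>) * (\<integral>x. g x \<partial>\<mu>) + C' * r ^ n * (2 * (?B / \<delta> + ?B * D / \<delta>\<^sup>2))"
    by (rule decay_real[OF u gm g01])
  also have "(\<integral>x. u x \<partial>\<mu>) * (\<integral>x. g x \<partial>\<mu>) \<le> (\<integral>p. ?H p \<partial>chain) * (\<integral>p. \<Phi> p \<partial>chain)"
  proof -
    have "(\<integral>x. u x \<partial>\<mu>) = (\<integral>x. h x * u x \<partial>leb01)" by (rule integral_\<mu>[OF um])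
    also have "\<dots> \<le> (\<integral>x. d x \<partial>leb01)"
      by (rule integral_mono_AE[OF hu_int di]) (use pt in \<open>auto elim: eventually_mono\<close>)
    also have "\<dots> = (\<integral>p. ?H p \<partial>chain)"
      using key[of "\<lambda>_. 1"] by (simp add: path_expectation_def noise.P.prob_space)
    finally have 1: "(\<integral>x. u x \<partial>\<mu>) \<le> (\<integral>p. ?H p \<partial>chain)" .
    have 2: "(\<integral>x. g x \<partial>\<mu>) = (\<integral>p. \<Phi> p \<partial>chain)"
      unfolding g_def by (rule chain_integral[where B=1, OF \<Phi>(1), symmetric]) (use \<Phi>(2) in auto)
    have 3: "0 \<le> (\<integral>x. g x \<partial>\<mu>)"
      by (rule Bochner_Integration.integral_nonneg) (use g01 space_\<mu> in auto)
    show ?thesis using mult_right_mono[OF 1 3] 2 by simp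
  qed
  finally show ?thesis by (simp add: decoupling_error_def)
qed

text \<open>Split off the first block and decouple it from the rest, which again is a function with values in
  \<open>[0,1]\<close> of the path after the gap.\<close>

lemma block_product_expectation:
  fixes l n K :: nat and v :: "int \<Rightarrow> real" and \<delta> :: real
  assumes v: "\<And>s. 0 \<le> v s \<and> v s \<le> 1" and \<delta>: "0 < \<delta>"
  defines "H \<equiv> grid_mixture \<psi> \<eta> Z l v"
  shows "(\<integral>p. (\<Prod>j<K. H ((left_shift ^^ (j * (l + n))) p)) \<partial>chain)
    \<le> (\<integral>p. H p \<partial>chain) ^ K + real K * decoupling_error l n \<delta>"
proof -
  let ?G = "\<lambda>K p. \<Prod>j<K. H ((left_shift ^^ (j * (l + n))) p)"
  let ?e = "decoupling_error l n \<delta>"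
  have Hm: "H \<in> borel_measurable path_space" unfolding H_def by (rule grid_mixture_measurable[OF \<psi>])
  have H: "0 \<le> H p \<and> H p \<le> 1" for p
    unfolding H_def by (rule grid_mixture_bounds[where \<psi>=\<psi>]) (rule partition, rule v)
  have Gm: "?G K \<in> borel_measurable path_space" for K
    by (intro borel_measurable_prod measurable_compose[OF measurable_left_shift_funpow Hm])
  have G: "0 \<le> ?G K p \<and> ?G K p \<le> 1" for K p
    using H by (intro conjI prod_nonneg prod_le_1) auto
  have Hi: "integrable chain H" by (rule chain.integrable_const_bound[of _ 1]) (use H Hm in \<open>auto cong: measurable_cong_sets\<close>)
  have IH0: "0 \<le> (\<integral>p. H p \<partial>chain)" using H by (intro Bochner_Integration.integral_nonneg) auto
  have "(\<integral>p. H p \<partial>chain) \<le> (\<integral>p. 1 \<partial>chain)" using Hi H by (intro integral_mono) auto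
  then have IH1: "(\<integral>p. H p \<partial>chain) \<le> 1" by (simp add: chain.prob_space)
  have e: "0 \<le> ?e"
    unfolding decoupling_error_def using \<delta> C' r D growth_nonneg by (intro add_nonneg_nonneg mult_nonneg_nonneg divide_nonneg_nonneg) auto
  show ?thesis
  proof (induction K)
    case 0
    then show ?case by (simp add: chain.prob_space)
  next
    case (Suc K)
    have "?G (Suc K) p = H p * ?G K ((left_shift ^^ (l + n)) p)" for p
      unfolding prod.lessThan_Suc_shift
      by (simp add: funpow_add[symmetric, THEN fun_cong, unfolded o_apply] add.commute)
    then have "(\<integral>p. ?G (Suc K) p \<partial>chain) = (\<integral>p. H p * ?G K ((left_shift ^^ (l + n)) p) \<partial>chain)" by simp
    also have "\<dots> \<le> (\<integral>p. H p \<partial>chain) * (\<integral>p. ?G K p \<partial>chain) + ?e"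
      unfolding H_def by (rule decoupling[OF v _ _ \<delta>]) (use Gm G in \<open>simp_all add: H_def\<close>)
    also have "\<dots> \<le> (\<integral>p. H p \<partial>chain) * ((\<integral>p. H p \<partial>chain) ^ K + real K * ?e) + ?e"
      using Suc IH0 by (intro add_right_mono mult_left_mono) auto
    also have "\<dots> = (\<integral>p. H p \<partial>chain) ^ Suc K + (\<integral>p. H p \<partial>chain) * (real K * ?e) + ?e"
      by (simp add: distrib_left)
    also have "\<dots> \<le> (\<integral>p. H p \<partial>chain) ^ Suc K + 1 * (real K * ?e) + ?e"
      using IH1 e by (intro add_right_mono add_left_mono mult_right_mono) auto
    finally show ?case by (simp add: algebra_simps)
  qed
qed

text \<open>The threshold \<open>c + \<eta>\<close> lies midway between \<open>c\<close> and \<open>c + 2 * \<eta>\<close>, and rounding shifts averages by at most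
  \<open>\<eta>\<close>. So the mixture of the indicator of rounded averages up to \<open>c + \<eta>\<close> equals \<open>1\<close> when a block fails to
  exceed \<open>c\<close>, and \<open>0\<close> when it exceeds \<open>c + 2 * \<eta>\<close>.\<close>

lemma prob_all_blocks_fail:
  fixes c \<delta> :: real and l n K :: nat
  assumes \<delta>: "0 < \<delta>"
  defines "p0 \<equiv> measure chain {p \<in> space chain. birkhoff_sum \<psi> l p > real l * (c + 2 * \<eta>)}"
  shows "measure chain {p \<in> space chain. \<forall>j<K. birkhoff_sum \<psi> l ((left_shift ^^ (j * (l + n))) p) \<le> real l * c}
    \<le> (1 - p0) ^ K + real K * decoupling_error l n \<delta>"
proof -
  define v :: "int \<Rightarrow> real" where "v s = (if \<eta> * of_int s \<le> real l * (c + \<eta>) then 1 else 0)" for s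
  have v: "0 \<le> v s \<and> v s \<le> 1" for s by (simp add: v_def)
  let ?H = "grid_mixture \<psi> \<eta> Z l v"
  let ?S = "birkhoff_sum \<psi> l"
  have Sm: "?S \<in> borel_measurable path_space" by (rule birkhoff_sum_measurable[OF \<psi>])
  have Hm: "?H \<in> borel_measurable path_space" by (rule grid_mixture_measurable[OF \<psi>])
  have H: "0 \<le> ?H p \<and> ?H p \<le> 1" for p
    by (rule grid_mixture_bounds[where \<psi>=\<psi>]) (rule partition, rule v)
  have H1: "?H p = 1" if S: "?S p \<le> real l * c" for p
  proof (rule grid_mixture_eqI[where \<psi>=\<psi> and \<eta>=\<eta>])
    fix s assume "\<bar>\<eta> * of_int s - ?S p\<bar> \<le> real l * \<eta>"
    then have "\<eta> * of_int s \<le> real l * c + real l * \<eta>" using S by linarith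
    then show "v s = 1" by (simp add: v_def distrib_left)
  qed (rule partition, rule \<eta>)
  have H0: "?H p = 0" if S: "?S p > real l * (c + 2 * \<eta>)" for p
  proof (rule grid_mixture_eqI[where \<psi>=\<psi> and \<eta>=\<eta>])
    fix s assume "\<bar>\<eta> * of_int s - ?S p\<bar> \<le> real l * \<eta>"
    moreover have "real l * (c + 2 * \<eta>) = real l * (c + \<eta>) + real l * \<eta>" by (simp add: algebra_simps)
    ultimately have "\<eta> * of_int s > real l * (c + \<eta>)" using S by linarith
    then show "v s = 0" by (simp add: v_def)
  qed (rule partition, rule \<eta>)
  define A where "A = {p \<in> space chain. ?S p > real l * (c + 2 * \<eta>)}"
  have A: "A \<in> sets chain" unfolding A_def using Sm by measurable
  have HA: "?H p \<le> 1 - indicator A p" for p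
  proof (cases "p \<in> A")
    case True
    then have "?H p = 0" by (intro H0) (simp add: A_def)
    then show ?thesis by (simp add: indicator_def)
  next
    case False
    then show ?thesis using H[of p] by simp
  qed
  have Hi: "integrable chain ?H" by (rule chain.integrable_const_bound[of _ 1]) (use H Hm in \<open>auto cong: measurable_cong_sets\<close>)
  have Ai: "integrable chain (indicator A :: _ \<Rightarrow> real)"
    using A by (intro integrable_real_indicator) (simp_all add: less_top[symmetric])
  have "(\<integral>p. ?H p \<partial>chain) \<le> (\<integral>p. 1 - indicator A p \<partial>chain)"
    by (rule integral_mono[OF Hi _ HA]) (use Ai in simp)
  also have "\<dots> = (\<integral>p. 1 \<partial>chain) - (\<integral>p. indicator A p \<partial>chain)"
    by (rule Bochner_Integration.integral_diff) (use Ai in simp_all)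
  also have "\<dots> = 1 - p0" using A unfolding p0_def A_def[symmetric] by simp
  finally have IH: "(\<integral>p. ?H p \<partial>chain) \<le> 1 - p0" .
  have IH0: "0 \<le> (\<integral>p. ?H p \<partial>chain)" using H by (intro Bochner_Integration.integral_nonneg) auto
  define F where "F = {p \<in> space chain. \<forall>j<K. ?S ((left_shift ^^ (j * (l + n))) p) \<le> real l * c}"
  let ?G = "\<lambda>p. \<Prod>j<K. ?H ((left_shift ^^ (j * (l + n))) p)"
  have Sj: "(\<lambda>p. ?S ((left_shift ^^ (j * (l + n))) p)) \<in> borel_measurable chain" for j
    using measurable_compose[OF measurable_left_shift_funpow Sm] by (simp cong: measurable_cong_sets)
  have F: "F \<in> sets chain" unfolding F_def using Sj by measurable
  have Gm: "?G \<in> borel_measurable path_space"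
    by (intro borel_measurable_prod measurable_compose[OF measurable_left_shift_funpow Hm])
  have G: "0 \<le> ?G p \<and> ?G p \<le> 1" for p
    using H by (intro conjI prod_nonneg prod_le_1) auto
  have Gi: "integrable chain ?G" by (rule chain.integrable_const_bound[of _ 1]) (use G Gm in \<open>auto cong: measurable_cong_sets\<close>)
  have Fi: "integrable chain (indicator F :: _ \<Rightarrow> real)"
    using F by (intro integrable_real_indicator) (simp_all add: less_top[symmetric])
  have FG: "indicator F p \<le> ?G p" for p
  proof (cases "p \<in> F")
    case True
    then have "?G p = 1" by (intro prod.neutral ballI H1) (simp add: F_def)
    then show ?thesis by (simp add: indicator_def)
  next
    case False
    then have "indicator F p = (0::real)" by simp
    then show ?thesis using G[of p] by linarith
  qed
  have "measure chain F = (\<integral>p. indicator F p \<partial>chain)" using F by simp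
  also have "\<dots> \<le> (\<integral>p. ?G p \<partial>chain)"
    by (rule integral_mono[OF Fi Gi FG])
  also have "\<dots> \<le> (\<integral>p. ?H p \<partial>chain) ^ K + real K * decoupling_error l n \<delta>"
    by (rule block_product_expectation[OF v \<delta>])
  also have "\<dots> \<le> (1 - p0) ^ K + real K * decoupling_error l n \<delta>"
    using IH IH0 by (intro add_right_mono power_mono) auto
  finally show ?thesis unfolding F_def .
qed

end

section \<open>Almost sure bounds on window averages\<close>

text \<open>A strictly convex function that vanishes at \<open>0\<close> and is non-negative lies strictly below its chords from
  \<open>0\<close>.\<close>

lemma rate_strict_mono:
  assumes rate: "annealed_rate_function \<nu> \<phi> J I" and t: "t \<in> J" and st: "0 < s" "s < t"
  shows "s \<in> J" "I s < I t"
proof -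
  have int: "is_interval J" and 0: "0 \<in> J"
    and nn: "\<And>s. s \<in> J \<Longrightarrow> 0 \<le> I s \<and> (I s = 0 \<longleftrightarrow> s = 0)"
    and conv: "\<And>s t u. s \<in> J \<Longrightarrow> t \<in> J \<Longrightarrow> s \<noteq> t \<Longrightarrow> u \<in> {0<..<1} \<Longrightarrow>
      I ((1 - u) * s + u * t) < (1 - u) * I s + u * I t"
    using rate unfolding annealed_rate_function_def by blast+
  show "s \<in> J"
    using st by (intro mem_is_interval_1_I[OF int 0 t]) auto
  have u: "s / t \<in> {0<..<1}" using st by simp
  have "I ((1 - s / t) * 0 + s / t * t) < (1 - s / t) * I 0 + s / t * I t"
    using st by (intro conv 0 t u) auto
  then have "I s < s / t * I t" using nn[OF 0] st by simp
  also have "\<dots> \<le> 1 * I t" using u nn[OF t] by (intro mult_right_mono) auto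
  finally show "I s < I t" by simp
qed

lemma large_deviation_bounds:
  assumes rate: "annealed_rate_function \<nu> \<phi> J I" and \<epsilon>: "\<epsilon> \<in> J" "0 < \<epsilon>" and \<kappa>: "0 < \<kappa>"
  defines "P \<equiv> \<lambda>n. measure \<nu> {x \<in> space \<nu>. birkhoff_sum \<phi> n x > real n * \<epsilon>}"
  shows "eventually (\<lambda>n. P n \<le> exp (- real n * (I \<epsilon> - \<kappa>)) \<and> exp (- real n * (I \<epsilon> + \<kappa>)) \<le> P n) sequentially"
proof -
  have lim: "(\<lambda>n. 1 / real n * ln (P n)) \<longlonglongrightarrow> - I \<epsilon>" and "0 \<le> I \<epsilon>" "I \<epsilon> \<noteq> 0"
    using rate \<epsilon> unfolding annealed_rate_function_def P_def by auto
  then have pos: "0 < I \<epsilon>" by simp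
  have 1: "eventually (\<lambda>n. 1 / real n * ln (P n) < - I \<epsilon> + \<kappa>) sequentially"
    using \<kappa> by (intro order_tendstoD(2)[OF lim]) simp
  have 2: "eventually (\<lambda>n. 1 / real n * ln (P n) < 0) sequentially"
    using pos by (intro order_tendstoD(2)[OF lim]) simp
  have 3: "eventually (\<lambda>n. - I \<epsilon> - \<kappa> < 1 / real n * ln (P n)) sequentially"
    using \<kappa> by (intro order_tendstoD(1)[OF lim]) simp
  from 1 2 3 eventually_gt_at_top[of 0] show ?thesis
  proof eventually_elim
    case (elim n)
    \<comment> \<open>a zero probability would make the normalised logarithm equal to zero\<close>
    have "P n \<noteq> 0" using elim(2) by auto
    moreover have "0 \<le> P n" by (simp add: P_def)
    ultimately have P: "P n = exp (ln (P n))" by simp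
    have "ln (P n) \<le> real n * (- I \<epsilon> + \<kappa>)" "real n * (- I \<epsilon> - \<kappa>) \<le> ln (P n)"
      using elim by (simp_all add: field_simps)
    then have a: "ln (P n) \<le> - real n * (I \<epsilon> - \<kappa>)" and b: "- real n * (I \<epsilon> + \<kappa>) \<le> ln (P n)"
      by (simp_all add: algebra_simps)
    have "exp (ln (P n)) \<le> exp (- real n * (I \<epsilon> - \<kappa>))" "exp (- real n * (I \<epsilon> + \<kappa>)) \<le> exp (ln (P n))"
      using a b by (simp_all only: exp_le_cancel_iff)
    then show ?case using P by simp
  qed
qed

lemma summable_exp_neg:
  assumes "0 < \<theta>"
  shows "summable (\<lambda>n. c * exp (- real n * \<theta>))"
proof -
  have "exp (- real n * \<theta>) = exp (- \<theta>) ^ n" for n by (simp add: exp_of_nat_mult[symmetric])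
  moreover have "summable (\<lambda>n. exp (- \<theta>) ^ n)" using assms by (intro summable_geometric) simp
  ultimately show ?thesis by (simp add: summable_mult)
qed

context stationary_chain
begin

text \<open>For fixed \<open>l\<close> one union bound treats all starting points \<open>m\<close> up to \<open>exp ((l + 1) * I \<alpha>)\<close>, which are
  the ones relevant for the \<open>n\<close> with window \<open>l\<close>. Since \<open>I \<beta> > I \<alpha>\<close>, the bounds decay exponentially in \<open>l\<close>
  and the Borel-Cantelli lemma applies. Bounds for each \<open>n\<close> separately would only be a small negative
  power of \<open>n\<close>, which need not be summable.\<close>

lemma AE_upper_bound:
  assumes \<phi>: "\<phi> \<in> borel_measurable leb01"
    and rate: "annealed_rate_function chain \<phi> J I"
    and \<alpha>: "0 < \<alpha>" "\<alpha> < \<beta>" and \<beta>: "\<beta> \<in> J"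
  shows "AE p in chain. eventually (\<lambda>l. \<forall>m. real m \<le> exp (real (Suc l) * I \<alpha>) \<longrightarrow>
    birkhoff_sum \<phi> l ((left_shift ^^ m) p) \<le> real l * \<beta>) sequentially"
proof -
  define a where "a = I \<alpha>"
  define \<kappa> where "\<kappa> = (I \<beta> - a) / 2"
  have \<alpha>J: "\<alpha> \<in> J" and ab: "a < I \<beta>" unfolding a_def by (rule rate_strict_mono[OF rate \<beta> \<alpha>])+
  have "0 \<le> a" using rate \<alpha>J unfolding annealed_rate_function_def a_def by blast
  have \<kappa>: "0 < \<kappa>" using ab by (simp add: \<kappa>_def)
  define N where "N l = nat \<lfloor>exp (real (Suc l) * a)\<rfloor>" for l
  define P where "P l = measure chain {p \<in> space chain. birkhoff_sum \<phi> l p > real l * \<beta>}" for l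
  define B where "B l m = {p \<in> space path_space. birkhoff_sum \<phi> l ((left_shift ^^ m) p) > real l * \<beta>}" for l m
  define A where "A l = (\<Union>m\<le>N l. B l m)" for l
  have Sm: "birkhoff_sum \<phi> l \<in> borel_measurable path_space" for l by (rule birkhoff_sum_measurable[OF \<phi>])
  have B0: "{p \<in> space path_space. birkhoff_sum \<phi> l p > real l * \<beta>} \<in> sets path_space" for l
    using Sm[of l] by measurable
  have B: "B l m \<in> sets path_space" for l m
  proof -
    have [measurable]: "(\<lambda>p. birkhoff_sum \<phi> l ((left_shift ^^ m) p)) \<in> borel_measurable path_space"
      by (rule measurable_compose[OF measurable_left_shift_funpow Sm])
    show ?thesis unfolding B_def by measurable
  qed
  then have A: "A l \<in> sets chain" for l unfolding A_def by simp
  have PB: "measure chain (B l m) = P l" for l m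
    unfolding B_def P_def using measure_chain_shift[OF B0, of l m] by simp
  have "eventually (\<lambda>l. measure chain (A l) \<le> 2 * exp a * exp (- real l * \<kappa>)) sequentially"
    using large_deviation_bounds[OF rate \<beta> _ \<kappa>, folded P_def] \<alpha>
  proof (simp, elim eventually_mono)
    fix l assume l: "P l \<le> exp (- (real l * (I \<beta> - \<kappa>))) \<and> exp (- (real l * (I \<beta> + \<kappa>))) \<le> P l"
    have "measure chain (A l) \<le> (\<Sum>m\<le>N l. measure chain (B l m))"
      unfolding A_def using B by (intro measure_UNION_le) auto
    also have "\<dots> = real (Suc (N l)) * P l" by (simp add: PB)
    also have "\<dots> \<le> (2 * exp (real (Suc l) * a)) * exp (- (real l * (I \<beta> - \<kappa>)))"
    proof (intro mult_mono)
      have "real (N l) \<le> exp (real (Suc l) * a)" unfolding N_def by simp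
      moreover have "1 \<le> exp (real (Suc l) * a)" using \<open>0 \<le> a\<close> by simp
      ultimately show "real (Suc (N l)) \<le> 2 * exp (real (Suc l) * a)"
        unfolding of_nat_Suc[of "N l"] by linarith
    qed (use l in \<open>auto simp: P_def\<close>)
    also have "\<dots> = 2 * exp (real (Suc l) * a + - (real l * (I \<beta> - \<kappa>)))" by (simp only: exp_add mult.assoc)
    also have "real (Suc l) * a + - (real l * (I \<beta> - \<kappa>)) = a + - real l * \<kappa>"
      by (simp add: \<kappa>_def field_simps)
    also have "2 * exp (a + - real l * \<kappa>) = 2 * exp a * exp (- real l * \<kappa>)" by (simp only: exp_add mult.assoc)
    finally show "measure chain (A l) \<le> 2 * exp a * exp (- (real l * \<kappa>))" by simp
  qed
  then have "summable (\<lambda>l. measure chain (A l))"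
    by (intro summable_comparison_test_ev[OF _ summable_exp_neg[OF \<kappa>]]) (auto elim: eventually_mono)
  then have "AE p in chain. eventually (\<lambda>l. p \<in> space chain - A l) sequentially"
    using A by (intro borel_cantelli_AE1) (simp_all add: less_top[symmetric])
  then show ?thesis
  proof eventually_elim
    case (elim p)
    then show ?case
    proof eventually_elim
      case (elim l)
      show ?case
      proof (intro allI impI)
        fix m :: nat assume "real m \<le> exp (real (Suc l) * I \<alpha>)"
        then have "m \<le> N l" unfolding N_def a_def by (simp add: le_nat_floor)
        then have "p \<notin> B l m" using elim by (auto simp: A_def)
        then show "birkhoff_sum \<phi> l ((left_shift ^^ m) p) \<le> real l * \<beta>"
          using elim by (auto simp: B_def)
      qed
    qed
  qed
qed

end

context observed_chain
begin

text \<open>Place blocks of length \<open>l\<close> with gaps \<open>k * l\<close> into the first \<open>exp (l * I \<alpha>)\<close> times. There are about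
  \<open>exp (l * I \<alpha>) / ((k + 1) * l)\<close> of them, and each exceeds \<open>\<gamma>\<close> with probability roughly
  \<open>exp (- l * I (\<gamma> + 2 * \<eta>))\<close> or more. As \<open>I (\<gamma> + 2 * \<eta>) < I \<alpha>\<close>, the expected number of successes grows
  exponentially, so that independent blocks would all fail with super-exponentially small probability.
  Decoupling costs an error per block, and the choices of \<open>k\<close> and \<open>\<delta>\<close> make it smaller than the inverse of
  the number of blocks by a factor \<open>exp (- l)\<close>.\<close>

lemma AE_lower_bound:
  assumes rate: "annealed_rate_function chain \<psi> J I"
    and \<alpha>: "\<alpha> \<in> J" "0 < \<gamma>" "\<gamma> + 2 * \<eta> < \<alpha>"
  shows "AE p in chain. eventually (\<lambda>l. \<exists>m. real (m + l) \<le> exp (real l * I \<alpha>) \<and>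
    birkhoff_sum \<psi> l ((left_shift ^^ m) p) > real l * \<gamma>) sequentially"
proof -
  define a where "a = I \<alpha>"
  define a' where "a' = I (\<gamma> + 2 * \<eta>)"
  define \<theta> where "\<theta> = (a - a') / 2"
  have g0: "0 < \<gamma> + 2 * \<eta>" using \<alpha> \<eta> by simp
  have J': "\<gamma> + 2 * \<eta> \<in> J" by (rule rate_strict_mono(1)[OF rate \<alpha>(1) g0 \<alpha>(3)])
  have aa': "a' < a" unfolding a_def a'_def by (rule rate_strict_mono(2)[OF rate \<alpha>(1) g0 \<alpha>(3)])
  have \<theta>: "0 < \<theta>" using aa' by (simp add: \<theta>_def)
  have "0 \<le> a'" using rate J' unfolding annealed_rate_function_def a'_def by blast
  then have a: "0 < a" using aa' by simp
  define P where "P l = measure chain {p \<in> space chain. birkhoff_sum \<psi> l p > real l * (\<gamma> + 2 * \<eta>)}" for l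
  \<comment> \<open>\<open>k\<close> is so large that mixing over the gap beats the growth of the densities, the factor
    \<open>exp (2 * l * (a + 1))\<close> from \<open>1 / \<delta>\<^sup>2\<close>, and one more such factor that brings the error down to \<open>\<delta>\<close>\<close>
  define G where "G = max growth 1"
  have G: "1 \<le> G" "growth \<le> G" by (simp_all add: G_def)
  have "(\<lambda>k. r ^ k * (G * exp (3 * (a + 1)))) \<longlonglongrightarrow> 0 * (G * exp (3 * (a + 1)))"
    using r by (intro tendsto_mult LIMSEQ_power_zero tendsto_const) auto
  then have "eventually (\<lambda>k. r ^ k * (G * exp (3 * (a + 1))) < 1) sequentially"
    by (intro order_tendstoD(2)) auto
  then obtain k where k: "r ^ k * (G * exp (3 * (a + 1))) < 1" by (auto simp: eventually_sequentially)
  \<comment> \<open>at most \<open>exp (l * a)\<close> blocks share the error, so their total is of order \<open>exp (- l)\<close>\<close>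
  define \<delta> where "\<delta> l = exp (- real l * (a + 1))" for l
  define c where "c = 1 + C' * (2 * (2 * D + 2 * D * D))"
  have c: "0 \<le> c" using C' D by (simp add: c_def)
  have err: "decoupling_error l (k * l) (\<delta> l) \<le> c * \<delta> l" for l
  proof -
    define e where "e = exp (real l * (a + 1))"
    have e: "0 < e" "1 \<le> e" using a by (auto simp: e_def)
    have \<delta>e: "\<delta> l = 1 / e" by (simp add: \<delta>_def e_def exp_minus inverse_eq_divide)
    have gr: "growth ^ l \<le> G ^ l" using G(2) growth_nonneg by (rule power_mono)
    have "growth ^ l * (2 * D) / \<delta> l + growth ^ l * (2 * D) * D / (\<delta> l)\<^sup>2
        = growth ^ l * (2 * D * e + 2 * D * D * e\<^sup>2)"
      using e by (simp add: \<delta>e field_simps)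
    also have "\<dots> \<le> G ^ l * (2 * D * e\<^sup>2 + 2 * D * D * e\<^sup>2)"
    proof (rule mult_mono[OF gr])
      have "e \<le> e\<^sup>2" using e(2) by (simp add: power2_eq_square)
      then show "2 * D * e + 2 * D * D * e\<^sup>2 \<le> 2 * D * e\<^sup>2 + 2 * D * D * e\<^sup>2" using D by simp
      show "0 \<le> G ^ l" using G(1) by simp
      show "0 \<le> 2 * D * e + 2 * D * D * e\<^sup>2" using D e by simp
    qed
    also have "\<dots> = (G ^ l * e\<^sup>2) * (2 * D + 2 * D * D)" by (simp add: algebra_simps)
    finally have 1: "growth ^ l * (2 * D) / \<delta> l + growth ^ l * (2 * D) * D / (\<delta> l)\<^sup>2
      \<le> (G ^ l * e\<^sup>2) * (2 * D + 2 * D * D)" .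
    have e3: "e ^ 3 = exp (3 * (a + 1)) ^ l"
      unfolding e_def exp_of_nat_mult[symmetric] by (simp add: algebra_simps)
    have "r ^ (k * l) * G ^ l * e\<^sup>2 = (r ^ k * (G * exp (3 * (a + 1)))) ^ l * \<delta> l"
    proof -
      have "(r ^ k * (G * exp (3 * (a + 1)))) ^ l = r ^ (k * l) * (G ^ l * e ^ 3)"
        by (simp only: power_mult_distrib e3 power_mult)
      then show ?thesis using e by (simp add: \<delta>e power2_eq_square power3_eq_cube)
    qed
    also have "\<dots> \<le> 1 * \<delta> l"
    proof (rule mult_right_mono)
      show "(r ^ k * (G * exp (3 * (a + 1)))) ^ l \<le> 1"
        using k r G by (intro power_le_one) auto
    qed (simp add: \<delta>_def)
    finally have 2: "r ^ (k * l) * G ^ l * e\<^sup>2 \<le> \<delta> l" by simp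
    have "C' * r ^ (k * l) * (2 * (growth ^ l * (2 * D) / \<delta> l + growth ^ l * (2 * D) * D / (\<delta> l)\<^sup>2))
      \<le> C' * r ^ (k * l) * (2 * ((G ^ l * e\<^sup>2) * (2 * D + 2 * D * D)))"
      using 1 C' r by (intro mult_left_mono) auto
    also have "\<dots> = (r ^ (k * l) * G ^ l * e\<^sup>2) * (C' * (2 * (2 * D + 2 * D * D)))" by (simp add: algebra_simps)
    also have "\<dots> \<le> \<delta> l * (C' * (2 * (2 * D + 2 * D * D)))"
      using 2 C' D by (intro mult_right_mono) auto
    finally show ?thesis unfolding decoupling_error_def c_def by (simp add: algebra_simps)
  qed
  define q where "q l = l + k * l" for l
  define K where "K l = nat \<lfloor>exp (real l * a) / real (q l)\<rfloor>" for l
  define F where "F l = {p \<in> space chain. \<forall>j<K l. birkhoff_sum \<psi> l ((left_shift ^^ (j * q l)) p) \<le> real l * \<gamma>}" for l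
  have F: "F l \<in> sets chain" for l
  proof -
    have "(\<lambda>p. birkhoff_sum \<psi> l ((left_shift ^^ (j * q l)) p)) \<in> borel_measurable chain" for j
      using measurable_compose[OF measurable_left_shift_funpow birkhoff_sum_measurable[OF \<psi>]] by (simp cong: measurable_cong_sets)
    then show ?thesis unfolding F_def by measurable
  qed
  have growth_ev: "eventually (\<lambda>l. exp (real l * \<theta>) \<ge> real l * real (q l)) sequentially"
  proof -
    have "filterlim (\<lambda>l. real l * (\<theta> / 4)) at_top sequentially"
      using \<theta> by (intro filterlim_at_top_mult_tendsto_pos[OF tendsto_const] filterlim_real_sequentially) auto
    then have "eventually (\<lambda>l. sqrt (real (1 + k)) / (\<theta> / 4) \<le> real l * (\<theta> / 4)) sequentially"
      by (simp only: filterlim_at_top)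
    then show ?thesis
    proof eventually_elim
      case (elim l)
      \<comment> \<open>a quarter of the exponent: \<open>exp (l * \<theta>)\<close> has to beat the square of a multiple of \<open>l\<close>, and
        \<open>exp (2 * t)\<close>, its square root, beats \<open>t\<^sup>2\<close>\<close>
      define t where "t = real l * (\<theta> / 4)"
      have t: "0 \<le> t" using \<theta> by (simp add: t_def)
      have "real l * sqrt (real (1 + k)) = sqrt (real (1 + k)) / (\<theta> / 4) * t"
        using \<theta> by (simp add: t_def)
      also have "\<dots> \<le> t * t" using elim t unfolding t_def[symmetric] by (rule mult_right_mono)
      also have "\<dots> \<le> exp t * exp t"
      proof (intro mult_mono t)
        show "t \<le> exp t" "t \<le> exp t" using exp_ge_add_one_self[of t] by linarith+
      qed simp
      finally have x: "real l * sqrt (real (1 + k)) \<le> exp (2 * t)" by (simp add: mult_exp_exp)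
      have "real l * real (q l) = (real l * sqrt (real (1 + k)))\<^sup>2"
        by (simp add: q_def power_mult_distrib algebra_simps power2_eq_square)
      also have "\<dots> \<le> (exp (2 * t))\<^sup>2" using x by (intro power_mono) auto
      also have "\<dots> = exp (real l * \<theta>)" by (simp add: exp_double[symmetric] t_def)
      finally show ?case .
    qed
  qed
  have bound: "eventually (\<lambda>l. measure chain (F l) \<le> (exp 1 + c) * exp (- real l * 1)) sequentially"
    using large_deviation_bounds[OF rate J' g0 \<theta>, folded P_def] growth_ev eventually_ge_at_top[of 1]
  proof (eventually_elim)
    case (elim l)
    have "1 \<le> q l" unfolding q_def using elim(3) by (rule trans_le_add1)
    then have q1: "1 \<le> real (q l)" by simp
    define x where "x = exp (real l * a) / real (q l)"
    have x0: "0 \<le> x" by (simp add: x_def)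
    have Kx: "real (K l) \<le> x" "x - 1 \<le> real (K l)"
      unfolding K_def x_def[symmetric] using x0 by linarith+
    have P01: "0 \<le> P l" "P l \<le> 1" by (simp_all add: P_def)
    have "measure chain (F l) \<le> (1 - P l) ^ K l + real (K l) * decoupling_error l (k * l) (\<delta> l)"
      unfolding F_def P_def q_def by (rule prob_all_blocks_fail) (simp add: \<delta>_def)
    also have "(1 - P l) ^ K l \<le> exp 1 * exp (- real l)"
    proof -
      have "(1 - P l) ^ K l \<le> exp (- P l) ^ K l"
        using P01 exp_ge_add_one_self[of "- P l"] by (intro power_mono) auto
      also have "\<dots> = exp (- (real (K l) * P l))" by (simp add: exp_of_nat_mult[symmetric])
      also have "\<dots> \<le> exp (1 - real l)"
      proof -
        have "real l \<le> exp (real l * \<theta>) / real (q l)" using elim(2) q1 by (simp add: le_divide_eq)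
        also have "\<dots> = x * exp (- real l * (a' + \<theta>))"
        proof -
          have "real l * \<theta> = real l * a + - real l * (a' + \<theta>)" by (simp add: \<theta>_def field_simps)
          then have "exp (real l * \<theta>) = exp (real l * a) * exp (- real l * (a' + \<theta>))" by (simp only: exp_add)
          then show ?thesis by (simp add: x_def)
        qed
        also have "\<dots> \<le> x * P l" using elim(1) x0 by (intro mult_left_mono) (auto simp: a'_def)
        also have "\<dots> \<le> (real (K l) + 1) * P l" using Kx P01 by (intro mult_right_mono) auto
        also have "\<dots> \<le> real (K l) * P l + 1" using P01 by (simp add: distrib_right)
        finally show ?thesis by simp
      qed
      also have "\<dots> = exp 1 * exp (- real l)" by (simp add: exp_diff exp_minus divide_inverse)
      finally show ?thesis .
    qed
    also have "real (K l) * decoupling_error l (k * l) (\<delta> l) \<le> c * exp (- real l)"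
    proof -
      have "x \<le> exp (real l * a)" unfolding x_def using q1 by (simp add: divide_le_eq)
      then have Ke: "real (K l) \<le> exp (real l * a)" using Kx by linarith
      have "real (K l) * decoupling_error l (k * l) (\<delta> l) \<le> real (K l) * (c * \<delta> l)"
        by (intro mult_left_mono err) simp
      also have "\<dots> \<le> exp (real l * a) * (c * \<delta> l)"
        using Ke c by (intro mult_right_mono) (auto simp: \<delta>_def)
      also have "\<dots> = c * exp (real l * a + - real l * (a + 1))" by (simp only: \<delta>_def exp_add mult_ac)
      also have "real l * a + - real l * (a + 1) = - real l" by (simp add: algebra_simps)
      finally show ?thesis .
    qed
    finally show ?case by (simp add: distrib_right)
  qed
  have "summable (\<lambda>l. measure chain (F l))"
    by (rule summable_comparison_test_ev[OF _ summable_exp_neg[OF zero_less_one]])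
       (use bound in \<open>auto elim: eventually_mono\<close>)
  then have "AE p in chain. eventually (\<lambda>l. p \<in> space chain - F l) sequentially"
    using F by (intro borel_cantelli_AE1) (simp_all add: less_top[symmetric])
  then show ?thesis
  proof eventually_elim
    case (elim p)
    then show ?case using eventually_ge_at_top[of 1]
    proof eventually_elim
      case (elim l)
      then obtain j where j: "j < K l" "birkhoff_sum \<psi> l ((left_shift ^^ (j * q l)) p) > real l * \<gamma>"
        by (auto simp: F_def not_le)
      have "1 \<le> q l" unfolding q_def using elim(2) by (rule trans_le_add1)
      then have q1: "1 \<le> real (q l)" by simp
      have lq: "l \<le> q l" by (simp add: q_def)
      have "j * q l + l \<le> Suc j * q l" using lq by simp
      also have "\<dots> \<le> K l * q l" using j(1) by (intro mult_right_mono) auto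
      finally have "real (j * q l + l) \<le> real (K l * q l)" by (simp only: of_nat_le_iff)
      also have "\<dots> = real (K l) * real (q l)" by simp
      also have "\<dots> \<le> exp (real l * a) / real (q l) * real (q l)"
      proof (rule mult_right_mono)
        show "real (K l) \<le> exp (real l * a) / real (q l)" unfolding K_def by simp
      qed simp
      also have "\<dots> = exp (real l * a)" using q1 by simp
      finally show ?case using j(2) unfolding a_def by blast
    qed
  qed
qed

end

section \<open>The limit of the window maxima\<close>

text \<open>If \<open>l\<close> is the window of \<open>n\<close>, then \<open>exp (l * I \<alpha>) \<le> n \<le> exp ((l + 1) * I \<alpha>)\<close>. Bounds for all large \<open>l\<close> at
  these two horizons therefore give bounds for all large \<open>n\<close>.\<close>

lemma window_maximum_tendsto:
  fixes S :: "nat \<Rightarrow> nat \<Rightarrow> real" and \<beta> \<gamma> :: "nat \<Rightarrow> real"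
  assumes pos: "0 < I \<alpha>"
    and upper: "\<And>k. eventually (\<lambda>l. \<forall>m. real m \<le> exp (real (Suc l) * I \<alpha>) \<longrightarrow> S l m \<le> real l * \<beta> k) sequentially"
    and lower: "\<And>k. eventually (\<lambda>l. \<exists>m. real (m + l) \<le> exp (real l * I \<alpha>) \<and> S l m > real l * \<gamma> k) sequentially"
    and lim: "\<beta> \<longlonglongrightarrow> \<alpha>" "\<gamma> \<longlonglongrightarrow> \<alpha>"
  shows "(\<lambda>n. MAX m\<in>{0..n - window I \<alpha> n}. S (window I \<alpha> n) m / real (window I \<alpha> n)) \<longlonglongrightarrow> \<alpha>"
proof -
  let ?w = "window I \<alpha>"
  have w_top: "filterlim ?w at_top sequentially"
    unfolding filterlim_at_top
  proof
    fix L :: nat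
    have "eventually (\<lambda>n. exp (real L * I \<alpha>) \<le> real n) sequentially"
      using filterlim_real_sequentially by (simp add: filterlim_at_top)
    then show "eventually (\<lambda>n. L \<le> ?w n) sequentially"
    proof eventually_elim
      case (elim n)
      have "0 < real n" by (rule less_le_trans[OF exp_gt_zero elim])
      then have "real L * I \<alpha> \<le> ln (real n)" using elim by (simp only: ln_ge_iff)
      then have "real L \<le> ln (real n) / I \<alpha>" using pos by (simp add: le_divide_eq)
      then show ?case unfolding window_def by (rule le_nat_floor)
    qed
  qed
  have w_bounds: "eventually (\<lambda>n. exp (real (?w n) * I \<alpha>) \<le> real n \<and> real n \<le> exp (real (Suc (?w n)) * I \<alpha>)) sequentially"
    using eventually_ge_at_top[of 1]
  proof eventually_elim
    case (elim n)
    then have n: "0 < real n" "0 \<le> ln (real n) / I \<alpha>" using pos by simp_all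
    have "real (?w n) \<le> ln (real n) / I \<alpha>" "ln (real n) / I \<alpha> \<le> real (Suc (?w n))"
      unfolding window_def using n(2) by linarith+
    then have "real (?w n) * I \<alpha> \<le> ln (real n)" "ln (real n) \<le> real (Suc (?w n)) * I \<alpha>"
      using pos by (simp_all only: pos_le_divide_eq pos_divide_le_eq)
    then have "exp (real (?w n) * I \<alpha>) \<le> exp (ln (real n))" "exp (ln (real n)) \<le> exp (real (Suc (?w n)) * I \<alpha>)"
      by (simp_all only: exp_le_cancel_iff)
    then show ?case using n by simp
  qed
  note w_ev = filterlim_iff[THEN iffD1, OF w_top, rule_format]
  have wpos: "eventually (\<lambda>n. 0 < ?w n) sequentially" by (rule w_ev[OF eventually_gt_at_top])
  show ?thesis
  proof (rule order_tendstoI)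
    fix y assume "\<alpha> < y"
    then have "eventually (\<lambda>k. \<beta> k < y) sequentially" by (rule order_tendstoD(2)[OF lim(1)])
    then obtain k where k: "\<beta> k < y" by (auto simp: eventually_sequentially)
    from w_ev[OF upper[of k]] w_bounds wpos
    show "eventually (\<lambda>n. (MAX m\<in>{0..n - ?w n}. S (?w n) m / real (?w n)) < y) sequentially"
    proof eventually_elim
      case (elim n)
      have "S (?w n) m / real (?w n) < y" if "m \<in> {0..n - ?w n}" for m
      proof -
        have "real m \<le> real n" using that by simp
        then have "real m \<le> exp (real (Suc (?w n)) * I \<alpha>)" using elim(2) by linarith
        then have "S (?w n) m \<le> real (?w n) * \<beta> k" using elim(1) by blast
        then have "S (?w n) m / real (?w n) \<le> \<beta> k" using elim(3) by (simp add: divide_le_eq mult.commute)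
        then show ?thesis using k by simp
      qed
      then show ?case by (subst Max_less_iff) auto
    qed
  next
    fix y assume "y < \<alpha>"
    then have "eventually (\<lambda>k. y < \<gamma> k) sequentially" by (rule order_tendstoD(1)[OF lim(2)])
    then obtain k where k: "y < \<gamma> k" by (auto simp: eventually_sequentially)
    from w_ev[OF lower[of k]] w_bounds wpos
    show "eventually (\<lambda>n. y < (MAX m\<in>{0..n - ?w n}. S (?w n) m / real (?w n))) sequentially"
    proof eventually_elim
      case (elim n)
      then obtain m where m: "real (m + ?w n) \<le> exp (real (?w n) * I \<alpha>)" "S (?w n) m > real (?w n) * \<gamma> k" by blast
      then have "real (m + ?w n) \<le> real n" using elim(2) by linarith
      then have mn: "m \<in> {0..n - ?w n}" by simp
      have "y < \<gamma> k" by (rule k)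
      also have "\<dots> < S (?w n) m / real (?w n)" using m(2) elim(3) by (simp add: less_divide_eq mult.commute)
      also have "\<dots> \<le> (MAX m\<in>{0..n - ?w n}. S (?w n) m / real (?w n))" using mn by (intro Max_ge) auto
      finally show ?case .
    qed
  qed
qed

theorem theorem6p3:
  fixes M :: "'a measure" and T :: "'a \<Rightarrow> real \<Rightarrow> real" and \<mu> :: "real measure"
    and \<phi> :: "real \<Rightarrow> real" and J :: "real set" and I :: "real \<Rightarrow> real" and \<alpha> :: real
  assumes "random_system M T"
    and "BV_bounded_operator (annealed_transfer M T)"
    and "lasota_yorke (annealed_transfer M T)"
    and "spectral_gap_at_1 (annealed_transfer M T)"
    and "ac_stationary M T \<mu>"
    and "decay_of_correlations M T \<mu>"
    and "\<phi> \<in> BV"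
    and "(\<integral>x. \<phi> x \<partial>\<mu>) = 0"
    and "asymptotic_variance M T \<mu> \<phi> > 0"
    and "annealed_rate_function (chain_law M T \<mu>) \<phi> J I"
    and "\<alpha> \<in> J" and "\<alpha> > 0"
  shows "AE x in chain_law M T \<mu>.
    (\<lambda>n. MAX m\<in>{0..n - window I \<alpha> n}.
       birkhoff_sum \<phi> (window I \<alpha> n) ((left_shift ^^ m) x) / real (window I \<alpha> n)) \<longlonglongrightarrow> \<alpha>"
proof -
  interpret random_system M T by (rule assms(1))
  interpret stationary_chain M T \<mu> by unfold_locales (rule assms(5))
  note rate = assms(10) and \<alpha>J = assms(11) and \<alpha> = assms(12)
  obtain h where h: "integrable leb01 h" "\<And>x. 0 \<le> h x" "\<mu> = density leb01 (\<lambda>x. ennreal (h x))"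
    using ac_stationary_density[OF assms(5)] by blast
  obtain D0 where D0: "bv_bounded D0 h" using stationary_density_bv[OF assms(5) h assms(2,3)] by blast
  define D where "D = D0 + 1"
  have D: "0 < D" "bv_bounded D h"
    using bv_bounded_nonneg[OF D0] bv_bounded_mono[OF D0, of D] by (simp_all add: D_def)
  obtain C where C: "\<forall>f\<in>BV. annealed_transfer M T f \<in> BV"
    "\<forall>f\<in>BV. BV_norm (annealed_transfer M T f) \<le> C * BV_norm f"
    using assms(2) unfolding BV_bounded_operator_def by blast
  obtain C' r0 where C': "0 < C'" "r0 < 1"
    and decay0: "\<And>n f (g :: real \<Rightarrow> complex). f \<in> BV \<Longrightarrow> integrable \<mu> g \<Longrightarrow>
      cmod ((\<integral>x. f x * (annealed_koopman M T ^^ n) g x \<partial>\<mu>) - (\<integral>x. f x \<partial>\<mu>) * (\<integral>x. g x \<partial>\<mu>))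
          \<le> C' * r0 ^ n * BV_norm f * L1_norm \<mu> g"
    using assms(6) unfolding decay_of_correlations_def by blast
  have BV_norm_nonneg: "0 \<le> BV_norm f" for f :: "real \<Rightarrow> 'b::{banach, second_countable_topology}"
    by (simp add: BV_norm_def L1_norm_def)
  have L1_nonneg: "0 \<le> L1_norm \<mu> g" for g :: "real \<Rightarrow> complex" by (simp add: L1_norm_def)
  \<comment> \<open>a negative rate is excluded by testing the decay at \<open>n = 1\<close> on constants\<close>
  have r0: "0 \<le> r0"
  proof -
    have c1: "bv_bounded 1 (\<lambda>x. complex_of_real 1)"
      using bv_bounded_of_real[OF bv_bounded_const[of 1]] by simp
    then have "(\<lambda>x. 1 :: complex) \<in> BV" using bv_bounded_imp_BV(1) by simp
    then have "0 \<le> C' * r0 ^ 1 * BV_norm (\<lambda>x. 1 :: complex) * L1_norm \<mu> (\<lambda>x. 1 :: complex)"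
      by (intro order_trans[OF norm_ge_zero decay0]) simp_all
    moreover have "L1_norm \<mu> (\<lambda>x. 1 :: complex) = 1" by (simp add: L1_norm_def \<mu>.prob_space)
    moreover have "1 \<le> BV_norm (\<lambda>x. 1 :: complex)" by (simp add: BV_norm_def L1_norm_def leb01.prob_space[simplified])
    ultimately show ?thesis using C'(1) by (simp add: zero_le_mult_iff)
  qed
  \<comment> \<open>enlarging the rate keeps the estimate, and \<open>1 / 2\<close> could be any number in \<open>(0,1)\<close>\<close>
  define r where "r = max r0 (1 / 2)"
  have r: "0 < r" "r < 1" using C'(2) by (auto simp: r_def)
  have decay: "cmod ((\<integral>x. f x * (annealed_koopman M T ^^ n) g x \<partial>\<mu>) - (\<integral>x. f x \<partial>\<mu>) * (\<integral>x. g x \<partial>\<mu>))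
          \<le> C' * r ^ n * BV_norm f * L1_norm \<mu> g"
    if "f \<in> BV" "integrable \<mu> g" for n f and g :: "real \<Rightarrow> complex"
  proof -
    have "r0 ^ n \<le> r ^ n" using r0 by (intro power_mono) (simp_all add: r_def)
    then have "C' * r0 ^ n * BV_norm f * L1_norm \<mu> g \<le> C' * r ^ n * BV_norm f * L1_norm \<mu> g"
      using C'(1) BV_norm_nonneg[of f] L1_nonneg[of g] by (intro mult_right_mono mult_left_mono) auto
    then show ?thesis using decay0[OF that, of n] by linarith
  qed
  have mixing: "mixing_chain M T \<mu> C C' r D h"
    by unfold_locales (use C C' h D r decay in auto)
  define B where "B = BV_norm \<phi> + 1"
  have B: "0 < B" using BV_norm_nonneg[of \<phi>] by (simp add: B_def)
  have \<phi>: "bv_bounded B \<phi>" by (rule BV_imp_bv_bounded[OF assms(7)]) (simp add: B_def)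
  have \<phi>m: "\<phi> \<in> borel_measurable leb01" by (rule bv_bounded_measurable[OF \<phi>])
  \<comment> \<open>\<open>\<phi>\<close> is only essentially bounded, while the finite grid has to cover every value\<close>
  define \<psi> where "\<psi> x = max (- B) (min B (\<phi> x))" for x
  have \<psi>: "bv_bounded B \<psi>"
    unfolding \<psi>_def[abs_def] using \<phi>
    by (rule bv_bounded_lipschitz[where G="\<lambda>y. max (- B) (min B y)" and p=1]) (use B in auto)
  have \<psi>m: "\<psi> \<in> borel_measurable leb01" by (rule bv_bounded_measurable[OF \<psi>])
  have \<psi>B: "\<bar>\<psi> y\<bar> \<le> B" for y using B by (auto simp: \<psi>_def)
  have "AE x in leb01. \<phi> x = \<psi> x"
    using bv_bounded_AE[OF \<phi>] by eventually_elim (auto simp: \<psi>_def)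
  from AE_chain_eq[OF \<phi>m \<psi>m this]
  have eq: "AE p in chain. \<forall>l m. birkhoff_sum \<phi> l ((left_shift ^^ m) p) = birkhoff_sum \<psi> l ((left_shift ^^ m) p)"
    by eventually_elim (simp add: birkhoff_sum_eq left_shift_funpow)
  have meas_eq: "measure chain {p \<in> space chain. birkhoff_sum \<phi> n p > c} = measure chain {p \<in> space chain. birkhoff_sum \<psi> n p > c}" for n c
  proof (rule measure_eq_AE)
    show "AE p in chain. (p \<in> {p \<in> space chain. birkhoff_sum \<phi> n p > c}) = (p \<in> {p \<in> space chain. birkhoff_sum \<psi> n p > c})"
      using eq by eventually_elim (metis (mono_tags, lifting) funpow_0 mem_Collect_eq)
    show "{p \<in> space chain. birkhoff_sum \<phi> n p > c} \<in> sets chain" "{p \<in> space chain. birkhoff_sum \<psi> n p > c} \<in> sets chain"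
      using birkhoff_sum_measurable[OF \<phi>m, of n] birkhoff_sum_measurable[OF \<psi>m, of n] by measurable
  qed
  have rate\<psi>: "annealed_rate_function chain \<psi> J I"
    using rate unfolding annealed_rate_function_def meas_eq .
  have pos: "0 < I \<alpha>"
  proof -
    have "0 \<le> I \<alpha> \<and> (I \<alpha> = 0 \<longleftrightarrow> \<alpha> = 0)" using rate \<alpha>J unfolding annealed_rate_function_def by blast
    then show ?thesis using \<alpha> by linarith
  qed
  have lower: "AE p in chain. eventually (\<lambda>l. \<exists>m. real (m + l) \<le> exp (real l * I \<alpha>) \<and>
      birkhoff_sum \<phi> l ((left_shift ^^ m) p) > real l * \<gamma>) sequentially" if \<gamma>: "0 < \<gamma>" "\<gamma> < \<alpha>" for \<gamma>
  proof -
    \<comment> \<open>then \<open>\<gamma> + 2 * \<eta>\<close> is the midpoint of \<open>\<gamma>\<close> and \<open>\<alpha>\<close>\<close>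
    define \<eta> where "\<eta> = (\<alpha> - \<gamma>) / 4"
    have gap: "0 < \<eta>" "\<gamma> + 2 * \<eta> < \<alpha>" using \<gamma> by (simp_all add: \<eta>_def field_simps)
    define N where "N = \<lceil>B / \<eta>\<rceil>"
    interpret mixing_chain M T \<mu> C C' r D h by (rule mixing)
    interpret observed_chain M T \<mu> C C' r D h \<psi> \<eta> "B / \<eta> + 1" "{-N-1..N+1}"
    proof unfold_locales
      show "(\<Sum>i\<in>{-N-1..N+1}. hat (\<psi> y / \<eta> - of_int i)) = 1" for y
      proof (rule hat_partition_of_unity)
        have "\<bar>\<psi> y / \<eta>\<bar> = \<bar>\<psi> y\<bar> / \<eta>" using gap by simp
        also have "\<dots> \<le> B / \<eta>" using \<psi>B[of y] gap by (intro divide_right_mono) auto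
        also have "\<dots> \<le> of_int N" by (simp add: N_def)
        finally show "\<bar>\<psi> y / \<eta>\<bar> \<le> of_int N" .
      qed
      show "bv_bounded (B / \<eta> + 1) (\<lambda>y. hat (\<psi> y / \<eta> - of_int i))" for i
      proof (rule bv_bounded_lipschitz[where G="\<lambda>y. hat (y / \<eta> - of_int i)" and p="1 / \<eta>", OF \<psi>])
        show "\<bar>hat (y / \<eta> - of_int i)\<bar> \<le> B / \<eta> + 1" for y
          using hat_bounds[of "y / \<eta> - of_int i"] B gap by (simp add: add_increasing)
        show "\<bar>hat (y / \<eta> - of_int i) - hat (z / \<eta> - of_int i)\<bar> \<le> 1 / \<eta> * \<bar>y - z\<bar>" for y z
        proof -
          have "\<bar>y / \<eta> - z / \<eta>\<bar> = 1 / \<eta> * \<bar>y - z\<bar>" using gap by (simp flip: diff_divide_distrib)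
          then show ?thesis using hat_lipschitz[of "y / \<eta> - of_int i" "z / \<eta> - of_int i"] by simp
        qed
      qed (use gap B in \<open>auto intro: measurable_compose[OF _ hat_measurable]\<close>)
    qed (use gap B \<psi>m in \<open>auto intro: add_pos_pos\<close>)
    from AE_lower_bound[OF rate\<psi> \<alpha>J \<gamma>(1) gap(2)] eq show ?thesis
      by eventually_elim simp
  qed
  obtain e where e: "0 < e" "ball \<alpha> e \<subseteq> J"
    using rate \<alpha>J unfolding annealed_rate_function_def by (meson open_contains_ball)
  define \<beta> where "\<beta> k = \<alpha> + e * inverse (real (Suc (Suc k)))" for k
  define \<gamma> where "\<gamma> k = \<alpha> - \<alpha> * inverse (real (Suc (Suc k)))" for k
  have i: "0 < inverse (real (Suc (Suc k)))" "inverse (real (Suc (Suc k))) < 1" for k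
    by (simp_all add: inverse_less_1_iff)
  have lim0: "(\<lambda>k. inverse (real (Suc (Suc k)))) \<longlonglongrightarrow> 0"
    using LIMSEQ_Suc[OF LIMSEQ_inverse_real_of_nat] .
  have \<beta>_lim: "\<beta> \<longlonglongrightarrow> \<alpha>"
    using tendsto_add[OF tendsto_const tendsto_mult[OF tendsto_const lim0], of \<alpha> e] by (simp add: \<beta>_def[abs_def])
  have \<gamma>_lim: "\<gamma> \<longlonglongrightarrow> \<alpha>"
    using tendsto_diff[OF tendsto_const tendsto_mult[OF tendsto_const lim0], of \<alpha> \<alpha>] by (simp add: \<gamma>_def[abs_def])
  have \<beta>k: "\<alpha> < \<beta> k" "\<beta> k \<in> J" for k
  proof -
    show "\<alpha> < \<beta> k" using e(1) i[of k] by (simp add: \<beta>_def)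
    have "e * inverse (real (Suc (Suc k))) < e * 1" using e(1) i[of k] by (intro mult_strict_left_mono) auto
    then have "\<beta> k \<in> ball \<alpha> e" using e(1) i(1)[of k] by (simp add: \<beta>_def dist_real_def)
    then show "\<beta> k \<in> J" using e(2) by blast
  qed
  have \<gamma>k: "0 < \<gamma> k" "\<gamma> k < \<alpha>" for k
  proof -
    have "\<alpha> * inverse (real (Suc (Suc k))) < \<alpha> * 1" using \<alpha> i[of k] by (intro mult_strict_left_mono) auto
    then show "0 < \<gamma> k" by (simp add: \<gamma>_def)
    show "\<gamma> k < \<alpha>" using \<alpha> i[of k] by (simp add: \<gamma>_def)
  qed
  have "AE p in chain. \<forall>k. eventually (\<lambda>l. \<forall>m. real m \<le> exp (real (Suc l) * I \<alpha>) \<longrightarrow>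
      birkhoff_sum \<phi> l ((left_shift ^^ m) p) \<le> real l * \<beta> k) sequentially"
    unfolding AE_all_countable by (intro allI AE_upper_bound[OF \<phi>m rate \<alpha> \<beta>k])
  moreover have "AE p in chain. \<forall>k. eventually (\<lambda>l. \<exists>m. real (m + l) \<le> exp (real l * I \<alpha>) \<and>
      birkhoff_sum \<phi> l ((left_shift ^^ m) p) > real l * \<gamma> k) sequentially"
    unfolding AE_all_countable by (intro allI lower \<gamma>k)
  ultimately show ?thesis
  proof eventually_elim
    case (elim p)
    show ?case
    proof (rule window_maximum_tendsto[where I=I and \<alpha>=\<alpha> and \<beta>=\<beta> and \<gamma>=\<gamma>])
      show "eventually (\<lambda>l. \<forall>m. real m \<le> exp (real (Suc l) * I \<alpha>) \<longrightarrow>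
          birkhoff_sum \<phi> l ((left_shift ^^ m) p) \<le> real l * \<beta> k) sequentially" for k
        using elim(1) by blast
      show "eventually (\<lambda>l. \<exists>m. real (m + l) \<le> exp (real l * I \<alpha>) \<and>
          birkhoff_sum \<phi> l ((left_shift ^^ m) p) > real l * \<gamma> k) sequentially" for k
        using elim(2) by blast
    qed (rule pos \<beta>_lim \<gamma>_lim)+
  qed
qed

end
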